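(* Let $\mathbb{F}$ be a field. For any $\alpha\propto m$ and $\beta\propto n$ one has, in $G_0(\mathcal{H}_\bullet)$, \[ \mathbf{C}_\alpha\,\hat\otimes\,\mathbf{C}_\beta=\begin{cases}\mathbf{C}_{\alpha\beta}\oplus\mathbf{C}_{\alpha\rhd\beta}, & \text{if }\alpha\beta\propto m+n,\\ \mathbf{C}_{\alpha\rhd\beta}, & \text{otherwise,}\end{cases} \qquad\text{and}\qquad \Delta(\mathbf{C}_\alpha)=\sum_{0\le i\le m}\mathbf{C}_{\alpha_{\le i}}\otimes\mathbf{C}_{\alpha_{>i}}. \]
   Context: $\mathcal{H}_0:=\mathbb{F}$ and, for $n\ge1$, $\mathcal{H}_n$ is the commutative $\mathbb{F}$-algebra generated by $x_1,\ldots,x_{n-1}$ with relations $x_i^2=x_i$ ($1\le i\le n-1$) and $x_ix_{i+1}=0$ ($1\le i\le n-2$). A composition of $n$ is a sequence $\alpha=(\alpha_1,\ldots,\alpha_\ell)$ of positive integers with sum $n$ (empty composition $\emptyset$ for $n=0$); let $\sigma_i:=\alpha_1+\cdots+\alpha_i$ and $D(\alpha):=\{\sigma_1,\ldots,\sigma_{\ell-1}\}$. Write $\alpha\propto n$ if $\alpha$ is a composition of $n$ with $\alpha_i>1$ whenever $1<i<\ell$. For $\alpha\propto n$, $\mathbf{C}_\alpha$ is the one-dimensional $\mathcal{H}_n$-module on which $x_i$ acts by $1$ if $i\in D(\alpha)$ and by $0$ otherwise; these form a complete list of pairwise non-isomorphic simple modules of the semisimple algebra $\mathcal{H}_n$.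 $G_0(\mathcal{H}_n)$ is the Grothendieck group of finitely generated $\mathcal{H}_n$-modules and $G_0(\mathcal{H}_\bullet):=\bigoplus_{n\ge0}G_0(\mathcal{H}_n)$; modules are identified with their classes. For nonnegative integers $m$ and $n$, the subalgebra of $\mathcal{H}_{m+n}$ generated by $x_1,\ldots,x_{m-1},x_{m+1},\ldots,x_{m+n-1}$ is isomorphic to $\mathcal{H}_m\otimes\mathcal{H}_n$, giving an embedding $\mathcal{H}_m\otimes\mathcal{H}_n\hookrightarrow\mathcal{H}_{m+n}$. For $\alpha\propto m$, $\beta\propto n$, the product $\mathbf{C}_\alpha\,\hat\otimes\,\mathbf{C}_\beta$ is the induction $\mathcal{H}_{m+n}\otimes_{\mathcal{H}_m\otimes\mathcal{H}_n}(\mathbf{C}_\alpha\otimes\mathbf{C}_\beta)$, and the coproduct $\Delta(\mathbf{C}_\alpha)$ is the sum over $0\le i\le m$ of the restrictions of $\mathbf{C}_\alpha$ from $\mathcal{H}_m$ to $\mathcal{H}_i\otimes\mathcal{H}_{m-i}$. The unit sends $1$ to $\mathbf{C}_\emptyset$, and the counit sends $\mathbf{C}_\emptyset$ to $1$ and $\mathbf{C}_\alpha$ to $0$ for all $\alpha\propto n$, $n\ge1$. For compositions $\alpha=(\alpha_1,\ldots,\alpha_\ell)$ of $m$ and $\beta=(\beta_1,\ldots,\beta_k)$ of $n$: $\alpha\beta:=(\alpha_1,\ldots,\alpha_\ell,\beta_1,\ldots,\beta_k)$ and $\alpha\rhd\beta:=(\alpha_1,\ldots,\alpha_{\ell-1},\alpha_\ell+\beta_1,\beta_2,\ldots,\beta_k)$.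 For $0\le i\le m$, let $r$ be the largest integer with $\sigma_r\le i$ (where $\sigma_0=0$); then $\alpha_{\le i}:=(\alpha_1,\ldots,\alpha_r,i-\sigma_r)$, where $i-\sigma_r$ is omitted if it is $0$, and $\alpha_{>i}:=(\sigma_{r+1}-i,\alpha_{r+2},\ldots,\alpha_\ell)$ (empty if $i=m$).
   Formalization: If α or β is the empty composition, α▷β is undefined; in that case the product is stated to be C_{αβ} alone (the unit law), with no near-concatenation term. *)

theory Defs
  imports
    "HOL-Algebra.Module"
    "HOL-Algebra.QuotRing"
    "HOL-Algebra.Free_Abelian_Groups"
    "HOL-Algebra.Algebraic_Closure_Type"
begin

section \<open>Compositions\<close>

text \<open>Lists are indexed from 0, so the part \<open>\<alpha>\<^sub>i\<close>, \<open>1 \<le> i \<le> \<ell>\<close>, is \<open>\<alpha> ! (i - 1)\<close>.\<close>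

definition is_composition :: "nat list \<Rightarrow> nat \<Rightarrow> bool" where
  "is_composition \<alpha> n \<longleftrightarrow> (\<forall>a\<in>set \<alpha>. 0 < a) \<and> sum_list \<alpha> = n"

definition admissible :: "nat list \<Rightarrow> nat \<Rightarrow> bool" (infix "\<propto>" 50) where
  "\<alpha> \<propto> n \<longleftrightarrow> is_composition \<alpha> n \<and> (\<forall>i. 1 < i \<and> i < length \<alpha> \<longrightarrow> 1 < \<alpha> ! (i - 1))"

definition psum :: "nat list \<Rightarrow> nat \<Rightarrow> nat" where
  "psum \<alpha> i = sum_list (take i \<alpha>)"

definition descents :: "nat list \<Rightarrow> nat set" where
  "descents \<alpha> = {psum \<alpha> i |i. 1 \<le> i \<and> i < length \<alpha>}"

text \<open>Only meaningful when both arguments are nonempty.\<close>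

definition near_concat :: "nat list \<Rightarrow> nat list \<Rightarrow> nat list" (infixr "\<rhd>" 65) where
  "\<alpha> \<rhd> \<beta> = butlast \<alpha> @ (last \<alpha> + hd \<beta>) # tl \<beta>"

definition cut_index :: "nat list \<Rightarrow> nat \<Rightarrow> nat" where
  "cut_index \<alpha> i = (GREATEST r. r \<le> length \<alpha> \<and> psum \<alpha> r \<le> i)"

definition comp_le :: "nat list \<Rightarrow> nat \<Rightarrow> nat list" where
  "comp_le \<alpha> i =
     (let r = cut_index \<alpha> i
      in take r \<alpha> @ (if i - psum \<alpha> r = 0 then [] else [i - psum \<alpha> r]))"

definition comp_gt :: "nat list \<Rightarrow> nat \<Rightarrow> nat list" where
  "comp_gt \<alpha> i =
     (let r = cut_index \<alpha> i
      in if i = sum_list \<alpha> then [] else (psum \<alpha> (r + 1) - i) # drop (r + 1) \<alpha>)"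


section \<open>Modules\<close>

text \<open>
  Modules over a commutative ring are those of the locale \<^locale>\<open>module\<close>, on the record type
  \<^typ>\<open>('r, 'b) module\<close>.  That record also carries a multiplication and a unit, which are
  irrelevant for modules.
\<close>

definition mod_hom ::
    "('r, 'x) ring_scheme \<Rightarrow> ('r, 'b) module \<Rightarrow> ('r, 'c) module \<Rightarrow> ('b \<Rightarrow> 'c) set" where
  "mod_hom R M N =
     {h \<in> hom (add_monoid M) (add_monoid N).
        \<forall>r\<in>carrier R. \<forall>v\<in>carrier M. h (r \<odot>\<^bsub>M\<^esub> v) = r \<odot>\<^bsub>N\<^esub> h v}"

definition mod_iso ::
    "('r, 'x) ring_scheme \<Rightarrow> ('r, 'b) module \<Rightarrow> ('r, 'c) module \<Rightarrow> bool" where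
  "mod_iso R M N \<longleftrightarrow> (\<exists>h\<in>mod_hom R M N. bij_betw h (carrier M) (carrier N))"

definition fg_module :: "('r, 'x) ring_scheme \<Rightarrow> ('r, 'b) module \<Rightarrow> bool" where
  "fg_module R M \<longleftrightarrow> module R M \<and>
     (\<exists>U. finite U \<and> U \<subseteq> carrier M \<and>
        (\<forall>v\<in>carrier M. \<exists>c\<in>U \<rightarrow> carrier R. v = finsum M (\<lambda>x. c x \<odot>\<^bsub>M\<^esub> x) U))"

definition short_exact ::
    "('r, 'x) ring_scheme \<Rightarrow> ('r, 'b) module \<Rightarrow> ('r, 'c) module \<Rightarrow> ('r, 'd) module \<Rightarrow> bool" where
  "short_exact R L M N \<longleftrightarrow>
     (\<exists>f\<in>mod_hom R L M. \<exists>g\<in>mod_hom R M N.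
        inj_on f (carrier L) \<and> f ` carrier L = a_kernel M N g \<and> g ` carrier M = carrier N)"


section \<open>Grothendieck groups\<close>

text \<open>
  The Grothendieck group of finitely generated \<open>R\<close>-modules needs a set of modules containing a
  copy of each of them.  Every finitely generated \<open>R\<close>-module is a quotient of some \<open>R\<^sup>k\<close>, whose
  elements are cosets in \<open>R\<^sup>k\<close>; so modules with carrier in \<^typ>\<open>(nat \<Rightarrow> 'r) set\<close> suffice.
  The group operation is written multiplicatively, as always for \<^const>\<open>free_Abelian_group\<close>
  and \<^const>\<open>FactGroup\<close>.
\<close>

type_synonym 'r small_module = "('r, (nat \<Rightarrow> 'r) set) module"

definition fg_modules :: "('r, 'x) ring_scheme \<Rightarrow> 'r small_module set" where
  "fg_modules R = {M. fg_module R M}"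

definition exact_relations :: "('r, 'x) ring_scheme \<Rightarrow> ('r small_module \<Rightarrow>\<^sub>0 int) set" where
  "exact_relations R =
     generate (free_Abelian_group (fg_modules R))
       {frag_of M - frag_of L - frag_of N |L M N.
          L \<in> fg_modules R \<and> M \<in> fg_modules R \<and> N \<in> fg_modules R \<and> short_exact R L M N}"

definition G0 :: "('r, 'x) ring_scheme \<Rightarrow> ('r small_module \<Rightarrow>\<^sub>0 int) set monoid" where
  "G0 R = free_Abelian_group (fg_modules R) Mod exact_relations R"

text \<open>
  The class of a finitely generated module with arbitrary carrier type.  The choice of
  representative is immaterial: \<open>0 \<rightarrow> 0 \<rightarrow> M \<rightarrow> N \<rightarrow> 0\<close> is exact for isomorphic \<open>M\<close> and \<open>N\<close>.
\<close>

definition mod_class ::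
    "('r, 'x) ring_scheme \<Rightarrow> ('r, 'b) module \<Rightarrow> ('r small_module \<Rightarrow>\<^sub>0 int) set" where
  "mod_class R M =
     exact_relations R #>\<^bsub>free_Abelian_group (fg_modules R)\<^esub>
       frag_of (SOME N. N \<in> fg_modules R \<and> mod_iso R M N)"

definition summand_inj :: "('i \<Rightarrow> ('g, 'x) monoid_scheme) \<Rightarrow> 'i \<Rightarrow> 'g \<Rightarrow> 'i \<Rightarrow> 'g" where
  "summand_inj G i x = (\<lambda>j. if j = i then x else \<one>\<^bsub>G j\<^esub>)"


section \<open>Tensor products, restriction and induction\<close>

text \<open>
  For \<open>R\<close>-modules \<open>M\<close> and \<open>N\<close>, the group \<open>M \<otimes>\<^sub>R N\<close> is the free abelian group on \<open>M \<times> N\<close> modulo the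
  following relations.
\<close>

definition tensor_relations ::
    "('r, 'x) ring_scheme \<Rightarrow> ('r, 'b) module \<Rightarrow> ('r, 'c) module \<Rightarrow> ('b \<times> 'c \<Rightarrow>\<^sub>0 int) set" where
  "tensor_relations R M N =
     {frag_of (u \<oplus>\<^bsub>M\<^esub> u', v) - frag_of (u, v) - frag_of (u', v) |u u' v.
        u \<in> carrier M \<and> u' \<in> carrier M \<and> v \<in> carrier N} \<union>
     {frag_of (u, v \<oplus>\<^bsub>N\<^esub> v') - frag_of (u, v) - frag_of (u, v') |u v v'.
        u \<in> carrier M \<and> v \<in> carrier N \<and> v' \<in> carrier N} \<union>
     {frag_of (r \<odot>\<^bsub>M\<^esub> u, v) - frag_of (u, r \<odot>\<^bsub>N\<^esub> v) |r u v.
        r \<in> carrier R \<and> u \<in> carrier M \<and> v \<in> carrier N}"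

definition tensor_kernel ::
    "('r, 'x) ring_scheme \<Rightarrow> ('r, 'b) module \<Rightarrow> ('r, 'c) module \<Rightarrow> ('b \<times> 'c \<Rightarrow>\<^sub>0 int) set" where
  "tensor_kernel R M N =
     generate (free_Abelian_group (carrier M \<times> carrier N)) (tensor_relations R M N)"

definition tensor_group ::
    "('r, 'x) ring_scheme \<Rightarrow> ('r, 'b) module \<Rightarrow> ('r, 'c) module \<Rightarrow>
     ('b \<times> 'c \<Rightarrow>\<^sub>0 int) set monoid" where
  "tensor_group R M N =
     free_Abelian_group (carrier M \<times> carrier N) Mod tensor_kernel R M N"

definition tensor_coset ::
    "('r, 'x) ring_scheme \<Rightarrow> ('r, 'b) module \<Rightarrow> ('r, 'c) module \<Rightarrow>
     ('b \<times> 'c \<Rightarrow>\<^sub>0 int) \<Rightarrow> ('b \<times> 'c \<Rightarrow>\<^sub>0 int) set" where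
  "tensor_coset R M N f =
     tensor_kernel R M N #>\<^bsub>free_Abelian_group (carrier M \<times> carrier N)\<^esub> f"

definition module_on ::
    "'b monoid \<Rightarrow> ('r \<Rightarrow> 'b \<Rightarrow> 'b) \<Rightarrow> ('r, 'b) module" where
  "module_on G act =
     \<lparr>carrier = carrier G, monoid.mult = undefined, monoid.one = undefined,
      ring.zero = \<one>\<^bsub>G\<^esub>, ring.add = monoid.mult G, module.smult = act\<rparr>"

text \<open>Restriction of scalars along a ring homomorphism \<open>\<phi>\<close> into the ring acting on \<open>M\<close>.\<close>

definition restrict_scalars :: "('s \<Rightarrow> 'r) \<Rightarrow> ('r, 'b) module \<Rightarrow> ('s, 'b) module" where
  "restrict_scalars \<phi> M =
     \<lparr>carrier = carrier M, monoid.mult = monoid.mult M, monoid.one = monoid.one M,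
      ring.zero = ring.zero M, ring.add = ring.add M, module.smult = (\<lambda>s v. \<phi> s \<odot>\<^bsub>M\<^esub> v)\<rparr>"

definition regular_module :: "('r, 'x) ring_scheme \<Rightarrow> ('r, 'r) module" where
  "regular_module A =
     \<lparr>carrier = carrier A, monoid.mult = monoid.mult A, monoid.one = monoid.one A,
      ring.zero = ring.zero A, ring.add = ring.add A, module.smult = monoid.mult A\<rparr>"

text \<open>
  Induction \<open>A \<otimes>\<^sub>B M\<close> of a \<open>B\<close>-module along a homomorphism \<open>\<phi> : B \<rightarrow> A\<close> of commutative rings,
  with \<open>a \<cdot> (a' \<otimes> v) = a a' \<otimes> v\<close>.  The union ranges over all representatives of a coset;
  they all give the same result.
\<close>

definition induced_module ::
    "('s, 'y) ring_scheme \<Rightarrow> ('r, 'x) ring_scheme \<Rightarrow> ('s \<Rightarrow> 'r) \<Rightarrow> ('s, 'b) module \<Rightarrow>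
     ('r, ('r \<times> 'b \<Rightarrow>\<^sub>0 int) set) module" where
  "induced_module B A \<phi> M =
     (let A' = restrict_scalars \<phi> (regular_module A) in
      module_on (tensor_group B A' M)
        (\<lambda>a Y. \<Union>g\<in>Y. tensor_coset B A' M
                  (frag_extend (\<lambda>(a', v). frag_of (a \<otimes>\<^bsub>A\<^esub> a', v)) g)))"

text \<open>
  The tensor product of two commutative \<open>K\<close>-algebras, given as records with the scalar
  multiplication of \<open>K\<close> (see \<^locale>\<open>algebra\<close>).  The monoid ring \<open>\<int>[A \<times> B]\<close> has the free abelian
  group on \<open>A \<times> B\<close> as additive group and satisfies \<open>(a, b) (a', b') = (a a', b b')\<close>, so dividing
  by the ideal of tensor relations gives the usual multiplication on \<open>A \<otimes>\<^sub>K B\<close>.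
\<close>

definition int_monoid_ring :: "('m, 'x) monoid_scheme \<Rightarrow> ('m \<Rightarrow>\<^sub>0 int) ring" where
  "int_monoid_ring S =
     \<lparr>carrier = {f. Poly_Mapping.keys f \<subseteq> carrier S},
      monoid.mult = (\<lambda>f g. frag_extend (\<lambda>x. frag_extend (\<lambda>y. frag_of (x \<otimes>\<^bsub>S\<^esub> y)) g) f),
      monoid.one = frag_of \<one>\<^bsub>S\<^esub>, ring.zero = 0, ring.add = (+)\<rparr>"

definition algebra_tensor ::
    "('k, 'x) ring_scheme \<Rightarrow> ('k, 'r) module \<Rightarrow> ('k, 's) module \<Rightarrow>
     ('r \<times> 's \<Rightarrow>\<^sub>0 int) set ring" where
  "algebra_tensor K A B =
     (let Z = int_monoid_ring (A \<times>\<times> B) in Z Quot (Idl\<^bsub>Z\<^esub> (tensor_relations K A B)))"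

text \<open>A module over a \<open>K\<close>-algebra \<open>A\<close>, regarded as a module over \<open>K\<close>.\<close>

definition base_module :: "('k, 'r) module \<Rightarrow> ('r, 'b) module \<Rightarrow> ('k, 'b) module" where
  "base_module A M = restrict_scalars (\<lambda>c. c \<odot>\<^bsub>A\<^esub> \<one>\<^bsub>A\<^esub>) M"

text \<open>
  For an \<open>A\<close>-module \<open>M\<close> and a \<open>B\<close>-module \<open>N\<close>, the \<open>(A \<otimes>\<^sub>K B)\<close>-module \<open>M \<otimes>\<^sub>K N\<close> with
  \<open>(a \<otimes> b) \<cdot> (u \<otimes> v) = a u \<otimes> b v\<close>.
\<close>

definition outer_tensor ::
    "('k, 'x) ring_scheme \<Rightarrow> ('k, 'r) module \<Rightarrow> ('k, 's) module \<Rightarrow>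
     ('r, 'b) module \<Rightarrow> ('s, 'c) module \<Rightarrow>
     (('r \<times> 's \<Rightarrow>\<^sub>0 int) set, ('b \<times> 'c \<Rightarrow>\<^sub>0 int) set) module" where
  "outer_tensor K A B M N =
     (let M' = base_module A M; N' = base_module B N in
      module_on (tensor_group K M' N')
        (\<lambda>U Y. \<Union>f\<in>U. \<Union>g\<in>Y. tensor_coset K M' N'
           (frag_extend (\<lambda>(a, b). frag_extend (\<lambda>(u, v). frag_of (a \<odot>\<^bsub>M\<^esub> u, b \<odot>\<^bsub>N\<^esub> v)) g) f)))"


section \<open>The algebras \<open>\<H>\<^sub>n\<close>\<close>

text \<open>
  The field \<open>\<F>\<close> is an arbitrary type of class \<^class>\<open>field\<close>.  Multivariate polynomials in
  \<open>x\<^sub>0, x\<^sub>1, \<dots>\<close> are finitely supported functions on monomials, with the library's convolution product.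
\<close>

type_synonym 'a mpoly = "(nat \<Rightarrow>\<^sub>0 nat) \<Rightarrow>\<^sub>0 'a"

definition Var :: "nat \<Rightarrow> 'a::field mpoly" where
  "Var i = Poly_Mapping.single (Poly_Mapping.single i 1) 1"

definition Const :: "'a::field \<Rightarrow> 'a mpoly" where
  "Const c = Poly_Mapping.single 0 c"

text \<open>Substitute \<open>v i\<close> for \<open>x\<^sub>i\<close> and map the coefficients by \<open>h\<close>.\<close>

definition poly_subst ::
    "('a::field \<Rightarrow> 'b::comm_ring_1) \<Rightarrow> (nat \<Rightarrow> 'b) \<Rightarrow> 'a mpoly \<Rightarrow> 'b" where
  "poly_subst h v p =
     (\<Sum>t\<in>Poly_Mapping.keys p. h (Poly_Mapping.lookup p t) *
        (\<Prod>i\<in>Poly_Mapping.keys t. v i ^ Poly_Mapping.lookup t i))"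

text \<open>The polynomial ring \<open>\<F>[x\<^sub>1, \<dots>, x\<^sub>n\<^sub>-\<^sub>1]\<close>; it is \<open>\<F>\<close> for \<open>n = 0\<close>.\<close>

definition H_poly_ring :: "nat \<Rightarrow> 'a::field mpoly ring" where
  "H_poly_ring n =
     \<lparr>carrier = {p. \<forall>t\<in>Poly_Mapping.keys p. Poly_Mapping.keys t \<subseteq> {1..<n}},
      monoid.mult = (*), monoid.one = 1, ring.zero = 0, ring.add = (+)\<rparr>"

definition H_ideal :: "nat \<Rightarrow> 'a::field mpoly set" where
  "H_ideal n =
     Idl\<^bsub>H_poly_ring n\<^esub>
       ({Var i ^ 2 - Var i |i. 1 \<le> i \<and> i < n} \<union> {Var i * Var (i + 1) |i. 1 \<le> i \<and> i + 1 < n})"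

definition H_coset :: "nat \<Rightarrow> 'a::field mpoly \<Rightarrow> 'a mpoly set" where
  "H_coset n p = H_ideal n +>\<^bsub>H_poly_ring n\<^esub> p"

text \<open>
  \<open>\<H>\<^sub>n\<close> as an \<open>\<F>\<close>-algebra.  For \<open>n = 0\<close> there are no variables and no relations, so the quotient is
  (a copy of) \<open>\<F>\<close>.
\<close>

definition H :: "nat \<Rightarrow> ('a::field, 'a mpoly set) module" where
  "H n =
     (let Q = H_poly_ring n Quot H_ideal n in
      \<lparr>carrier = carrier Q, monoid.mult = monoid.mult Q, monoid.one = monoid.one Q,
       ring.zero = ring.zero Q, ring.add = ring.add Q, module.smult = (\<lambda>c U. H_coset n (Const c) \<otimes>\<^bsub>Q\<^esub> U)\<rparr>)"

type_synonym 'a H2_elem = "('a mpoly set \<times> 'a mpoly set \<Rightarrow>\<^sub>0 int) set"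

definition H2 :: "nat \<Rightarrow> nat \<Rightarrow> 'a::field H2_elem ring" where
  "H2 m n = algebra_tensor (ring_of_type_algebra :: 'a ring) (H m) (H n)"

text \<open>The algebra homomorphism \<open>\<H>\<^sub>n \<rightarrow> \<H>\<^sub>N\<close> with \<open>x\<^sub>i \<mapsto> x\<^bsub>i+k\<^esub>\<close>, for \<open>n + k \<le> N\<close>.\<close>

definition H_shift :: "nat \<Rightarrow> nat \<Rightarrow> 'a::field mpoly set \<Rightarrow> 'a mpoly set" where
  "H_shift N k U = the_elem ((\<lambda>p. H_coset N (poly_subst Const (\<lambda>i. Var (i + k)) p)) ` U)"

text \<open>
  The embedding \<open>\<H>\<^sub>m \<otimes> \<H>\<^sub>n \<rightarrow> \<H>\<^bsub>m+n\<^esub>\<close> with \<open>x\<^sub>i \<otimes> 1 \<mapsto> x\<^sub>i\<close> and \<open>1 \<otimes> x\<^sub>j \<mapsto> x\<^bsub>m+j\<^esub>\<close>.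
\<close>

definition H_embed :: "nat \<Rightarrow> nat \<Rightarrow> 'a::field H2_elem \<Rightarrow> 'a mpoly set" where
  "H_embed m n U =
     the_elem ((\<lambda>f. finsum (H (m + n))
       (\<lambda>(a, b). add_pow (H (m + n)) (Poly_Mapping.lookup f (a, b))
          (H_shift (m + n) 0 a \<otimes>\<^bsub>H (m + n)\<^esub> H_shift (m + n) m b))
       (Poly_Mapping.keys f)) ` U)"

text \<open>
  The simple module \<open>C\<^sub>\<alpha>\<close>: the coset of \<open>p\<close> acts on \<open>\<F>\<close> as multiplication by the value of \<open>p\<close> where
  \<open>x\<^sub>i = 1\<close> for \<open>i \<in> D(\<alpha>)\<close> and \<open>x\<^sub>i = 0\<close> otherwise.
\<close>

definition simple_module :: "nat list \<Rightarrow> ('a::field mpoly set, 'a) module" where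
  "simple_module \<alpha> =
     \<lparr>carrier = UNIV, monoid.mult = undefined, monoid.one = undefined, ring.zero = 0, ring.add = (+),
      module.smult = (\<lambda>U v. the_elem (poly_subst id (\<lambda>i. if i \<in> descents \<alpha> then 1 else 0) ` U) * v)\<rparr>"

definition H_tensor ::
    "nat \<Rightarrow> nat \<Rightarrow> ('a::field mpoly set, 'b) module \<Rightarrow> ('a mpoly set, 'c) module \<Rightarrow>
     ('a H2_elem, ('b \<times> 'c \<Rightarrow>\<^sub>0 int) set) module" where
  "H_tensor m n M N = outer_tensor (ring_of_type_algebra :: 'a ring) (H m) (H n) M N"


section \<open>Product and coproduct\<close>

type_synonym 'a G0_elem = "nat \<Rightarrow> ('a mpoly set small_module \<Rightarrow>\<^sub>0 int) set"
type_synonym 'a G02_elem = "nat \<times> nat \<Rightarrow> ('a H2_elem small_module \<Rightarrow>\<^sub>0 int) set"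

definition G0_H :: "'a::field G0_elem monoid" where
  "G0_H = sum_group UNIV (\<lambda>n. G0 (H n :: ('a, 'a mpoly set) module))"

text \<open>The class in \<open>G\<^sub>0(\<H>\<^sub>\<bullet>)\<close> of an \<open>\<H>\<^sub>n\<close>-module.\<close>

definition H_class :: "nat \<Rightarrow> ('a::field mpoly set, 'b) module \<Rightarrow> 'a G0_elem" where
  "H_class n M =
     summand_inj (\<lambda>n. G0 (H n :: ('a, 'a mpoly set) module)) n
       (mod_class (H n :: ('a, 'a mpoly set) module) M)"

text \<open>
  The direct sum of the groups \<open>G\<^sub>0(\<H>\<^sub>i \<otimes> \<H>\<^sub>j)\<close>, in which the coproduct takes its values; it is
  identified with \<open>G\<^sub>0(\<H>\<^sub>\<bullet>) \<otimes> G\<^sub>0(\<H>\<^sub>\<bullet>)\<close> by letting \<open>[M] \<otimes> [N]\<close> be the class of the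
  \<open>(\<H>\<^sub>i \<otimes> \<H>\<^sub>j)\<close>-module \<open>M \<otimes> N\<close>.
\<close>

definition G0_H2 :: "'a::field G02_elem monoid" where
  "G0_H2 = sum_group UNIV (\<lambda>(i, j). G0 (H2 i j :: 'a H2_elem ring))"

definition H2_class :: "nat \<Rightarrow> nat \<Rightarrow> ('a::field H2_elem, 'b) module \<Rightarrow> 'a G02_elem" where
  "H2_class i j M =
     summand_inj (\<lambda>(i, j). G0 (H2 i j :: 'a H2_elem ring)) (i, j)
       (mod_class (H2 i j :: 'a H2_elem ring) M)"

definition H_product ::
    "nat \<Rightarrow> nat \<Rightarrow> ('a::field mpoly set, 'b) module \<Rightarrow> ('a mpoly set, 'c) module \<Rightarrow> 'a G0_elem"
where
  "H_product m n M N =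
     H_class (m + n)
       (induced_module (H2 m n) (H (m + n) :: ('a, 'a mpoly set) module) (H_embed m n)
          (H_tensor m n M N))"

definition H_coproduct :: "nat \<Rightarrow> ('a::field mpoly set, 'b) module \<Rightarrow> 'a G02_elem" where
  "H_coproduct m M =
     finprod G0_H2 (\<lambda>i. H2_class i (m - i) (restrict_scalars (H_embed i (m - i)) M)) {0..m}"

end

theory Submission
  imports Defs "HOL-Library.Product_Plus"
begin

text \<open>
  The characters of \<open>\<H>\<^sub>n\<close> are the evaluations at the points of \<open>{0, 1}\<^sup>n\<^sup>-\<^sup>1\<close> without two
  adjacent ones, and \<open>C\<^sub>\<alpha>\<close> belongs to the indicator of \<open>D(\<alpha>)\<close>.  Restriction to \<open>\<H>\<^sub>i \<otimes> \<H>\<^sub>m\<^sub>-\<^sub>i\<close> cuts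
  the point at position \<open>i\<close>, which gives the coproduct.  Conversely \<open>C\<^sub>\<alpha> \<otimes> C\<^sub>\<beta>\<close> fixes every coordinate
  except the \<open>m\<close>-th: the induced module is generated by \<open>w = 1 \<otimes> 1\<close>, every \<open>x\<^sub>i\<close> with \<open>i \<noteq> m\<close> acts on
  \<open>w\<close> by a scalar and \<open>x\<^sub>m\<close> is idempotent, so it is spanned by \<open>w\<close> and \<open>x\<^sub>m w\<close>.  It is two-dimensional
  exactly if both completions of the point are admissible; otherwise \<open>x\<^sub>m w = x\<^sub>m x\<^sub>j w = 0\<close> for a
  neighbour \<open>j\<close> of \<open>m\<close>.
\<close>

section \<open>Polynomial substitution\<close>

text \<open>Elements of a tensor product are here cosets of formal integer sums, so dimensions
  cannot be read off from bases. Each identification instead exhibits an additive evaluation of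
  formal sums whose kernel is exactly the group generated by the tensor relations. That the
  relations evaluate to 0 is a direct check. The converse is the obstacle, and it is met by reducing
  every formal sum to one pure tensor: the right-hand factor is always generated by a single
  element, so scalars can be moved to the left and the summands collected. For induction the
  left-hand factor is then a polynomial, and the question becomes whether it annihilates the
  generator; its values at the completions of the point decide this. A second obstacle is that
  classes in \<open>G0\<close> are formed from chosen modules on a fixed type. Isomorphic modules
  lead to the same choice at once, but additivity along a short exact sequence requires small copies
  of the modules to exist, which is shown for the models on the field and on its square.\<close>

locale coeff_hom =
  fixes h :: "'a::field \<Rightarrow> 'b::comm_ring_1"
  assumes h_one: "h 1 = 1"
    and h_add: "h (a + b) = h a + h b"
    and h_mult: "h (a * b) = h a * h b"
begin

lemma h_zero: "h 0 = 0"
  using h_add[of 0 0] by simp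

definition monomial_value :: "(nat \<Rightarrow> 'b) \<Rightarrow> (nat \<Rightarrow>\<^sub>0 nat) \<Rightarrow> 'b" where
  "monomial_value v t = (\<Prod>i\<in>Poly_Mapping.keys t. v i ^ Poly_Mapping.lookup t i)"

lemma monomial_value_superset:
  assumes "finite A" "Poly_Mapping.keys t \<subseteq> A"
  shows "monomial_value v t = (\<Prod>i\<in>A. v i ^ Poly_Mapping.lookup t i)"
  unfolding monomial_value_def
  by (rule prod.mono_neutral_left) (use assms in \<open>auto simp: in_keys_iff\<close>)

lemma monomial_value_add: "monomial_value v (s + t) = monomial_value v s * monomial_value v t"
proof -
  let ?A = "Poly_Mapping.keys s \<union> Poly_Mapping.keys t"
  have "Poly_Mapping.keys (s + t) \<subseteq> ?A" by (rule keys_add)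
  then have "monomial_value v (s + t) = (\<Prod>i\<in>?A. v i ^ Poly_Mapping.lookup (s + t) i)"
    by (intro monomial_value_superset) auto
  also have "\<dots> = (\<Prod>i\<in>?A. v i ^ Poly_Mapping.lookup s i) * (\<Prod>i\<in>?A. v i ^ Poly_Mapping.lookup t i)"
    by (simp add: lookup_add power_add prod.distrib)
  also have "\<dots> = monomial_value v s * monomial_value v t"
    by (simp add: monomial_value_superset[of ?A])
  finally show ?thesis .
qed

text \<open>Enlarging the index set is harmless because \<open>h\<close> sends 0 to 0; polynomials
  with different supports can then be compared term by term.\<close>

lemma poly_subst_superset:
  assumes "finite A" "Poly_Mapping.keys p \<subseteq> A"
  shows "poly_subst h v p = (\<Sum>t\<in>A. h (Poly_Mapping.lookup p t) * monomial_value v t)"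
  unfolding poly_subst_def monomial_value_def[symmetric]
  by (rule sum.mono_neutral_left) (use assms in \<open>auto simp: in_keys_iff h_zero\<close>)

lemma poly_subst_add: "poly_subst h v (p + q) = poly_subst h v p + poly_subst h v q"
proof -
  let ?A = "Poly_Mapping.keys p \<union> Poly_Mapping.keys q"
  have "Poly_Mapping.keys (p + q) \<subseteq> ?A" by (rule keys_add)
  then have "poly_subst h v (p + q) = (\<Sum>t\<in>?A. h (Poly_Mapping.lookup (p + q) t) * monomial_value v t)"
    by (intro poly_subst_superset) auto
  also have "\<dots> = poly_subst h v p + poly_subst h v q"
    by (simp add: lookup_add h_add distrib_right sum.distrib poly_subst_superset[of ?A])
  finally show ?thesis .
qed

lemma poly_subst_single: "poly_subst h v (Poly_Mapping.single t c) = h c * monomial_value v t"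
  by (subst poly_subst_superset[of "{t}"]) auto

lemma poly_subst_zero: "poly_subst h v 0 = 0"
  by (simp add: poly_subst_def)

lemma poly_subst_uminus: "poly_subst h v (- p) = - poly_subst h v p"
  using poly_subst_add[of v p "- p"] by (simp add: poly_subst_zero eq_neg_iff_add_eq_0 add.commute)

lemma poly_subst_diff: "poly_subst h v (p - q) = poly_subst h v p - poly_subst h v q"
  using poly_subst_add[of v p "- q"] by (simp add: poly_subst_uminus)

lemma poly_subst_Const: "poly_subst h v (Const c) = h c"
  by (simp add: Const_def poly_subst_single monomial_value_def)

lemma poly_subst_one: "poly_subst h v 1 = 1"
  using poly_subst_Const[of v 1] by (simp add: Const_def h_one)

lemma poly_subst_Var: "poly_subst h v (Var i) = v i"
  by (simp add: Var_def poly_subst_single monomial_value_def h_one)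

end

lemma poly_mapping_sum_singles:
  fixes p :: "'k \<Rightarrow>\<^sub>0 'b::comm_monoid_add"
  shows "p = (\<Sum>t\<in>Poly_Mapping.keys p. Poly_Mapping.single t (Poly_Mapping.lookup p t))"
  by (rule poly_mapping_eqI) (auto simp: lookup_sum lookup_single when_def in_keys_iff)

lemma poly_mapping_single_induct [case_names single add]:
  fixes p :: "'k \<Rightarrow>\<^sub>0 'b::comm_monoid_add"
  assumes "\<And>t c. P (Poly_Mapping.single t c)"
    and "\<And>p q. P p \<Longrightarrow> P q \<Longrightarrow> P (p + q)"
  shows "P p"
proof -
  have "P (\<Sum>t\<in>A. Poly_Mapping.single t (Poly_Mapping.lookup p t))" if "finite A" for A
    using that
  proof (induction A)
    case empty
    then show ?case using assms(1)[of undefined 0] by simp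
  next
    case (insert t A)
    then show ?case by (simp add: assms)
  qed
  then have "P (\<Sum>t\<in>Poly_Mapping.keys p. Poly_Mapping.single t (Poly_Mapping.lookup p t))"
    by simp
  then show ?thesis by (simp flip: poly_mapping_sum_singles)
qed

context coeff_hom begin

text \<open>Both sides are additive in \<open>p\<close> and in \<open>q\<close>, so only products of
  two monomials remain, where exponents add.\<close>

lemma poly_subst_mult: "poly_subst h v (p * q) = poly_subst h v p * poly_subst h v q"
proof (induction p rule: poly_mapping_single_induct)
  case (single s a)
  show ?case
    by (induction q rule: poly_mapping_single_induct)
      (simp_all add: mult_single poly_subst_single monomial_value_add h_mult
        distrib_left poly_subst_add mult.assoc mult.left_commute)
next
  case (add p q)
  then show ?case by (simp add: distrib_right poly_subst_add)
qed

lemma poly_subst_power: "poly_subst h v (p ^ k) = poly_subst h v p ^ k"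
  by (induction k) (simp_all add: poly_subst_one poly_subst_mult)

lemmas poly_subst_simps = poly_subst_zero poly_subst_one poly_subst_add poly_subst_uminus
  poly_subst_diff poly_subst_mult poly_subst_power poly_subst_Const poly_subst_Var

end

text \<open>The two instances in use: \<open>id\<close> evaluates a polynomial at a point of the
  field, \<open>Const\<close> renames its variables inside a polynomial ring.\<close>

interpretation id_hom: coeff_hom id
  by standard auto

interpretation Const_hom: coeff_hom Const
  by standard (auto simp: Const_def single_add mult_single)

lemma Const_inj: "inj Const"
  by (metis Const_def injI lookup_single_eq)

definition eval_at :: "(nat \<Rightarrow> 'a) \<Rightarrow> 'a::field mpoly \<Rightarrow> 'a" where
  "eval_at v p = poly_subst id v p"

lemma eval_at_simps:
  "eval_at v 0 = 0" "eval_at v 1 = 1" "eval_at v (p + q) = eval_at v p + eval_at v q"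
  "eval_at v (- p) = - eval_at v p" "eval_at v (p - q) = eval_at v p - eval_at v q"
  "eval_at v (p * q) = eval_at v p * eval_at v q" "eval_at v (p ^ k) = eval_at v p ^ k"
  "eval_at v (Const c) = c" "eval_at v (Var i) = v i"
  unfolding eval_at_def id_hom.poly_subst_simps id_apply by (rule refl)+

section \<open>The polynomial ring in the variables of index 1 to \<open>n - 1\<close>\<close>

lemma H_poly_ring_simps [simp]:
  "monoid.mult (H_poly_ring n) = (*)" "\<one>\<^bsub>H_poly_ring n\<^esub> = 1"
  "\<zero>\<^bsub>H_poly_ring n\<^esub> = 0" "add (H_poly_ring n) = (+)"
  by (simp_all add: H_poly_ring_def)

lemma in_H_poly_ring:
  "p \<in> carrier (H_poly_ring n) \<longleftrightarrow> (\<forall>t\<in>Poly_Mapping.keys p. Poly_Mapping.keys t \<subseteq> {1..<n})"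
  by (simp add: H_poly_ring_def)

lemma H_poly_zero: "0 \<in> carrier (H_poly_ring n)"
  by (simp add: in_H_poly_ring)

lemma H_poly_Const: "Const c \<in> carrier (H_poly_ring n)"
  by (simp add: in_H_poly_ring Const_def)

lemma H_poly_one: "1 \<in> carrier (H_poly_ring n)"
  by (simp add: in_H_poly_ring)

lemma H_poly_Var: "i \<in> {1..<n} \<Longrightarrow> Var i \<in> carrier (H_poly_ring n)"
  by (simp add: in_H_poly_ring Var_def)

lemma H_poly_add:
  "p \<in> carrier (H_poly_ring n) \<Longrightarrow> q \<in> carrier (H_poly_ring n) \<Longrightarrow> p + q \<in> carrier (H_poly_ring n)"
  unfolding in_H_poly_ring using keys_add[of p q] by blast

lemma H_poly_uminus: "p \<in> carrier (H_poly_ring n) \<Longrightarrow> - p \<in> carrier (H_poly_ring n)"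
  unfolding in_H_poly_ring by (auto simp: in_keys_iff)

lemma H_poly_diff:
  "p \<in> carrier (H_poly_ring n) \<Longrightarrow> q \<in> carrier (H_poly_ring n) \<Longrightarrow> p - q \<in> carrier (H_poly_ring n)"
  using H_poly_add[of p n "- q"] H_poly_uminus[of q n] by simp

lemma H_poly_mult:
  assumes "p \<in> carrier (H_poly_ring n)" "q \<in> carrier (H_poly_ring n)"
  shows "p * q \<in> carrier (H_poly_ring n)"
  unfolding in_H_poly_ring
proof
  fix t assume "t \<in> Poly_Mapping.keys (p * q)"
  then obtain a b where "t = a + b" "a \<in> Poly_Mapping.keys p" "b \<in> Poly_Mapping.keys q"
    using keys_mult[of p q] by blast
  then show "Poly_Mapping.keys t \<subseteq> {1..<n}"
    using assms keys_add[of a b] unfolding in_H_poly_ring by blast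
qed

lemmas H_poly_closed = H_poly_zero H_poly_one H_poly_Const H_poly_Var H_poly_add H_poly_uminus
  H_poly_diff H_poly_mult

lemma H_poly_ring_cring: "cring (H_poly_ring n)"
proof (rule cringI)
  show "abelian_group (H_poly_ring n)"
  proof (rule abelian_groupI)
    show "\<exists>y\<in>carrier (H_poly_ring n). y \<oplus>\<^bsub>H_poly_ring n\<^esub> x = \<zero>\<^bsub>H_poly_ring n\<^esub>"
      if "x \<in> carrier (H_poly_ring n)" for x
      using H_poly_uminus[OF that] by (intro bexI[of _ "- x"]) auto
  qed (auto simp: H_poly_closed ac_simps)
  show "Group.comm_monoid (H_poly_ring n)"
    by (rule comm_monoidI) (auto simp: H_poly_closed ac_simps)
qed (auto simp: distrib_right)

text \<open>Induction on the degree of monomials, peeling off one variable at a time. The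
  \<open>Var\<close> case keeps the cofactor in the ring, so that the variables can be made to act
  one after another.\<close>

lemma H_poly_induct [consumes 1, case_names Const Var add]:
  assumes p: "p \<in> carrier (H_poly_ring n)"
    and Const: "\<And>c. P (Const c)"
    and Var: "\<And>i q. i \<in> {1..<n} \<Longrightarrow> q \<in> carrier (H_poly_ring n) \<Longrightarrow> P q \<Longrightarrow> P (Var i * q)"
    and add: "\<And>p q. p \<in> carrier (H_poly_ring n) \<Longrightarrow> q \<in> carrier (H_poly_ring n) \<Longrightarrow>
      P p \<Longrightarrow> P q \<Longrightarrow> P (p + q)"
  shows "P p"
proof -
  have mono: "P (Poly_Mapping.single t c)" if "Poly_Mapping.keys t \<subseteq> {1..<n}" for t c
    using that
  proof (induction "\<Sum>i\<in>Poly_Mapping.keys t. Poly_Mapping.lookup t i" arbitrary: t rule: less_induct)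
    case less
    show ?case
    proof (cases "t = 0")
      case True
      then show ?thesis using Const[of c] by (simp add: Const_def)
    next
      case False
      then obtain i where i: "i \<in> Poly_Mapping.keys t"
        by (metis poly_mapping_eqI lookup_zero in_keys_iff)
      define s where "s = t - Poly_Mapping.single i 1"
      \<comment> \<open>Exponents are subtracted in the natural numbers; since \<open>i\<close>
        occurs in \<open>t\<close>, nothing is cut off.\<close>
      have t: "t = Poly_Mapping.single i 1 + s"
        using i by (intro poly_mapping_eqI)
          (auto simp: s_def lookup_add lookup_minus lookup_single when_def in_keys_iff)
      have sub: "Poly_Mapping.keys s \<subseteq> Poly_Mapping.keys t"
        by (auto simp: t in_keys_iff lookup_add)
      \<comment> \<open>The exponent of \<open>i\<close> may drop to 0, so the degree of
        \<open>s\<close> is summed over the support of \<open>t\<close> before the two degrees are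
        compared.\<close>
      have "(\<Sum>j\<in>Poly_Mapping.keys s. Poly_Mapping.lookup s j)
          = (\<Sum>j\<in>Poly_Mapping.keys t. Poly_Mapping.lookup s j)"
        by (rule sum.mono_neutral_left) (use sub in \<open>auto simp: in_keys_iff\<close>)
      also have "\<dots> < (\<Sum>j\<in>Poly_Mapping.keys t. Poly_Mapping.lookup t j)"
        by (rule sum_strict_mono_ex1) (use i in \<open>auto simp: t lookup_add intro: bexI[of _ i]\<close>)
      finally have "P (Poly_Mapping.single s c)"
        using less sub by blast
      moreover have "Poly_Mapping.single t c = Var i * Poly_Mapping.single s c"
        by (simp add: Var_def mult_single t)
      moreover have "i \<in> {1..<n}" "Poly_Mapping.single s c \<in> carrier (H_poly_ring n)"
        using i less.prems sub by (auto simp: in_H_poly_ring)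
      ultimately show ?thesis using Var by simp
    qed
  qed
  \<comment> \<open>Membership is carried along because the case \<open>add\<close> asks for both
    summands to lie in the ring.\<close>
  have "(\<Sum>t\<in>A. Poly_Mapping.single t (Poly_Mapping.lookup p t)) \<in> carrier (H_poly_ring n) \<and>
     P (\<Sum>t\<in>A. Poly_Mapping.single t (Poly_Mapping.lookup p t))"
    if "finite A" "A \<subseteq> Poly_Mapping.keys p" for A
    using that
  proof (induction A)
    case empty
    then show ?case using Const[of 0] by (simp add: H_poly_closed Const_def)
  next
    case (insert t A)
    then have "Poly_Mapping.keys t \<subseteq> {1..<n}" using p by (auto simp: in_H_poly_ring)
    then have "Poly_Mapping.single t (Poly_Mapping.lookup p t) \<in> carrier (H_poly_ring n)"
      by (auto simp: in_H_poly_ring)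
    then show ?case using insert mono \<open>Poly_Mapping.keys t \<subseteq> {1..<n}\<close>
      by (simp add: H_poly_add add)
  qed
  from this[OF finite_keys order_refl] show ?thesis
    by (simp flip: poly_mapping_sum_singles)
qed

lemma poly_subst_shift:
  assumes "p \<in> carrier (H_poly_ring n)" "\<And>i. i \<in> {1..<n} \<Longrightarrow> v (i + k) = w i"
  shows "eval_at v (poly_subst Const (\<lambda>i. Var (i + k)) p) = eval_at w p"
  using assms(1)
  by (induction p rule: H_poly_induct)
    (auto simp: eval_at_simps Const_hom.poly_subst_simps assms(2))

lemma poly_subst_shift_closed:
  assumes "p \<in> carrier (H_poly_ring n)" "n + k \<le> N"
  shows "poly_subst Const (\<lambda>i. Var (i + k)) p \<in> carrier (H_poly_ring N)"
  using assms(1)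
  by (induction p rule: H_poly_induct)
    (use assms(2) in \<open>auto simp: Const_hom.poly_subst_simps intro!: H_poly_closed\<close>)

section \<open>Characters of the algebras\<close>

abbreviation H_relators :: "nat \<Rightarrow> 'a::field mpoly set" where
  "H_relators n \<equiv> {Var i ^ 2 - Var i |i. 1 \<le> i \<and> i < n} \<union> {Var i * Var (i + 1) |i. 1 \<le> i \<and> i + 1 < n}"

lemma power_H_poly: "p \<in> carrier (H_poly_ring n) \<Longrightarrow> p ^ k \<in> carrier (H_poly_ring n)"
  by (induction k) (auto intro: H_poly_closed)

lemma H_relators_closed: "H_relators n \<subseteq> carrier (H_poly_ring n)"
  by (auto intro!: H_poly_closed power_H_poly)

lemma H_ideal_ideal: "ideal (H_ideal n) (H_poly_ring n)"
  unfolding H_ideal_def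
  by (rule ring.genideal_ideal[OF cring.axioms(1)[OF H_poly_ring_cring] H_relators_closed])

lemma H_relators_in_ideal: "H_relators n \<subseteq> H_ideal n"
  unfolding H_ideal_def
  by (rule ring.genideal_self[OF cring.axioms(1)[OF H_poly_ring_cring] H_relators_closed])

lemma H_poly_a_inv: "p \<in> carrier (H_poly_ring n) \<Longrightarrow> \<ominus>\<^bsub>H_poly_ring n\<^esub> p = - p"
  by (rule abelian_group.minus_equality) 
    (auto simp: H_poly_closed H_poly_ring_cring cring.axioms(1) ring.is_abelian_group)

text \<open>Negatives arise from multiplication by \<open>- 1\<close>, so closure under sums and
  products suffices to capture the ideal.\<close>

lemma H_ideal_minimal:
  assumes I: "I \<subseteq> carrier (H_poly_ring n)" "0 \<in> I"
    and add: "\<And>p q. p \<in> I \<Longrightarrow> q \<in> I \<Longrightarrow> p + q \<in> I"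
    and mult: "\<And>p q. p \<in> I \<Longrightarrow> q \<in> carrier (H_poly_ring n) \<Longrightarrow> p * q \<in> I"
    and rel: "H_relators n \<subseteq> I"
  shows "H_ideal n \<subseteq> I"
  unfolding H_ideal_def
proof (rule ring.genideal_minimal[OF cring.axioms(1)[OF H_poly_ring_cring] _ rel])
  have uminus: "- p \<in> I" if "p \<in> I" for p
    using mult[OF that, of "- 1"] by (simp add: H_poly_closed)
  show "ideal I (H_poly_ring n)"
  proof (rule idealI[OF cring.axioms(1)[OF H_poly_ring_cring]])
    show "subgroup I (add_monoid (H_poly_ring n))"
    proof (rule group.subgroupI)
      show "Group.group (add_monoid (H_poly_ring n :: 'a mpoly ring))"
        by (rule abelian_group.a_group) (simp add: H_poly_ring_cring cring.axioms(1) ring.is_abelian_group)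
      show "inv\<^bsub>add_monoid (H_poly_ring n)\<^esub> a \<in> I" if "a \<in> I" for a
        using that I uminus[OF that] H_poly_a_inv[of a n] by (auto simp: a_inv_def)
    qed (use I add in auto)
  qed (use mult in \<open>auto simp: mult.commute\<close>)
qed

lemma H_ideal_zero: "0 \<in> H_ideal n"
  using additive_subgroup.zero_closed[OF ideal.axioms(1)[OF H_ideal_ideal]] by simp

lemma H_ideal_add: "p \<in> H_ideal n \<Longrightarrow> q \<in> H_ideal n \<Longrightarrow> p + q \<in> H_ideal n"
  using additive_subgroup.a_closed[OF ideal.axioms(1)[OF H_ideal_ideal]] by force

lemma H_ideal_mult: "p \<in> H_ideal n \<Longrightarrow> q \<in> carrier (H_poly_ring n) \<Longrightarrow> p * q \<in> H_ideal n"
  using ideal.I_r_closed[OF H_ideal_ideal] by force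

lemma H_ideal_uminus: "p \<in> H_ideal n \<Longrightarrow> - p \<in> H_ideal n"
  using H_ideal_mult[of p n "- 1"] by (simp add: H_poly_closed)

lemma mem_H_coset: "q \<in> H_coset n p \<longleftrightarrow> q - p \<in> H_ideal n"
  by (auto simp: H_coset_def a_r_coset_def' intro: bexI[of _ "q - p"])

lemma H_coset_self: "p \<in> H_coset n p"
  by (simp add: mem_H_coset H_ideal_zero)

lemma H_coset_eqI:
  assumes "p - q \<in> H_ideal n"
  shows "H_coset n p = H_coset n q"
proof (rule Set.set_eqI)
  fix r
  have "r - q = (r - p) + (p - q)" "r - p = (r - q) + - (p - q)" by simp_all
  then show "r \<in> H_coset n p \<longleftrightarrow> r \<in> H_coset n q"
    unfolding mem_H_coset by (metis H_ideal_add H_ideal_uminus assms)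
qed

lemma H_coset_zero: "H_coset n 0 = H_ideal n"
  by (auto simp: mem_H_coset)

lemma H_ops:
  "monoid.mult (H n) = monoid.mult (H_poly_ring n Quot H_ideal n)"
  "\<one>\<^bsub>H n\<^esub> = H_coset n 1" "\<zero>\<^bsub>H n\<^esub> = H_coset n 0"
  "add (H n) = add (H_poly_ring n Quot H_ideal n)"
  "c \<odot>\<^bsub>H n\<^esub> U = H_coset n (Const c) \<otimes>\<^bsub>H n\<^esub> U"
  unfolding H_coset_zero by (simp_all add: H_def Let_def FactRing_def H_coset_def)

lemma carrier_H: "carrier (H n) = H_coset n ` carrier (H_poly_ring n)"
  by (auto simp: H_def Let_def FactRing_def H_coset_def A_RCOSETS_def')

lemma H_carrierE:
  assumes "U \<in> carrier (H n)"
  obtains p where "p \<in> carrier (H_poly_ring n)" "U = H_coset n p"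
  using assms by (auto simp: carrier_H)

lemma H_coset_closed: "p \<in> carrier (H_poly_ring n) \<Longrightarrow> H_coset n p \<in> carrier (H n)"
  by (simp add: carrier_H)

lemma H_mult:
  assumes "p \<in> carrier (H_poly_ring n)" "q \<in> carrier (H_poly_ring n)"
  shows "H_coset n p \<otimes>\<^bsub>H n\<^esub> H_coset n q = H_coset n (p * q)"
  using ideal.rcoset_mult_add[OF H_ideal_ideal assms]
  by (simp add: H_ops FactRing_def H_coset_def)

lemma H_add:
  assumes "p \<in> carrier (H_poly_ring n)" "q \<in> carrier (H_poly_ring n)"
  shows "H_coset n p \<oplus>\<^bsub>H n\<^esub> H_coset n q = H_coset n (p + q)"
proof -
  interpret ideal "H_ideal n" "H_poly_ring n" by (rule H_ideal_ideal)
  show ?thesis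
    using a_rcos_sum[OF assms] by (simp add: H_ops FactRing_def H_coset_def)
qed

lemma H_cring: "cring (H n)"
proof (rule cringI)
  show "abelian_group (H n)"
  proof (rule abelian_groupI)
    show "\<exists>y\<in>carrier (H n). y \<oplus>\<^bsub>H n\<^esub> x = \<zero>\<^bsub>H n\<^esub>" if "x \<in> carrier (H n)" for x
    proof -
      from that obtain p where p: "p \<in> carrier (H_poly_ring n)" "x = H_coset n p"
        by (rule H_carrierE)
      then show ?thesis
        by (intro bexI[of _ "H_coset n (- p)"]) (auto simp: H_add H_ops(3) H_poly_closed H_coset_closed)
    qed
  qed (auto simp: carrier_H H_add H_ops(2,3) H_poly_closed ac_simps)
  show "Group.comm_monoid (H n)"
    by (rule comm_monoidI) (auto simp: carrier_H H_mult H_ops(2,3) H_poly_closed ac_simps)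
qed (auto simp: carrier_H H_add H_mult H_poly_closed distrib_right)

abbreviation type_ring :: "'a::field ring" where
  "type_ring \<equiv> ring_of_type_algebra"

lemma type_ring_simps [simp]:
  "carrier type_ring = UNIV" "monoid.mult type_ring = (*)" "\<one>\<^bsub>type_ring\<^esub> = 1"
  "\<zero>\<^bsub>type_ring\<^esub> = 0" "add type_ring = (+)"
  by (simp_all add: ring_of_type_algebra_def)

text \<open>Every indicator point satisfies \<open>x_i ^ 2 = x_i\<close>; nonadjacency is what the
  relations \<open>x_i x_(i+1) = 0\<close> demand of it.\<close>

definition nonadjacent :: "nat set \<Rightarrow> bool" where
  "nonadjacent D \<longleftrightarrow> (\<forall>i. i \<in> D \<longrightarrow> Suc i \<notin> D)"

abbreviation H_point :: "nat set \<Rightarrow> nat \<Rightarrow> 'a::field" where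
  "H_point D \<equiv> (\<lambda>i. if i \<in> D then 1 else 0)"

definition H_char :: "nat set \<Rightarrow> 'a::field mpoly set \<Rightarrow> 'a" where
  "H_char D U = the_elem (eval_at (H_point D) ` U)"

text \<open>The polynomials vanishing at the point form an ideal that contains the relators.\<close>

lemma eval_at_H_ideal:
  fixes p :: "'a::field mpoly"
  assumes "nonadjacent D" "p \<in> H_ideal n"
  shows "eval_at (H_point D) p = 0"
proof -
  have "H_ideal n \<subseteq> {p :: 'a mpoly. p \<in> carrier (H_poly_ring n) \<and> eval_at (H_point D) p = 0}"
  proof (rule H_ideal_minimal)
    show "H_relators n \<subseteq> {p :: 'a mpoly. p \<in> carrier (H_poly_ring n) \<and> eval_at (H_point D) p = 0}"
    proof
      fix p :: "'a mpoly" assume p: "p \<in> H_relators n"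
      then have "eval_at (H_point D) p = 0"
        using assms(1) by (auto simp: eval_at_simps nonadjacent_def)
      then show "p \<in> {p. p \<in> carrier (H_poly_ring n) \<and> eval_at (H_point D) p = 0}"
        using p H_relators_closed by blast
    qed
  qed (auto simp: eval_at_simps H_poly_closed)
  then show ?thesis using assms(2) by blast
qed

text \<open>Evaluation is constant on a coset, so its image is a singleton and
  \<open>the_elem\<close> returns the common value. \<open>H_shift\<close> and
  \<open>H2_lift\<close> are made well defined in the same way.\<close>

lemma H_char_coset:
  assumes "nonadjacent D"
  shows "H_char D (H_coset n p) = eval_at (H_point D) p"
proof -
  have "eval_at (H_point D) q = eval_at (H_point D) p" if "q \<in> H_coset n p" for q
    using eval_at_H_ideal[OF assms, of "q - p" n] that by (simp add: mem_H_coset eval_at_simps)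
  then have "eval_at (H_point D) ` H_coset n p = {eval_at (H_point D) p}"
    using H_coset_self by blast
  then show ?thesis by (simp add: H_char_def)
qed

lemma H_char_ring_hom:
  assumes "nonadjacent D"
  shows "H_char D \<in> ring_hom (H n) type_ring"
  by (rule ring_hom_memI)
    (auto elim!: H_carrierE simp: H_mult H_add H_ops(2) H_char_coset[OF assms] eval_at_simps)

section \<open>Shifting the variables from one algebra into another\<close>

abbreviation poly_shift :: "nat \<Rightarrow> 'a::field mpoly \<Rightarrow> 'a mpoly" where
  "poly_shift k \<equiv> poly_subst Const (\<lambda>i. Var (i + k))"

text \<open>Relators go to relators with indices raised by \<open>k\<close>, and the bound on
  \<open>n + k\<close> keeps these in range.\<close>

lemma poly_shift_H_ideal:
  fixes p :: "'a::field mpoly"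
  assumes "n + k \<le> N" "p \<in> H_ideal n"
  shows "poly_shift k p \<in> H_ideal N"
proof -
  have "H_ideal n \<subseteq> {p :: 'a mpoly. p \<in> carrier (H_poly_ring n) \<and> poly_shift k p \<in> H_ideal N}"
  proof (rule H_ideal_minimal)
    show "H_relators n \<subseteq> {p :: 'a mpoly. p \<in> carrier (H_poly_ring n) \<and> poly_shift k p \<in> H_ideal N}"
    proof
      fix p :: "'a mpoly" assume p: "p \<in> H_relators n"
      then consider i where "p = Var i ^ 2 - Var i" "1 \<le> i" "i < n"
        | i where "p = Var i * Var (i + 1)" "1 \<le> i" "i + 1 < n" by blast
      then have "poly_shift k p \<in> H_relators N"
      proof cases
        case (1 i)
        then show ?thesis using assms(1)
          by (intro UnI1 CollectI exI[of _ "i + k"]) (simp add: Const_hom.poly_subst_simps)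
      next
        case (2 i)
        then show ?thesis using assms(1)
          by (intro UnI2 CollectI exI[of _ "i + k"]) (simp add: Const_hom.poly_subst_simps)
      qed
      then show "p \<in> {p. p \<in> carrier (H_poly_ring n) \<and> poly_shift k p \<in> H_ideal N}"
        using p H_relators_closed H_relators_in_ideal by blast
    qed
  qed (use assms(1) in \<open>auto simp: Const_hom.poly_subst_simps H_poly_closed H_ideal_zero 
    intro!: H_ideal_add H_ideal_mult poly_subst_shift_closed\<close>)
  then show ?thesis using assms(2) by blast
qed

lemma H_shift_coset:
  assumes "n + k \<le> N"
  shows "H_shift N k (H_coset n p) = H_coset N (poly_shift k p)"
proof -
  have "H_coset N (poly_shift k q) = H_coset N (poly_shift k p)" if "q \<in> H_coset n p" for q
    using poly_shift_H_ideal[OF assms, of "q - p"] that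
    by (intro H_coset_eqI) (simp add: mem_H_coset Const_hom.poly_subst_simps)
  then have "(\<lambda>p. H_coset N (poly_shift k p)) ` H_coset n p = {H_coset N (poly_shift k p)}"
    using H_coset_self by blast
  then show ?thesis by (simp add: H_shift_def)
qed

lemma H_shift_ring_hom:
  assumes "n + k \<le> N"
  shows "H_shift N k \<in> ring_hom (H n) (H N)"
proof (rule ring_hom_memI)
qed (auto elim!: H_carrierE simp: H_mult H_add H_ops(2) H_shift_coset[OF assms]
    Const_hom.poly_subst_simps H_poly_closed poly_subst_shift_closed[OF _ assms] intro!: H_coset_closed)

text \<open>Composing a character with the shift reads off a block of coordinates of its point,
  those from \<open>k + 1\<close> to \<open>k + n - 1\<close>.\<close>

lemma H_char_shift:
  assumes "n + k \<le> N" "nonadjacent D" "nonadjacent D'" "U \<in> carrier (H n)"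
    and "\<And>i. i \<in> {1..<n} \<Longrightarrow> i + k \<in> D \<longleftrightarrow> i \<in> D'"
  shows "H_char D (H_shift N k U) = H_char D' U"
proof -
  from assms(4) obtain p where p: "p \<in> carrier (H_poly_ring n)" "U = H_coset n p"
    by (rule H_carrierE)
  have "eval_at (H_point D) (poly_shift k p) = eval_at (H_point D') p"
    by (rule poly_subst_shift[OF p(1)]) (use assms(5) in auto)
  then show ?thesis
    using assms p by (simp add: H_shift_coset H_char_coset)
qed

section \<open>Monoid rings\<close>

lemmas frag_induct = free_Abelian_group_induct [consumes 1, case_names zero diff frag_of]

text \<open>The integer-linear extension of \<open>w\<close> to formal sums. The embedding of the
  tensor algebra and all evaluations of tensors are built from it.\<close>

definition gsum :: "('r, 'x) ring_scheme \<Rightarrow> ('k \<Rightarrow> 'r) \<Rightarrow> ('k \<Rightarrow>\<^sub>0 int) \<Rightarrow> 'r" where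
  "gsum R w f = finsum R (\<lambda>x. add_pow R (Poly_Mapping.lookup f x) (w x)) (Poly_Mapping.keys f)"

context abelian_group begin

lemma add_pow_closed: "a \<in> carrier G \<Longrightarrow> add_pow G (k::int) a \<in> carrier G"
  by (simp add: add.int_pow_closed)

lemma gsum_superset:
  assumes "finite A" "Poly_Mapping.keys f \<subseteq> A" "w \<in> A \<rightarrow> carrier G"
  shows "gsum G w f = (\<Oplus>x\<in>A. add_pow G (Poly_Mapping.lookup f x) (w x))"
  unfolding gsum_def
proof (rule add.finprod_mono_neutral_cong_left[OF assms(1,2)])
  fix i assume "i \<in> A - Poly_Mapping.keys f"
  then have "Poly_Mapping.lookup f i = 0" by (simp add: in_keys_iff)
  then show "add_pow G (Poly_Mapping.lookup f i) (w i) = \<zero>"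
    by (simp add: add_pow_def int_pow_def)
qed (use assms(3) in \<open>auto simp: add_pow_closed Pi_iff\<close>)

lemma gsum_closed:
  assumes "w \<in> S \<rightarrow> carrier G" "Poly_Mapping.keys f \<subseteq> S"
  shows "gsum G w f \<in> carrier G"
  unfolding gsum_def using assms by (intro finsum_closed) (auto intro!: add_pow_closed)

lemma gsum_add:
  assumes "w \<in> S \<rightarrow> carrier G" "Poly_Mapping.keys f \<subseteq> S" "Poly_Mapping.keys g \<subseteq> S"
  shows "gsum G w (f + g) = gsum G w f \<oplus> gsum G w g"
proof -
  let ?A = "Poly_Mapping.keys f \<union> Poly_Mapping.keys g"
  have w: "w \<in> ?A \<rightarrow> carrier G" using assms by auto
  have "gsum G w (f + g) = (\<Oplus>x\<in>?A. add_pow G (Poly_Mapping.lookup (f + g) x) (w x))"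
    by (rule gsum_superset[OF _ _ w]) (auto simp: keys_add)
  also have "\<dots> = (\<Oplus>x\<in>?A. add_pow G (Poly_Mapping.lookup f x) (w x) \<oplus>
      add_pow G (Poly_Mapping.lookup g x) (w x))"
    using w by (intro add.finprod_cong') (auto simp: lookup_add add.int_pow_mult add_pow_closed Pi_iff)
  also have "\<dots> = gsum G w f \<oplus> gsum G w g"
    using w by (subst finsum_addf) (auto simp: gsum_superset[OF _ _ w] intro!: add_pow_closed)
  finally show ?thesis .
qed

lemma gsum_zero: "gsum G w 0 = \<zero>"
  by (simp add: gsum_def)

lemma gsum_frag_of: "w x \<in> carrier G \<Longrightarrow> gsum G w (frag_of x) = w x"
  by (simp add: gsum_def)

lemma gsum_diff:
  assumes "w \<in> S \<rightarrow> carrier G" "Poly_Mapping.keys f \<subseteq> S" "Poly_Mapping.keys g \<subseteq> S"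
  shows "gsum G w (f - g) = gsum G w f \<ominus> gsum G w g"
proof -
  have d: "Poly_Mapping.keys (f - g) \<subseteq> S"
    using assms keys_diff by fastforce
  have "gsum G w f = gsum G w (f - g) \<oplus> gsum G w g"
    using gsum_add[OF assms(1) d assms(3)] by simp
  then show ?thesis
    using gsum_closed[OF assms(1)] assms d
    by (simp add: a_minus_def add.m_assoc r_neg)
qed

end

lemma gsum_cong:
  assumes "abelian_group R" "w \<in> S \<rightarrow> carrier R" "Poly_Mapping.keys f \<subseteq> S" "\<And>x. x \<in> S \<Longrightarrow> w x = w' x"
  shows "gsum R w f = gsum R w' f"
proof -
  interpret abelian_group R by fact
  show ?thesis
    unfolding gsum_def
  proof (rule add.finprod_cong'[OF refl])
    have "w' x \<in> carrier R" if "x \<in> S" for x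
      using assms(2) assms(4)[OF that] that by (metis PiE)
    then show "(\<lambda>x. add_pow R (Poly_Mapping.lookup f x) (w' x)) \<in> Poly_Mapping.keys f \<rightarrow> carrier R"
      using assms(3) by (auto intro!: add_pow_closed)
  qed (use assms(3,4) in auto)
qed

lemma gsum_hom:
  assumes "cring R" "cring R'" "h \<in> ring_hom R R'"
    and "w \<in> S \<rightarrow> carrier R" "Poly_Mapping.keys f \<subseteq> S"
  shows "h (gsum R w f) = gsum R' (\<lambda>x. h (w x)) f"
proof -
  interpret ring_hom_cring R R' h
    using assms(1-3) by (simp add: ring_hom_cring_def ring_hom_cring_axioms_def)
  have w': "(\<lambda>x. h (w x)) \<in> S \<rightarrow> carrier R'" using assms(4) by auto
  show ?thesis
    using assms(5)
  proof (induction f rule: frag_induct)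
    case zero
    show ?case by (simp add: R.gsum_zero S.gsum_zero)
  next
    case (diff f g)
    then show ?case
      by (simp add: R.gsum_diff[OF assms(4)] S.gsum_diff[OF w'] R.gsum_closed[OF assms(4)] a_minus_def)
  next
    case (frag_of a)
    then have "w a \<in> carrier R" using assms(4) by auto
    then show ?case by (simp add: R.gsum_frag_of S.gsum_frag_of)
  qed
qed

lemma int_monoid_ring_simps [simp]:
  "\<one>\<^bsub>int_monoid_ring S\<^esub> = frag_of \<one>\<^bsub>S\<^esub>" "\<zero>\<^bsub>int_monoid_ring S\<^esub> = 0"
  "add (int_monoid_ring S) = (+)"
  "f \<in> carrier (int_monoid_ring S) \<longleftrightarrow> Poly_Mapping.keys f \<subseteq> carrier S"
  by (simp_all add: int_monoid_ring_def)

lemma frag_extend_diff_fun: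
  "frag_extend (\<lambda>x. A x - B x) f = frag_extend A f - frag_extend B f"
  using subset_UNIV by (induction f rule: frag_induction) (auto simp: frag_extend_diff)

lemma frag_extend_zero_fun: "frag_extend (\<lambda>x. 0) f = 0"
  by (simp add: frag_extend_def)

lemma frag_extend_closed:
  assumes "\<And>x. x \<in> S \<Longrightarrow> Poly_Mapping.keys (w x) \<subseteq> T" "Poly_Mapping.keys f \<subseteq> S"
  shows "Poly_Mapping.keys (frag_extend w f) \<subseteq> T"
  using keys_frag_extend[of w f] assms by blast

context
  fixes S :: "('m, 'x) monoid_scheme"
begin

lemma int_monoid_mult_frag_of: "frag_of x \<otimes>\<^bsub>int_monoid_ring S\<^esub> frag_of y = frag_of (x \<otimes>\<^bsub>S\<^esub> y)"
  by (simp add: int_monoid_ring_def)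

lemma int_monoid_mult_diff_left:
  "(f - g) \<otimes>\<^bsub>int_monoid_ring S\<^esub> k = f \<otimes>\<^bsub>int_monoid_ring S\<^esub> k - g \<otimes>\<^bsub>int_monoid_ring S\<^esub> k"
  by (simp add: int_monoid_ring_def frag_extend_diff)

lemma int_monoid_mult_diff_right:
  "k \<otimes>\<^bsub>int_monoid_ring S\<^esub> (f - g) = k \<otimes>\<^bsub>int_monoid_ring S\<^esub> f - k \<otimes>\<^bsub>int_monoid_ring S\<^esub> g"
  by (simp add: int_monoid_ring_def frag_extend_diff frag_extend_diff_fun)

lemma int_monoid_mult_zero:
  "0 \<otimes>\<^bsub>int_monoid_ring S\<^esub> f = 0" "f \<otimes>\<^bsub>int_monoid_ring S\<^esub> 0 = 0"
  by (simp_all add: int_monoid_ring_def frag_extend_zero_fun)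

lemmas int_monoid_mult_simps = int_monoid_mult_frag_of int_monoid_mult_diff_left
  int_monoid_mult_diff_right int_monoid_mult_zero

lemma int_monoid_mult_add_left:
  "(f + g) \<otimes>\<^bsub>int_monoid_ring S\<^esub> k = f \<otimes>\<^bsub>int_monoid_ring S\<^esub> k + g \<otimes>\<^bsub>int_monoid_ring S\<^esub> k"
  by (simp add: int_monoid_ring_def frag_extend_add)

lemma int_monoid_mult_closed:
  assumes "Group.monoid S" "Poly_Mapping.keys f \<subseteq> carrier S" "Poly_Mapping.keys g \<subseteq> carrier S"
  shows "Poly_Mapping.keys (f \<otimes>\<^bsub>int_monoid_ring S\<^esub> g) \<subseteq> carrier S"
  unfolding int_monoid_ring_def monoid.simps
  by (intro frag_extend_closed[OF _ assms(2)] frag_extend_closed[OF _ assms(3)])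
    (simp add: keys_frag_of monoid.m_closed[OF assms(1)])

text \<open>Associativity, commutativity and the unit law are additive in every argument, so
  inductions over formal sums bring them down to the monoid.\<close>

lemma int_monoid_ring_cring:
  assumes "Group.comm_monoid S"
  shows "cring (int_monoid_ring S)"
proof (rule cringI)
  interpret S: comm_monoid S by fact
  note closed = int_monoid_mult_closed[OF S.monoid_axioms]
  show "abelian_group (int_monoid_ring S)"
  proof (rule abelian_groupI)
    show "\<exists>y\<in>carrier (int_monoid_ring S). y \<oplus>\<^bsub>int_monoid_ring S\<^esub> x = \<zero>\<^bsub>int_monoid_ring S\<^esub>"
      if "x \<in> carrier (int_monoid_ring S)" for x
      using that by (intro bexI[of _ "- x"]) auto
  qed (auto simp: ac_simps dest: subsetD[OF keys_add])
  show "Group.comm_monoid (int_monoid_ring S)"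
  proof (rule comm_monoidI)
    show "f \<otimes>\<^bsub>int_monoid_ring S\<^esub> g \<otimes>\<^bsub>int_monoid_ring S\<^esub> k = f \<otimes>\<^bsub>int_monoid_ring S\<^esub> (g \<otimes>\<^bsub>int_monoid_ring S\<^esub> k)"
      if fgk: "f \<in> carrier (int_monoid_ring S)" "g \<in> carrier (int_monoid_ring S)"
        "k \<in> carrier (int_monoid_ring S)" for f g k
      using fgk(1)[unfolded int_monoid_ring_simps]
    proof (induction f rule: frag_induct)
      case (frag_of a)
      show ?case
        using fgk(2)[unfolded int_monoid_ring_simps]
      proof (induction g rule: frag_induct)
        case (frag_of b)
        show ?case
          using fgk(3)[unfolded int_monoid_ring_simps]
          by (induction k rule: frag_induct)
            (use \<open>a \<in> carrier S\<close> \<open>b \<in> carrier S\<close> in \<open>auto simp: int_monoid_mult_simps S.m_assoc\<close>)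
      qed (auto simp: int_monoid_mult_simps)
    qed (auto simp: int_monoid_mult_simps)
    show "f \<otimes>\<^bsub>int_monoid_ring S\<^esub> g = g \<otimes>\<^bsub>int_monoid_ring S\<^esub> f"
      if fg: "f \<in> carrier (int_monoid_ring S)" "g \<in> carrier (int_monoid_ring S)" for f g
      using fg(1)[unfolded int_monoid_ring_simps]
    proof (induction f rule: frag_induct)
      case (frag_of a)
      show ?case
        using fg(2)[unfolded int_monoid_ring_simps]
        by (induction g rule: frag_induct)
          (use \<open>a \<in> carrier S\<close> in \<open>auto simp: int_monoid_mult_simps S.m_comm\<close>)
    qed (auto simp: int_monoid_mult_simps)
    show "\<one>\<^bsub>int_monoid_ring S\<^esub> \<otimes>\<^bsub>int_monoid_ring S\<^esub> f = f"
      if f: "f \<in> carrier (int_monoid_ring S)" for f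
      using f[unfolded int_monoid_ring_simps]
      by (induction f rule: frag_induct) (auto simp: int_monoid_mult_simps)
  qed (use closed in \<open>auto simp: keys_frag_of\<close>)
qed (auto simp: int_monoid_mult_add_left)

text \<open>The universal property of the monoid ring: a multiplicative \<open>w\<close> extends to
  a multiplicative map, since both sides are additive in \<open>f\<close> and
  \<open>g\<close>.\<close>

lemma gsum_int_monoid_mult:
  assumes "Group.monoid S" "cring R" and w: "w \<in> carrier S \<rightarrow> carrier R"
    and mult: "\<And>x y. x \<in> carrier S \<Longrightarrow> y \<in> carrier S \<Longrightarrow> w (x \<otimes>\<^bsub>S\<^esub> y) = w x \<otimes>\<^bsub>R\<^esub> w y"
    and fg: "Poly_Mapping.keys f \<subseteq> carrier S" "Poly_Mapping.keys g \<subseteq> carrier S"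
  shows "gsum R w (f \<otimes>\<^bsub>int_monoid_ring S\<^esub> g) = gsum R w f \<otimes>\<^bsub>R\<^esub> gsum R w g"
proof -
  interpret S: monoid S by fact
  interpret R: cring R by fact
  note closed = int_monoid_mult_closed[OF S.monoid_axioms]
  note gsimps = R.gsum_diff[OF w] R.gsum_closed[OF w] R.gsum_zero R.gsum_frag_of
    closed int_monoid_mult_simps keys_frag_of R.minus_eq R.l_distr R.r_distr R.l_minus R.r_minus
  have wc: "w x \<in> carrier R" if "x \<in> carrier S" for x using w that by auto
  show ?thesis
    using fg(1)
  proof (induction f rule: frag_induct)
    case (frag_of a)
    show ?case
      using fg(2)
      by (induction g rule: frag_induct) (use frag_of in \<open>auto simp: gsimps mult wc\<close>)
  qed (use fg(2) in \<open>auto simp: gsimps\<close>)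
qed

end

section \<open>Tensor products of the algebras\<close>

lemma type_ring_cring: "cring type_ring"
  by (rule cring_from_type_algebra)

lemma type_ring_abelian_group: "abelian_group type_ring"
  by (simp add: type_ring_cring cring.axioms(1) ring.is_abelian_group)

lemma type_ring_minus [simp]: "x \<ominus>\<^bsub>type_ring\<^esub> y = x - y"
proof -
  have "\<ominus>\<^bsub>type_ring\<^esub> y = - y"
    by (rule abelian_group.minus_equality[OF type_ring_abelian_group]) auto
  then show ?thesis by (simp add: a_minus_def)
qed

lemma gsum_type_ring_simps:
  "gsum type_ring w 0 = 0" "gsum type_ring w (frag_of x) = w x"
  "gsum type_ring w (f - g) = gsum type_ring w f - gsum type_ring w g"
  by (simp_all add: abelian_group.gsum_zero abelian_group.gsum_frag_of type_ring_abelian_group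
      abelian_group.gsum_diff[where S = UNIV])

definition H2_ideal :: "nat \<Rightarrow> nat \<Rightarrow> ('a::field mpoly set \<times> 'a mpoly set \<Rightarrow>\<^sub>0 int) set" where
  "H2_ideal m n = Idl\<^bsub>int_monoid_ring (H m \<times>\<times> H n)\<^esub>
     (tensor_relations (type_ring :: 'a ring) (H m) (H n))"

definition H2_coset ::
    "nat \<Rightarrow> nat \<Rightarrow> ('a::field mpoly set \<times> 'a mpoly set \<Rightarrow>\<^sub>0 int) \<Rightarrow> 'a H2_elem" where
  "H2_coset m n f = H2_ideal m n +>\<^bsub>int_monoid_ring (H m \<times>\<times> H n)\<^esub> f"

lemma H_add_closed: "a \<in> carrier (H n) \<Longrightarrow> b \<in> carrier (H n) \<Longrightarrow> a \<oplus>\<^bsub>H n\<^esub> b \<in> carrier (H n)"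
  by (rule ring.ring_simprules(1)[OF cring.axioms(1)[OF H_cring]])

lemma H_mult_closed: "a \<in> carrier (H n) \<Longrightarrow> b \<in> carrier (H n) \<Longrightarrow> a \<otimes>\<^bsub>H n\<^esub> b \<in> carrier (H n)"
  by (rule ring.ring_simprules(5)[OF cring.axioms(1)[OF H_cring]])

lemma H_smult_closed: "a \<in> carrier (H n) \<Longrightarrow> c \<odot>\<^bsub>H n\<^esub> a \<in> carrier (H n)"
  by (simp add: H_ops(5) H_mult_closed H_coset_closed H_poly_closed)

text \<open>The level of structure at which tensor relations stay inside the free group on the pairs
  and isomorphisms can be inverted.\<close>

definition module_closed :: "('r, 'x) ring_scheme \<Rightarrow> ('r, 'b) module \<Rightarrow> bool" where
  "module_closed R M \<longleftrightarrow>
     (\<forall>u\<in>carrier M. \<forall>v\<in>carrier M. u \<oplus>\<^bsub>M\<^esub> v \<in> carrier M) \<and>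
     (\<forall>r\<in>carrier R. \<forall>u\<in>carrier M. r \<odot>\<^bsub>M\<^esub> u \<in> carrier M)"

lemma keys_diff3_subset:
  "x \<in> S \<Longrightarrow> y \<in> S \<Longrightarrow> z \<in> S \<Longrightarrow> Poly_Mapping.keys (frag_of x - frag_of y - frag_of z) \<subseteq> S"
  "x \<in> S \<Longrightarrow> y \<in> S \<Longrightarrow> Poly_Mapping.keys (frag_of x - frag_of y) \<subseteq> S"
  by (auto simp: lookup_minus in_keys_iff lookup_frag_of split: if_splits)

lemma tensor_relationsE [consumes 1, case_names add_left add_right smult]:
  assumes "f \<in> tensor_relations R M N"
  obtains u u' v where "f = frag_of (u \<oplus>\<^bsub>M\<^esub> u', v) - frag_of (u, v) - frag_of (u', v)"
      "u \<in> carrier M" "u' \<in> carrier M" "v \<in> carrier N"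
    | u v v' where "f = frag_of (u, v \<oplus>\<^bsub>N\<^esub> v') - frag_of (u, v) - frag_of (u, v')"
      "u \<in> carrier M" "v \<in> carrier N" "v' \<in> carrier N"
    | r u v where "f = frag_of (r \<odot>\<^bsub>M\<^esub> u, v) - frag_of (u, r \<odot>\<^bsub>N\<^esub> v)"
      "r \<in> carrier R" "u \<in> carrier M" "v \<in> carrier N"
  using assms unfolding tensor_relations_def by blast

lemma tensor_relations_closed:
  assumes "module_closed R M" "module_closed R N" "f \<in> tensor_relations R M N"
  shows "Poly_Mapping.keys f \<subseteq> carrier M \<times> carrier N"
  using assms(3)
proof (cases rule: tensor_relationsE)
  case (add_left u u' v)
  then show ?thesis
    unfolding add_left(1) using assms(1) by (intro keys_diff3_subset) (auto simp: module_closed_def)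
next
  case (add_right u v v')
  then show ?thesis
    unfolding add_right(1) using assms(2) by (intro keys_diff3_subset) (auto simp: module_closed_def)
next
  case (smult r u v)
  then show ?thesis
    unfolding smult(1) using assms(1,2) by (intro keys_diff3_subset) (auto simp: module_closed_def)
qed

lemma H_module_closed: "module_closed type_ring (H n)"
  by (auto simp: module_closed_def H_smult_closed H_add_closed)

lemma comm_monoid_DirProd:
  assumes "cring A" "cring B"
  shows "Group.comm_monoid (A \<times>\<times> B)"
proof -
  interpret A: cring A by fact
  interpret B: cring B by fact
  show ?thesis
  proof (rule comm_monoidI)
    show "x \<otimes>\<^bsub>A \<times>\<times> B\<^esub> y = y \<otimes>\<^bsub>A \<times>\<times> B\<^esub> x"
      if "x \<in> carrier (A \<times>\<times> B)" "y \<in> carrier (A \<times>\<times> B)" for x y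
      using that A.m_comm[of "fst x" "fst y"] B.m_comm[of "snd x" "snd y"]
      by (simp add: mult_DirProd' mem_Times_iff)
  qed (auto simp: A.m_assoc B.m_assoc)
qed

lemma comm_monoid_H_pairs: "Group.comm_monoid (H m \<times>\<times> H n)"
  by (rule comm_monoid_DirProd[OF H_cring H_cring])

lemma H2_cring_Z: "cring (int_monoid_ring (H m \<times>\<times> H n))"
  by (rule int_monoid_ring_cring[OF comm_monoid_H_pairs])

lemma H2_ideal_ideal: "ideal (H2_ideal m n) (int_monoid_ring (H m \<times>\<times> H n))"
  unfolding H2_ideal_def
proof (rule ring.genideal_ideal[OF cring.axioms(1)[OF H2_cring_Z]], rule subsetI)
  fix f assume "f \<in> tensor_relations type_ring (H m) (H n)"
  then show "f \<in> carrier (int_monoid_ring (H m \<times>\<times> H n))"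
    unfolding int_monoid_ring_simps carrier_DirProd
    by (rule tensor_relations_closed[OF H_module_closed H_module_closed])
qed

lemma carrier_H2:
  "carrier (H2 m n) = H2_coset m n ` {f. Poly_Mapping.keys f \<subseteq> carrier (H m) \<times> carrier (H n)}"
  by (auto simp: H2_def algebra_tensor_def Let_def FactRing_def A_RCOSETS_def' H2_coset_def H2_ideal_def)

lemma H2_carrierE:
  assumes "U \<in> carrier (H2 m n)"
  obtains f where "Poly_Mapping.keys f \<subseteq> carrier (H m) \<times> carrier (H n)" "U = H2_coset m n f"
  using assms by (auto simp: carrier_H2)

lemma mem_H2_coset: "g \<in> H2_coset m n f \<longleftrightarrow> g - f \<in> H2_ideal m n"
  by (auto simp: H2_coset_def a_r_coset_def' intro: bexI[of _ "g - f"])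

lemma H2_ideal_keys: "f \<in> H2_ideal m n \<Longrightarrow> Poly_Mapping.keys f \<subseteq> carrier (H m) \<times> carrier (H n)"
  using subsetD[OF additive_subgroup.a_subset[OF ideal.axioms(1)[OF H2_ideal_ideal]]]
  by (simp only: int_monoid_ring_simps carrier_DirProd)

lemma H2_coset_self: "f \<in> H2_coset m n f"
  using additive_subgroup.zero_closed[OF ideal.axioms(1)[OF H2_ideal_ideal]]
  by (simp add: mem_H2_coset)

text \<open>The map out of the tensor algebra induced by two homomorphisms into a commutative ring.
  Both \<open>H_embed\<close> and the characters of the tensor algebra are of this form.\<close>

definition H2_lift ::
    "('r, 'x) ring_scheme \<Rightarrow> ('a::field mpoly set \<Rightarrow> 'r) \<Rightarrow> ('a mpoly set \<Rightarrow> 'r) \<Rightarrow> 'a H2_elem \<Rightarrow> 'r" where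
  "H2_lift R \<phi> \<psi> U = the_elem (gsum R (\<lambda>(a, b). \<phi> a \<otimes>\<^bsub>R\<^esub> \<psi> b) ` U)"

lemma H_embed_eq_lift: "H_embed m n = H2_lift (H (m + n)) (H_shift (m + n) 0) (H_shift (m + n) m)"
  by (rule ext) (simp add: H_embed_def H2_lift_def gsum_def[abs_def] split_def)

text \<open>The kernel of the linear extension is an ideal of the monoid ring, so it is enough to
  kill the tensor relations. Additive relations vanish by distributivity; the scalar relation
  vanishes because \<open>\<phi>\<close> and \<open>\<psi>\<close> agree on constants.\<close>

lemma H2_lift_ideal:
  fixes \<phi> \<psi> :: "'a::field mpoly set \<Rightarrow> 'r"
  assumes "cring R" "\<phi> \<in> ring_hom (H m) R" "\<psi> \<in> ring_hom (H n) R"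
    and const: "\<And>c. \<phi> (H_coset m (Const c)) = \<psi> (H_coset n (Const c))"
    and f: "f \<in> H2_ideal m n"
  shows "gsum R (\<lambda>(a, b). \<phi> a \<otimes>\<^bsub>R\<^esub> \<psi> b) f = \<zero>\<^bsub>R\<^esub>"
proof -
  let ?A = "H m :: ('a, 'a mpoly set) module"
  let ?B = "H n :: ('a, 'a mpoly set) module"
  let ?Z = "int_monoid_ring (?A \<times>\<times> ?B)"
  let ?w = "\<lambda>(a, b). \<phi> a \<otimes>\<^bsub>R\<^esub> \<psi> b"
  let ?S = "carrier ?A \<times> carrier ?B"
  interpret R: cring R by fact
  interpret Z: cring ?Z by (rule H2_cring_Z)
  interpret f1: ring_hom_cring ?A R \<phi>
    using assms(1,2) H_cring by (simp add: ring_hom_cring_def ring_hom_cring_axioms_def)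
  interpret f2: ring_hom_cring ?B R \<psi>
    using assms(1,3) H_cring by (simp add: ring_hom_cring_def ring_hom_cring_axioms_def)
  have w: "?w \<in> ?S \<rightarrow> carrier R" by auto
  have w': "?w \<in> carrier (?A \<times>\<times> ?B) \<rightarrow> carrier R" by auto
  have mult: "gsum R ?w (g \<otimes>\<^bsub>?Z\<^esub> k) = gsum R ?w g \<otimes>\<^bsub>R\<^esub> gsum R ?w k"
    if "Poly_Mapping.keys g \<subseteq> ?S" "Poly_Mapping.keys k \<subseteq> ?S" for g k
  proof (rule gsum_int_monoid_mult[OF comm_monoid.axioms(1)[OF comm_monoid_H_pairs] \<open>cring R\<close> w'])
    fix x y assume "x \<in> carrier (?A \<times>\<times> ?B)" "y \<in> carrier (?A \<times>\<times> ?B)"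
    then show "?w (x \<otimes>\<^bsub>?A \<times>\<times> ?B\<^esub> y) = ?w x \<otimes>\<^bsub>R\<^esub> ?w y"
      by (auto simp: R.m_ac)
  qed (use that in auto)
  let ?I = "{f. Poly_Mapping.keys f \<subseteq> ?S \<and> gsum R ?w f = \<zero>\<^bsub>R\<^esub>}"
  have "H2_ideal m n \<subseteq> ?I"
    unfolding H2_ideal_def
  proof (rule Z.genideal_minimal)
    show "ideal ?I ?Z"
    proof (rule idealI[OF Z.ring_axioms])
      show "subgroup ?I (add_monoid ?Z)"
      proof (rule group.subgroupI[OF Z.a_group])
        show "inv\<^bsub>add_monoid ?Z\<^esub> f \<in> ?I" if "f \<in> ?I" for f
        proof -
          have "inv\<^bsub>add_monoid ?Z\<^esub> f = - f"
            using that Z.minus_equality[of "- f" f] by (simp add: a_inv_def)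
          moreover have "gsum R ?w (0 - f) = \<zero>\<^bsub>R\<^esub>"
            using that by (subst R.gsum_diff[OF w]) (auto simp: R.gsum_zero)
          ultimately show ?thesis using that by simp
        qed
        show "f \<otimes>\<^bsub>add_monoid ?Z\<^esub> g \<in> ?I" if "f \<in> ?I" "g \<in> ?I" for f g
          using that R.gsum_add[OF w, of f g] keys_add[of f g] by auto
        have "0 \<in> ?I" by (simp add: R.gsum_zero)
        then show "?I \<noteq> {}" by blast
      qed auto
      have cl: "Poly_Mapping.keys (g \<otimes>\<^bsub>?Z\<^esub> k) \<subseteq> ?S"
        if "Poly_Mapping.keys g \<subseteq> ?S" "Poly_Mapping.keys k \<subseteq> ?S" for g k
        using Z.m_closed[of g k] that by simp
      show "x \<otimes>\<^bsub>?Z\<^esub> a \<in> ?I" if "a \<in> ?I" "x \<in> carrier ?Z" for a x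
        using that cl[of x a] mult[of x a] R.gsum_closed[OF w, of x] by auto
      show "a \<otimes>\<^bsub>?Z\<^esub> x \<in> ?I" if "a \<in> ?I" "x \<in> carrier ?Z" for a x
        using that cl[of a x] mult[of a x] R.gsum_closed[OF w, of x] by auto
    qed
    have g2: "gsum R ?w (frag_of x - frag_of y) = ?w x \<ominus>\<^bsub>R\<^esub> ?w y" if "x \<in> ?S" "y \<in> ?S" for x y
      using that w by (subst R.gsum_diff[OF w]) (auto simp: keys_frag_of R.gsum_frag_of)
    have g3: "gsum R ?w (frag_of x - frag_of y - frag_of z) = ?w x \<ominus>\<^bsub>R\<^esub> ?w y \<ominus>\<^bsub>R\<^esub> ?w z"
      if "x \<in> ?S" "y \<in> ?S" "z \<in> ?S" for x y z
      using that w by (subst R.gsum_diff[OF w])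
        (auto simp: keys_frag_of R.gsum_frag_of g2 keys_diff3_subset)
    have smult1: "\<phi> (c \<odot>\<^bsub>?A\<^esub> a) = \<phi> (H_coset m (Const c)) \<otimes>\<^bsub>R\<^esub> \<phi> a" if "a \<in> carrier ?A" for c a
      using that by (simp add: H_ops(5) H_coset_closed H_poly_closed)
    have smult2: "\<psi> (c \<odot>\<^bsub>?B\<^esub> a) = \<psi> (H_coset n (Const c)) \<otimes>\<^bsub>R\<^esub> \<psi> a" if "a \<in> carrier ?B" for c a
      using that by (simp add: H_ops(5) H_coset_closed H_poly_closed)
    have cc: "H_coset n (Const c) \<in> carrier ?B" for c by (simp add: H_coset_closed H_poly_closed)
    show "tensor_relations type_ring ?A ?B \<subseteq> ?I"
    proof
      fix f :: "'a mpoly set \<times> 'a mpoly set \<Rightarrow>\<^sub>0 int"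
      assume f: "f \<in> tensor_relations type_ring ?A ?B"
      have k: "Poly_Mapping.keys f \<subseteq> ?S"
        by (rule tensor_relations_closed[OF H_module_closed H_module_closed f])
      from f have "gsum R ?w f = \<zero>\<^bsub>R\<^esub>"
      proof (cases rule: tensor_relationsE)
        case (add_left u u' v)
        then have "\<phi> u \<in> carrier R" "\<phi> u' \<in> carrier R" "\<psi> v \<in> carrier R" by auto
        then have "(\<phi> u \<oplus>\<^bsub>R\<^esub> \<phi> u') \<otimes>\<^bsub>R\<^esub> \<psi> v \<ominus>\<^bsub>R\<^esub> \<phi> u \<otimes>\<^bsub>R\<^esub> \<psi> v \<ominus>\<^bsub>R\<^esub> \<phi> u' \<otimes>\<^bsub>R\<^esub> \<psi> v = \<zero>\<^bsub>R\<^esub>"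
          by algebra
        moreover have "gsum R ?w f = (\<phi> u \<oplus>\<^bsub>R\<^esub> \<phi> u') \<otimes>\<^bsub>R\<^esub> \<psi> v \<ominus>\<^bsub>R\<^esub> \<phi> u \<otimes>\<^bsub>R\<^esub> \<psi> v \<ominus>\<^bsub>R\<^esub> \<phi> u' \<otimes>\<^bsub>R\<^esub> \<psi> v"
          unfolding add_left(1) using add_left(2-) by (subst g3) (simp_all add: H_add_closed)
        ultimately show ?thesis by simp
      next
        case (add_right u v v')
        then have "\<phi> u \<in> carrier R" "\<psi> v \<in> carrier R" "\<psi> v' \<in> carrier R" by auto
        then have "\<phi> u \<otimes>\<^bsub>R\<^esub> (\<psi> v \<oplus>\<^bsub>R\<^esub> \<psi> v') \<ominus>\<^bsub>R\<^esub> \<phi> u \<otimes>\<^bsub>R\<^esub> \<psi> v \<ominus>\<^bsub>R\<^esub> \<phi> u \<otimes>\<^bsub>R\<^esub> \<psi> v' = \<zero>\<^bsub>R\<^esub>"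
          by algebra
        moreover have "gsum R ?w f = \<phi> u \<otimes>\<^bsub>R\<^esub> (\<psi> v \<oplus>\<^bsub>R\<^esub> \<psi> v') \<ominus>\<^bsub>R\<^esub> \<phi> u \<otimes>\<^bsub>R\<^esub> \<psi> v \<ominus>\<^bsub>R\<^esub> \<phi> u \<otimes>\<^bsub>R\<^esub> \<psi> v'"
          unfolding add_right(1) using add_right(2-) by (subst g3) (simp_all add: H_add_closed)
        ultimately show ?thesis by simp
      next
        case (smult c u v)
        then have "\<phi> u \<in> carrier R" "\<psi> v \<in> carrier R" "\<psi> (H_coset n (Const c)) \<in> carrier R"
          using cc by auto
        then have "\<psi> (H_coset n (Const c)) \<otimes>\<^bsub>R\<^esub> \<phi> u \<otimes>\<^bsub>R\<^esub> \<psi> v \<ominus>\<^bsub>R\<^esub>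
            \<phi> u \<otimes>\<^bsub>R\<^esub> (\<psi> (H_coset n (Const c)) \<otimes>\<^bsub>R\<^esub> \<psi> v) = \<zero>\<^bsub>R\<^esub>"
          by algebra
        moreover have "gsum R ?w f = \<psi> (H_coset n (Const c)) \<otimes>\<^bsub>R\<^esub> \<phi> u \<otimes>\<^bsub>R\<^esub> \<psi> v \<ominus>\<^bsub>R\<^esub>
            \<phi> u \<otimes>\<^bsub>R\<^esub> (\<psi> (H_coset n (Const c)) \<otimes>\<^bsub>R\<^esub> \<psi> v)"
          unfolding smult(1) using smult(2-)
          by (subst g2) (simp_all add: H_smult_closed smult1 smult2 const)
        ultimately show ?thesis by simp
      qed
      with k show "f \<in> ?I" by blast
    qed
  qed
  with f show ?thesis by blast
qed

text \<open>The value is given at an arbitrary representative \<open>g\<close>, because the action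
  on an outer tensor product is a union over all representatives.\<close>

lemma H2_lift_coset:
  assumes "cring R" "\<phi> \<in> ring_hom (H m) R" "\<psi> \<in> ring_hom (H n) R"
    and const: "\<And>c. \<phi> (H_coset m (Const c)) = \<psi> (H_coset n (Const c))"
    and f: "Poly_Mapping.keys f \<subseteq> carrier (H m) \<times> carrier (H n)" and g: "g \<in> H2_coset m n f"
  shows "H2_lift R \<phi> \<psi> (H2_coset m n f) = gsum R (\<lambda>(a, b). \<phi> a \<otimes>\<^bsub>R\<^esub> \<psi> b) g"
proof -
  let ?w = "\<lambda>(a, b). \<phi> a \<otimes>\<^bsub>R\<^esub> \<psi> b"
  interpret R: cring R by fact
  have w: "?w \<in> carrier (H m) \<times> carrier (H n) \<rightarrow> carrier R"
    using assms(2,3) by (auto simp: ring_hom_closed)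
  have "gsum R ?w k = gsum R ?w f" if "k \<in> H2_coset m n f" for k
  proof -
    have "gsum R ?w (k - f + f) = gsum R ?w (k - f) \<oplus>\<^bsub>R\<^esub> gsum R ?w f"
      by (rule R.gsum_add[OF w]) (use that f in \<open>auto simp: mem_H2_coset dest: H2_ideal_keys\<close>)
    then show ?thesis
      using H2_lift_ideal[OF assms(1-4), of "k - f"] that R.gsum_closed[OF w f]
      by (simp add: mem_H2_coset)
  qed
  then have "gsum R ?w ` H2_coset m n f = {gsum R ?w g}"
    using g by auto
  then show ?thesis by (simp add: H2_lift_def)
qed

section \<open>Tensor products by evaluation\<close>

text \<open>The standard models, used on the field and on its square: the additive group is fixed by
  the type and only the action varies.\<close>

definition type_module :: "('r \<Rightarrow> 'v \<Rightarrow> 'v) \<Rightarrow> ('r, 'v::ab_group_add) module" where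
  "type_module act =
     \<lparr>carrier = UNIV, monoid.mult = undefined, monoid.one = undefined,
      ring.zero = 0, ring.add = (+), module.smult = act\<rparr>"

lemma type_module_simps [simp]:
  "carrier (type_module act) = UNIV" "\<zero>\<^bsub>type_module act\<^esub> = 0"
  "add (type_module act) = (+)" "module.smult (type_module act) = act"
  by (simp_all add: type_module_def)

lemma type_module_closed: "module_closed R (type_module act)"
  by (simp add: module_closed_def)

lemma simple_module_eq: "simple_module \<alpha> = type_module (\<lambda>U v. H_char (descents \<alpha>) U * v)"
  by (simp add: simple_module_def type_module_def H_char_def eval_at_def[abs_def])

section \<open>Isomorphisms of modules and their effect on classes\<close>

lemma mod_isoI:
  assumes "bij_betw h (carrier M) (carrier N)"
    and "\<And>u v. u \<in> carrier M \<Longrightarrow> v \<in> carrier M \<Longrightarrow> h (u \<oplus>\<^bsub>M\<^esub> v) = h u \<oplus>\<^bsub>N\<^esub> h v"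
    and "\<And>r v. r \<in> carrier R \<Longrightarrow> v \<in> carrier M \<Longrightarrow> h (r \<odot>\<^bsub>M\<^esub> v) = r \<odot>\<^bsub>N\<^esub> h v"
  shows "mod_iso R M N"
  unfolding mod_iso_def mod_hom_def
  by (rule bexI[of _ h]) (use assms in \<open>auto simp: hom_def bij_betw_def\<close>)

lemma mod_isoE:
  assumes "mod_iso R M N"
  obtains h where "bij_betw h (carrier M) (carrier N)"
    and "\<And>u v. u \<in> carrier M \<Longrightarrow> v \<in> carrier M \<Longrightarrow> h (u \<oplus>\<^bsub>M\<^esub> v) = h u \<oplus>\<^bsub>N\<^esub> h v"
    and "\<And>r v. r \<in> carrier R \<Longrightarrow> v \<in> carrier M \<Longrightarrow> h (r \<odot>\<^bsub>M\<^esub> v) = r \<odot>\<^bsub>N\<^esub> h v"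
  using assms unfolding mod_iso_def mod_hom_def by (auto simp: hom_def)

lemma mod_iso_trans:
  assumes "mod_iso R M N" "mod_iso R N P"
  shows "mod_iso R M P"
proof -
  obtain h where h: "bij_betw h (carrier M) (carrier N)"
    "\<And>u v. u \<in> carrier M \<Longrightarrow> v \<in> carrier M \<Longrightarrow> h (u \<oplus>\<^bsub>M\<^esub> v) = h u \<oplus>\<^bsub>N\<^esub> h v"
    "\<And>r v. r \<in> carrier R \<Longrightarrow> v \<in> carrier M \<Longrightarrow> h (r \<odot>\<^bsub>M\<^esub> v) = r \<odot>\<^bsub>N\<^esub> h v"
    using mod_isoE[OF assms(1)] by blast
  obtain k where k: "bij_betw k (carrier N) (carrier P)"
    "\<And>u v. u \<in> carrier N \<Longrightarrow> v \<in> carrier N \<Longrightarrow> k (u \<oplus>\<^bsub>N\<^esub> v) = k u \<oplus>\<^bsub>P\<^esub> k v"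
    "\<And>r v. r \<in> carrier R \<Longrightarrow> v \<in> carrier N \<Longrightarrow> k (r \<odot>\<^bsub>N\<^esub> v) = r \<odot>\<^bsub>P\<^esub> k v"
    using mod_isoE[OF assms(2)] by blast
  show ?thesis
    by (rule mod_isoI[of "k \<circ> h"])
      (use h k in \<open>auto simp: bij_betwE intro: bij_betw_trans\<close>)
qed

lemma mod_iso_sym:
  assumes "module_closed R M" "mod_iso R M N"
  shows "mod_iso R N M"
proof -
  obtain h where h: "bij_betw h (carrier M) (carrier N)"
    "\<And>u v. u \<in> carrier M \<Longrightarrow> v \<in> carrier M \<Longrightarrow> h (u \<oplus>\<^bsub>M\<^esub> v) = h u \<oplus>\<^bsub>N\<^esub> h v"
    "\<And>r v. r \<in> carrier R \<Longrightarrow> v \<in> carrier M \<Longrightarrow> h (r \<odot>\<^bsub>M\<^esub> v) = r \<odot>\<^bsub>N\<^esub> h v"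
    using mod_isoE[OF assms(2)] by blast
  define k where "k = inv_into (carrier M) h"
  have k: "k (h v) = v" if "v \<in> carrier M" for v
    unfolding k_def using h(1) that by (intro inv_into_f_f) (auto simp: bij_betw_def)
  have N: "carrier N = h ` carrier M" using h(1) by (simp add: bij_betw_def)
  show ?thesis
  proof (rule mod_isoI)
    show "bij_betw k (carrier N) (carrier M)"
      unfolding k_def using h(1) by (rule bij_betw_inv_into)
  qed (use assms(1) in \<open>auto simp: N k module_closed_def simp flip: h(2,3)\<close>)
qed

text \<open>Isomorphic modules have the same small copies, so the two choices are made from the same
  predicate and coincide, whether or not a copy exists.\<close>

lemma mod_class_cong:
  assumes "module_closed R M" "mod_iso R M N"
  shows "mod_class R M = mod_class R N"
proof -
  have "P \<in> fg_modules R \<and> mod_iso R M P \<longleftrightarrow> P \<in> fg_modules R \<and> mod_iso R N P" for P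
    using mod_iso_trans[OF assms(2), of P] mod_iso_trans[OF mod_iso_sym[OF assms], of P] by blast
  then show ?thesis by (simp add: mod_class_def)
qed

section \<open>Tensor products by generators and relations\<close>

locale tensor_pair =
  fixes R :: "('r, 'x) ring_scheme" and M :: "('r, 'b) module" and N :: "('r, 'c) module"
  assumes closed_left: "module_closed R M" and closed_right: "module_closed R N"
begin

abbreviation tensor_basis :: "('b \<times> 'c) set" where
  "tensor_basis \<equiv> carrier M \<times> carrier N"

lemma tensor_kernel_subgroup: "subgroup (tensor_kernel R M N) (free_Abelian_group tensor_basis)"
  unfolding tensor_kernel_def
  by (rule group.generate_is_subgroup)
    (use tensor_relations_closed[OF closed_left closed_right] in \<open>auto simp del: mem_Sigma_iff\<close>)

lemma tensor_kernel_keys: "f \<in> tensor_kernel R M N \<Longrightarrow> Poly_Mapping.keys f \<subseteq> tensor_basis"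
  using subgroup.mem_carrier[OF tensor_kernel_subgroup] by (simp only: carrier_free_Abelian_group_iff)

lemma tensor_kernel_zero: "0 \<in> tensor_kernel R M N"
  using subgroup.one_closed[OF tensor_kernel_subgroup] by simp

lemma tensor_kernel_add:
  "f \<in> tensor_kernel R M N \<Longrightarrow> g \<in> tensor_kernel R M N \<Longrightarrow> f + g \<in> tensor_kernel R M N"
  using subgroup.m_closed[OF tensor_kernel_subgroup] by force

lemma tensor_kernel_uminus: "f \<in> tensor_kernel R M N \<Longrightarrow> - f \<in> tensor_kernel R M N"
  using subgroup.m_inv_closed[OF tensor_kernel_subgroup, of f] tensor_kernel_keys[of f]
  by simp

lemma tensor_kernel_diff:
  "f \<in> tensor_kernel R M N \<Longrightarrow> g \<in> tensor_kernel R M N \<Longrightarrow> f - g \<in> tensor_kernel R M N"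
  using tensor_kernel_add[of f "- g"] tensor_kernel_uminus[of g] by simp

lemma tensor_kernel_relation: "f \<in> tensor_relations R M N \<Longrightarrow> f \<in> tensor_kernel R M N"
  unfolding tensor_kernel_def by (rule generate.incl)

lemma tensor_kernel_add_left:
  "u \<in> carrier M \<Longrightarrow> u' \<in> carrier M \<Longrightarrow> v \<in> carrier N \<Longrightarrow>
     frag_of (u \<oplus>\<^bsub>M\<^esub> u', v) - frag_of (u, v) - frag_of (u', v) \<in> tensor_kernel R M N"
  by (rule tensor_kernel_relation) (auto simp: tensor_relations_def)

lemma tensor_kernel_smult:
  "r \<in> carrier R \<Longrightarrow> u \<in> carrier M \<Longrightarrow> v \<in> carrier N \<Longrightarrow>
     frag_of (r \<odot>\<^bsub>M\<^esub> u, v) - frag_of (u, r \<odot>\<^bsub>N\<^esub> v) \<in> tensor_kernel R M N"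
  by (rule tensor_kernel_relation) (auto simp: tensor_relations_def)

text \<open>Since \<open>w\<close> generates \<open>N\<close>, every right-hand factor is a multiple
  of \<open>w\<close> whose scalar moves to the left; pure tensors ending in \<open>w\<close> then
  combine by additivity. Kernel membership need only be decided for one pure tensor.\<close>

lemma tensor_reduce:
  assumes "abelian_group M" and w: "w \<in> carrier N"
    and cyclic: "\<And>v. v \<in> carrier N \<Longrightarrow> \<exists>r\<in>carrier R. v = r \<odot>\<^bsub>N\<^esub> w"
    and g: "Poly_Mapping.keys g \<subseteq> tensor_basis"
  obtains a where "a \<in> carrier M" "g - frag_of (a, w) \<in> tensor_kernel R M N"
proof -
  interpret M: abelian_group M by fact
  have "\<exists>a\<in>carrier M. g - frag_of (a, w) \<in> tensor_kernel R M N"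
    using g
  proof (induction g rule: frag_induct)
    case zero
    \<comment> \<open>For \<open>u = u' = 0\<close> the additive relation collapses to minus the
      pure tensor of 0 and \<open>w\<close>.\<close>
    have "0 - frag_of (\<zero>\<^bsub>M\<^esub>, w) \<in> tensor_kernel R M N"
      using tensor_kernel_add_left[OF M.zero_closed M.zero_closed w] by simp
    then show ?case by blast
  next
    case (diff f g)
    then obtain a b where a: "a \<in> carrier M" "f - frag_of (a, w) \<in> tensor_kernel R M N"
      and b: "b \<in> carrier M" "g - frag_of (b, w) \<in> tensor_kernel R M N" by blast
    \<comment> \<open>Differences are not among the relations; the additive one is applied to the
      splitting of \<open>a\<close> into \<open>a - b\<close> and \<open>b\<close>.\<close>
    have ab: "a \<ominus>\<^bsub>M\<^esub> b \<oplus>\<^bsub>M\<^esub> b = a"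
      using a(1) b(1) by (simp add: M.minus_eq M.a_assoc M.l_neg)
    have "frag_of (a, w) - frag_of (a \<ominus>\<^bsub>M\<^esub> b, w) - frag_of (b, w) \<in> tensor_kernel R M N"
      using tensor_kernel_add_left[of "a \<ominus>\<^bsub>M\<^esub> b" b w] a(1) b(1) w ab by simp
    with tensor_kernel_diff[OF a(2) b(2)]
    have "(f - frag_of (a, w)) - (g - frag_of (b, w)) +
        (frag_of (a, w) - frag_of (a \<ominus>\<^bsub>M\<^esub> b, w) - frag_of (b, w)) \<in> tensor_kernel R M N"
      by (rule tensor_kernel_add)
    then have "(f - g) - frag_of (a \<ominus>\<^bsub>M\<^esub> b, w) \<in> tensor_kernel R M N"
      by (simp add: algebra_simps)
    then show ?case using a(1) b(1) by blast
  next
    case (frag_of x)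
    then obtain u v where x: "x = (u, v)" "u \<in> carrier M" "v \<in> carrier N" by blast
    then obtain r where r: "r \<in> carrier R" "v = r \<odot>\<^bsub>N\<^esub> w" using cyclic by blast
    have "frag_of x - frag_of (r \<odot>\<^bsub>M\<^esub> u, w) \<in> tensor_kernel R M N"
      using tensor_kernel_uminus[OF tensor_kernel_smult[OF r(1) x(2) w]] by (simp add: x r)
    moreover have "r \<odot>\<^bsub>M\<^esub> u \<in> carrier M"
      using closed_left r x by (simp add: module_closed_def)
    ultimately show ?case by blast
  qed
  then show ?thesis using that by blast
qed

text \<open>An additive map that kills the relations kills the group they generate. Additivity is
  required in the form of differences, which covers inverses as well as sums.\<close>

lemma tensor_kernel_induct:
  assumes "f \<in> tensor_kernel R M N"
    and "\<Phi> 0 = (0::'v::ab_group_add)"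
    and diff: "\<And>f g. Poly_Mapping.keys f \<subseteq> tensor_basis \<Longrightarrow> Poly_Mapping.keys g \<subseteq> tensor_basis \<Longrightarrow>
      \<Phi> (f - g) = \<Phi> f - \<Phi> g"
    and rel: "\<And>f. f \<in> tensor_relations R M N \<Longrightarrow> \<Phi> f = 0"
  shows "\<Phi> f = 0"
  using assms(1) unfolding tensor_kernel_def
proof (induction rule: generate.induct)
  case one
  show ?case using assms(2) by simp
next
  case (incl h)
  then show ?case by (rule rel)
next
  case (inv h)
  then have k: "Poly_Mapping.keys h \<subseteq> tensor_basis"
    by (rule tensor_relations_closed[OF closed_left closed_right])
  then show ?case
    using diff[of 0 h] rel[OF inv] assms(2) by simp
next
  case (eng h1 h2)
  then have k: "Poly_Mapping.keys h1 \<subseteq> tensor_basis" "Poly_Mapping.keys h2 \<subseteq> tensor_basis"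
    using tensor_kernel_keys by (auto simp: tensor_kernel_def simp del: mem_Sigma_iff)
  then show ?case
    using diff[of h1 "- h2"] diff[of 0 h2] eng.IH assms(2) by simp
qed

end

text \<open>The setting of the first isomorphism theorem: \<open>\<Phi>\<close> is additive and
  onto, with the tensor kernel as its kernel. Cosets of formal sums are then the fibres of
  \<open>\<Phi>\<close> and can be named by their values in \<open>'v\<close>.\<close>

locale tensor_evaluation = tensor_pair R M N
  for R :: "('r, 'x) ring_scheme" and M :: "('r, 'b) module" and N :: "('r, 'c) module" +
  fixes \<Phi> :: "('b \<times> 'c \<Rightarrow>\<^sub>0 int) \<Rightarrow> 'v::ab_group_add"
  assumes eval_diff: "\<And>f g. Poly_Mapping.keys f \<subseteq> carrier M \<times> carrier N \<Longrightarrow>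
      Poly_Mapping.keys g \<subseteq> carrier M \<times> carrier N \<Longrightarrow> \<Phi> (f - g) = \<Phi> f - \<Phi> g"
    and eval_kernel: "\<And>f. Poly_Mapping.keys f \<subseteq> carrier M \<times> carrier N \<Longrightarrow>
      f \<in> tensor_kernel R M N \<longleftrightarrow> \<Phi> f = 0"
    and eval_surj: "\<And>v. \<exists>f. Poly_Mapping.keys f \<subseteq> carrier M \<times> carrier N \<and> \<Phi> f = v"
begin

definition fibre :: "'v \<Rightarrow> ('b \<times> 'c \<Rightarrow>\<^sub>0 int) set" where
  "fibre v = {f. Poly_Mapping.keys f \<subseteq> tensor_basis \<and> \<Phi> f = v}"

lemma keys_diff_basis:
  "Poly_Mapping.keys f \<subseteq> A \<Longrightarrow> Poly_Mapping.keys g \<subseteq> A \<Longrightarrow> Poly_Mapping.keys (f - g) \<subseteq> A"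
  using keys_diff[of f g] by blast

lemma keys_add_basis:
  "Poly_Mapping.keys f \<subseteq> A \<Longrightarrow> Poly_Mapping.keys g \<subseteq> A \<Longrightarrow> Poly_Mapping.keys (f + g) \<subseteq> A"
  using keys_add[of f g] by blast

lemma eval_add:
  assumes "Poly_Mapping.keys f \<subseteq> tensor_basis" "Poly_Mapping.keys g \<subseteq> tensor_basis"
  shows "\<Phi> (f + g) = \<Phi> f + \<Phi> g"
  using eval_diff[OF keys_add_basis[OF assms] assms(2)] by simp

lemma tensor_coset_eq_fibre:
  assumes f: "Poly_Mapping.keys f \<subseteq> tensor_basis"
  shows "tensor_coset R M N f = fibre (\<Phi> f)"
proof (rule Set.set_eqI)
  fix g
  have "g \<in> tensor_coset R M N f \<longleftrightarrow> g - f \<in> tensor_kernel R M N"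
    by (auto simp: tensor_coset_def r_coset_def intro: bexI[of _ "g - f"])
  also have "\<dots> \<longleftrightarrow> g \<in> fibre (\<Phi> f)"
  proof
    assume k: "g - f \<in> tensor_kernel R M N"
    then have "Poly_Mapping.keys (g - f) \<subseteq> tensor_basis" by (rule tensor_kernel_keys)
    then have g: "Poly_Mapping.keys g \<subseteq> tensor_basis"
      using keys_add_basis[of "g - f" tensor_basis f] f by simp
    moreover have "\<Phi> (g - f) = 0"
      using k eval_kernel[OF keys_diff_basis[OF g f]] by simp
    ultimately show "g \<in> fibre (\<Phi> f)"
      using eval_diff[OF g f] by (simp add: fibre_def)
  next
    assume "g \<in> fibre (\<Phi> f)"
    then show "g - f \<in> tensor_kernel R M N"
      using eval_kernel[OF keys_diff_basis, of g f] eval_diff[of g f] f by (simp add: fibre_def)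
  qed
  finally show "g \<in> tensor_coset R M N f \<longleftrightarrow> g \<in> fibre (\<Phi> f)" .
qed

lemma fibre_nonempty: "fibre v \<noteq> {}"
  using eval_surj[of v] by (auto simp: fibre_def)

lemma fibre_inj: "inj fibre"
proof (rule injI)
  fix v v' assume "fibre v = fibre v'"
  moreover obtain f where "f \<in> fibre v" using fibre_nonempty by blast
  ultimately have "f \<in> fibre v" "f \<in> fibre v'" by simp_all
  then show "v = v'" by (simp add: fibre_def)
qed

lemma carrier_tensor_group: "carrier (tensor_group R M N) = range fibre"
proof -
  have "carrier (tensor_group R M N) = tensor_coset R M N ` {f. Poly_Mapping.keys f \<subseteq> tensor_basis}"
    by (auto simp: tensor_group_def FactGroup_def RCOSETS_def tensor_coset_def free_Abelian_group_def)
  also have "\<dots> = (\<lambda>f. fibre (\<Phi> f)) ` {f. Poly_Mapping.keys f \<subseteq> tensor_basis}"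
    by (intro image_cong refl tensor_coset_eq_fibre) simp
  also have "\<dots> = range fibre"
  proof -
    have "fibre v \<in> (\<lambda>f. fibre (\<Phi> f)) ` {f. Poly_Mapping.keys f \<subseteq> tensor_basis}" for v
      using eval_surj[of v] by blast
    then show ?thesis by blast
  qed
  finally show ?thesis .
qed

lemma fibre_add: "fibre v \<otimes>\<^bsub>tensor_group R M N\<^esub> fibre v' = fibre (v + v')"
proof -
  have "fibre v \<otimes>\<^bsub>tensor_group R M N\<^esub> fibre v' = (\<Union>f\<in>fibre v. \<Union>g\<in>fibre v'. {f + g})"
    by (simp add: tensor_group_def FactGroup_def set_mult_def)
  also have "\<dots> = fibre (v + v')"
  proof (intro equalityI subsetI)
    fix k assume "k \<in> (\<Union>f\<in>fibre v. \<Union>g\<in>fibre v'. {f + g})"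
    then obtain f g where "k = f + g" "f \<in> fibre v" "g \<in> fibre v'" by blast
    then show "k \<in> fibre (v + v')"
      by (simp add: fibre_def eval_add keys_add_basis)
  next
    fix k assume k: "k \<in> fibre (v + v')"
    \<comment> \<open>Subtracting any fixed member of the first fibre leaves a member of the
      second.\<close>
    obtain f where f: "f \<in> fibre v" using fibre_nonempty by blast
    then have "k - f \<in> fibre v'"
      using k by (simp add: fibre_def eval_diff keys_diff_basis)
    then show "k \<in> (\<Union>f\<in>fibre v. \<Union>g\<in>fibre v'. {f + g})"
      using f by (intro UN_I[of f] UN_I[of "k - f"]) auto
  qed
  finally show ?thesis .
qed

text \<open>The bijection \<open>fibre\<close> already respects addition, so an isomorphism of
  modules only requires a computation of the action on fibres.\<close>

lemma tensor_group_iso: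
  assumes "\<And>s v. s \<in> carrier S \<Longrightarrow> act s (fibre v) = fibre (act' s v)"
  shows "mod_iso S (type_module act') (module_on (tensor_group R M N) act)"
proof (rule mod_isoI)
  show "bij_betw fibre (carrier (type_module act')) (carrier (module_on (tensor_group R M N) act))"
    using fibre_inj by (simp add: bij_betw_def module_on_def carrier_tensor_group)
qed (use assms in \<open>auto simp: module_on_def fibre_add\<close>)

end

section \<open>Restriction\<close>

lemma abelian_group_UNIV:
  fixes M :: "('r, 'v::ab_group_add) module"
  assumes "carrier M = UNIV" "\<zero>\<^bsub>M\<^esub> = 0" "add M = (+)"
  shows "abelian_group M"
  by (rule abelian_groupI)
    (use assms in \<open>auto simp: ac_simps intro: exI[of _ "- x" for x]\<close>)

text \<open>The tensor square of the field is the field, by multiplication: each formal sum is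
  congruent to \<open>a \<otimes> 1\<close>, and multiplying out recovers \<open>a\<close>.\<close>

lemma field_tensor_evaluation:
  fixes M N :: "('a::field, 'a) module"
  assumes M: "carrier M = UNIV" "\<zero>\<^bsub>M\<^esub> = 0" "add M = (+)" "\<And>c v. c \<odot>\<^bsub>M\<^esub> v = c * v"
    and N: "carrier N = UNIV" "add N = (+)" "\<And>c v. c \<odot>\<^bsub>N\<^esub> v = c * v"
  shows "tensor_evaluation type_ring M N (gsum type_ring (\<lambda>(u, v). u * v))"
proof -
  let ?\<Phi> = "gsum type_ring (\<lambda>(u, v). u * v) :: ('a \<times> 'a \<Rightarrow>\<^sub>0 int) \<Rightarrow> 'a"
  interpret tensor_pair type_ring M N
    by standard (simp_all add: module_closed_def M N)
  show ?thesis
  proof unfold_locales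
    fix f :: "'a \<times> 'a \<Rightarrow>\<^sub>0 int"
    have ker: "?\<Phi> g = 0" if "g \<in> tensor_kernel type_ring M N" for g
      using that
    proof (rule tensor_kernel_induct)
      fix g assume "g \<in> tensor_relations type_ring M N"
      then show "?\<Phi> g = 0"
        by (cases rule: tensor_relationsE) (simp_all add: M N gsum_type_ring_simps distrib_left distrib_right)
    qed (simp_all add: gsum_type_ring_simps)
    have cyclic: "\<exists>r\<in>carrier type_ring. v = r \<odot>\<^bsub>N\<^esub> 1" for v
      by (intro bexI[of _ v]) (simp_all add: N)
    obtain a where a: "f - frag_of (a, 1) \<in> tensor_kernel type_ring M N"
      using tensor_reduce[OF abelian_group_UNIV[OF M(1-3)], of 1 f] cyclic by (auto simp: M N)
    have fa: "?\<Phi> f = a"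
      using ker[OF a] by (simp add: gsum_type_ring_simps)
    show "f \<in> tensor_kernel type_ring M N \<longleftrightarrow> ?\<Phi> f = 0"
    proof
      assume "?\<Phi> f = 0"
      then have "f - frag_of (0, 1) \<in> tensor_kernel type_ring M N" using a fa by simp
      moreover have "- frag_of (0, 1) \<in> tensor_kernel type_ring M N"
        using tensor_kernel_add_left[of 0 0 1] by (simp add: M N)
      ultimately have "f - frag_of (0, 1) - - frag_of (0, 1) \<in> tensor_kernel type_ring M N"
        by (rule tensor_kernel_diff)
      then show "f \<in> tensor_kernel type_ring M N" by simp
    qed (rule ker)
  next
    fix v :: 'a
    show "\<exists>f. Poly_Mapping.keys f \<subseteq> carrier M \<times> carrier N \<and> ?\<Phi> f = v"
      by (intro exI[of _ "frag_of (v, 1)"]) (simp add: M N gsum_type_ring_simps)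
  qed (simp add: gsum_type_ring_simps)
qed

abbreviation H_char_module :: "nat set \<Rightarrow> ('a::field mpoly set, 'a) module" where
  "H_char_module D \<equiv> type_module (\<lambda>U v. H_char D U * v)"

definition H2_char :: "nat set \<Rightarrow> nat set \<Rightarrow> 'a::field H2_elem \<Rightarrow> 'a" where
  "H2_char D E = H2_lift type_ring (H_char D) (H_char E)"

lemma H_char_Const: "nonadjacent D \<Longrightarrow> H_char D (H_coset n (Const c)) = c"
  by (simp add: H_char_coset eval_at_simps)

lemma H2_char_coset:
  assumes "nonadjacent D" "nonadjacent E"
    and "Poly_Mapping.keys f \<subseteq> carrier (H m) \<times> carrier (H n)" "g \<in> H2_coset m n f"
  shows "H2_char D E (H2_coset m n f) = gsum type_ring (\<lambda>(a, b). H_char D a * H_char E b) g"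
  unfolding H2_char_def
  using H2_lift_coset[OF type_ring_cring H_char_ring_hom[OF assms(1)] H_char_ring_hom[OF assms(2)] _ assms(3,4)]
  by (simp add: H_char_Const assms(1,2))

lemma H_tensor_iso:
  assumes D: "nonadjacent D" and E: "nonadjacent E"
  shows "mod_iso (H2 m n :: 'a::field H2_elem ring) (type_module (\<lambda>U v. H2_char D E U * v))
    (H_tensor m n (H_char_module D) (H_char_module E))"
proof -
  let ?M = "base_module (H m) (H_char_module D) :: ('a, 'a) module"
  let ?N = "base_module (H n) (H_char_module E) :: ('a, 'a) module"
  let ?val = "\<lambda>(u, v). u * v :: 'a"
  let ?\<chi> = "\<lambda>(a :: 'a mpoly set, b). H_char D a * H_char E b"
  define op :: "('a mpoly set \<times> 'a mpoly set \<Rightarrow>\<^sub>0 int) \<Rightarrow> ('a \<times> 'a \<Rightarrow>\<^sub>0 int) \<Rightarrow> 'a \<times> 'a \<Rightarrow>\<^sub>0 int"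
    where "op f g = frag_extend (\<lambda>(a, b). frag_extend (\<lambda>(u, v).
      frag_of (a \<odot>\<^bsub>H_char_module D\<^esub> u, b \<odot>\<^bsub>H_char_module E\<^esub> v)) g) f" for f g
  have one: "H_char D (c \<odot>\<^bsub>H k\<^esub> \<one>\<^bsub>H k\<^esub>) = c" if "nonadjacent D" for c :: 'a and k D
    using that by (simp add: H_ops(2,5) H_mult H_poly_closed H_char_Const)
  have simps: "carrier ?M = UNIV" "\<zero>\<^bsub>?M\<^esub> = 0" "add ?M = (+)" "\<And>c v. c \<odot>\<^bsub>?M\<^esub> v = c * v"
    "carrier ?N = UNIV" "add ?N = (+)" "\<And>c v. c \<odot>\<^bsub>?N\<^esub> v = c * v"
    by (simp_all add: base_module_def restrict_scalars_def one D E)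
  interpret tensor_evaluation type_ring ?M ?N "gsum type_ring ?val"
    using simps by (rule field_tensor_evaluation)
  \<comment> \<open>Both sides are additive in \<open>f\<close> and in \<open>g\<close>; on
    generators this is a rearrangement of four factors in the field.\<close>
  have op: "gsum type_ring ?val (op f g) = gsum type_ring ?\<chi> f * gsum type_ring ?val g" for f g
    using subset_UNIV
  proof (induction f rule: frag_induct)
    case (frag_of x)
    show ?case
      using subset_UNIV
    proof (induction g rule: frag_induct)
    qed (auto simp: op_def gsum_type_ring_simps frag_extend_diff algebra_simps split: prod.splits)
  qed (auto simp: op_def gsum_type_ring_simps frag_extend_diff algebra_simps)
  show ?thesis
    unfolding H_tensor_def outer_tensor_def Let_def op_def[symmetric]
  proof (rule tensor_group_iso)
    fix U :: "'a H2_elem" and v assume "U \<in> carrier (H2 m n)"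
    then obtain f0 where f0: "Poly_Mapping.keys f0 \<subseteq> carrier (H m) \<times> carrier (H n)" "U = H2_coset m n f0"
      by (rule H2_carrierE)
    \<comment> \<open>Every pair of representatives produces the same fibre, so the union defining
      the action is that single fibre.\<close>
    have "tensor_coset type_ring ?M ?N (op f g) = fibre (H2_char D E U * v)"
      if "f \<in> U" "g \<in> fibre v" for f g
      using that H2_char_coset[OF D E f0(1), of f] f0(2)
      by (simp add: tensor_coset_eq_fibre simps op fibre_def)
    moreover have "U \<noteq> {}" "fibre v \<noteq> {}"
      using f0(2) H2_coset_self[of f0 m n] fibre_nonempty[of v] by blast+
    ultimately show "(\<Union>f\<in>U. \<Union>g\<in>fibre v. tensor_coset type_ring ?M ?N (op f g)) = fibre (H2_char D E U * v)"
      by simp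
  qed
qed

text \<open>Neither \<open>CD\<close> nor \<open>CE\<close> speaks of the index \<open>m\<close>,
  because the embedded subalgebra has no generator \<open>x_m\<close>. The freedom left there is
  what induction has to resolve.\<close>

lemma H_char_embed:
  assumes "nonadjacent C" "nonadjacent D" "nonadjacent E"
    and CD: "\<And>i. i \<in> {1..<m} \<Longrightarrow> i \<in> C \<longleftrightarrow> i \<in> D"
    and CE: "\<And>i. i \<in> {1..<n} \<Longrightarrow> i + m \<in> C \<longleftrightarrow> i \<in> E"
    and U: "U \<in> carrier (H2 m n)"
  shows "H_embed m n U \<in> carrier (H (m + n))" "H_char C (H_embed m n U) = H2_char D E U"
proof -
  let ?R = "H (m + n) :: ('a, 'a mpoly set) module"
  let ?S = "carrier (H m) \<times> carrier (H n) :: ('a mpoly set \<times> 'a mpoly set) set"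
  let ?w = "\<lambda>(a, b). H_shift (m + n) 0 a \<otimes>\<^bsub>?R\<^esub> H_shift (m + n) m b"
  obtain f where f: "Poly_Mapping.keys f \<subseteq> ?S" "U = H2_coset m n f"
    using U by (rule H2_carrierE)
  have hom: "H_shift (m + n) 0 \<in> ring_hom (H m) ?R" "H_shift (m + n) m \<in> ring_hom (H n) ?R"
    by (auto intro: H_shift_ring_hom)
  have w: "?w \<in> ?S \<rightarrow> carrier ?R"
    using hom by (auto simp: ring_hom_closed intro!: H_mult_closed)
  have "H_embed m n U = gsum ?R ?w f"
    unfolding H_embed_eq_lift f(2)
    by (rule H2_lift_coset[OF H_cring hom _ f(1) H2_coset_self])
      (simp add: H_shift_coset Const_hom.poly_subst_simps)
  moreover have "gsum ?R ?w f \<in> carrier ?R"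
    by (rule abelian_group.gsum_closed[OF ring.is_abelian_group[OF cring.axioms(1)[OF H_cring]] w f(1)])
  moreover have "H_char C (gsum ?R ?w f) = gsum type_ring (\<lambda>x. H_char C (?w x)) f"
    by (rule gsum_hom[OF H_cring type_ring_cring H_char_ring_hom[OF assms(1)] w f(1)])
  moreover have "\<dots> = gsum type_ring (\<lambda>(a, b). H_char D a * H_char E b) f"
  proof (rule gsum_cong[OF type_ring_abelian_group _ f(1)])
    fix x assume "x \<in> ?S"
    then obtain a b where x: "x = (a, b)" "a \<in> carrier (H m)" "b \<in> carrier (H n)" by blast
    have "H_char C (H_shift (m + n) 0 a) = H_char D a"
      by (rule H_char_shift[where n = m]) (use assms(1,2) CD x in auto)
    moreover have "H_char C (H_shift (m + n) m b) = H_char E b"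
      by (rule H_char_shift[where n = n]) (use assms(1,3) CE x in auto)
    ultimately show "H_char C (?w x) = (\<lambda>(a, b). H_char D a * H_char E b) x"
      using ring_hom_mult[OF H_char_ring_hom[OF assms(1)]
          ring_hom_closed[OF hom(1) x(2)] ring_hom_closed[OF hom(2) x(3)]] x(1) by simp
  qed auto
  ultimately show "H_embed m n U \<in> carrier ?R" "H_char C (H_embed m n U) = H2_char D E U"
    using H2_char_coset[OF assms(2,3) f(1) H2_coset_self] f(2) by simp_all
qed

lemma mod_iso_type_module_cong:
  assumes "\<And>r v. r \<in> carrier R \<Longrightarrow> act r v = act' r v"
  shows "mod_iso R (type_module act) (type_module act')"
  by (rule mod_isoI[of id]) (use assms in auto)

lemma H_restriction_iso:
  assumes "nonadjacent C" "nonadjacent D" "nonadjacent E"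
    and "\<And>i. i \<in> {1..<m} \<Longrightarrow> i \<in> C \<longleftrightarrow> i \<in> D"
    and "\<And>i. i \<in> {1..<n} \<Longrightarrow> i + m \<in> C \<longleftrightarrow> i \<in> E"
  shows "mod_iso (H2 m n :: 'a::field H2_elem ring) (restrict_scalars (H_embed m n) (H_char_module C))
    (H_tensor m n (H_char_module D) (H_char_module E))"
proof (rule mod_iso_trans[OF _ H_tensor_iso[OF assms(2,3)]])
  have "restrict_scalars (H_embed m n) (H_char_module C :: ('a mpoly set, 'a) module)
      = type_module (\<lambda>U v. H_char C (H_embed m n U) * v)"
    by (simp add: restrict_scalars_def type_module_def)
  moreover have "mod_iso (H2 m n :: 'a H2_elem ring) (type_module (\<lambda>U v. H_char C (H_embed m n U) * v))
      (type_module (\<lambda>U v. H2_char D E U * v))"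
    by (intro mod_iso_type_module_cong arg_cong2[where f = "(*)"] refl H_char_embed(2))
      (use assms in auto)
  ultimately show "mod_iso (H2 m n :: 'a H2_elem ring) (restrict_scalars (H_embed m n) (H_char_module C))
      (type_module (\<lambda>U v. H2_char D E U * v))"
    by simp
qed

section \<open>Induction\<close>

lemma H_ideal_square: "i \<in> {1..<n} \<Longrightarrow> Var i * Var i - Var i \<in> H_ideal n"
  by (rule subsetD[OF H_relators_in_ideal]) (auto simp: power2_eq_square)

lemma H_ideal_adjacent: "1 \<le> i \<Longrightarrow> i + 1 < n \<Longrightarrow> Var i * Var (i + 1) \<in> H_ideal n"
  by (rule subsetD[OF H_relators_in_ideal]) auto

text \<open>\<open>T\<close> stands for the outer tensor product of two simple modules. Its elements
  are cosets of formal sums, so it is accessed through a parametrization \<open>h\<close> by the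
  field, under which the tensor algebra acts by its character; \<open>h 1\<close> is the
  generator.\<close>

locale H_induction =
  fixes m n :: nat and D E :: "nat set"
    and T :: "('a::field H2_elem, 'b) module" and h :: "'a \<Rightarrow> 'b"
  assumes D: "nonadjacent D" and E: "nonadjacent E"
    and h_bij: "bij_betw h UNIV (carrier T)"
    and h_add: "\<And>u v. h (u + v) = h u \<oplus>\<^bsub>T\<^esub> h v"
    and h_smult: "\<And>r v. r \<in> carrier (H2 m n) \<Longrightarrow> h (H2_char D E r * v) = r \<odot>\<^bsub>T\<^esub> h v"
begin

abbreviation target :: "('a, 'a mpoly set) module" where
  "target \<equiv> H (m + n)"

abbreviation scalars :: "('a H2_elem, 'a mpoly set) module" where
  "scalars \<equiv> restrict_scalars (H_embed m n) (regular_module target)"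

definition val :: "'b \<Rightarrow> 'a" where
  "val = the_inv h"

lemma val_h [simp]: "val (h v) = v"
  using h_bij by (simp add: val_def bij_betw_def the_inv_f_f)

lemma carrier_T: "carrier T = range h"
  using h_bij by (simp add: bij_betw_def)

lemma scalars_simps [simp]:
  "carrier scalars = carrier target" "\<zero>\<^bsub>scalars\<^esub> = \<zero>\<^bsub>target\<^esub>" "add scalars = add target"
  "r \<odot>\<^bsub>scalars\<^esub> a = H_embed m n r \<otimes>\<^bsub>target\<^esub> a"
  by (simp_all add: restrict_scalars_def regular_module_def)

text \<open>\<open>F\<close> is the set of indices acting by 1 in a simple module whose restriction to
  \<open>\<H>\<^sub>m \<otimes> \<H>\<^sub>n\<close> is given by \<open>D\<close> and \<open>E\<close>.\<close>

definition restricts :: "nat set \<Rightarrow> bool" where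
  "restricts F \<longleftrightarrow> nonadjacent F \<and> (\<forall>i\<in>{1..<m}. i \<in> F \<longleftrightarrow> i \<in> D) \<and> (\<forall>i\<in>{1..<n}. i + m \<in> F \<longleftrightarrow> i \<in> E)"

lemma H_char_embed_restricts:
  assumes "restricts F" "U \<in> carrier (H2 m n)"
  shows "H_char F (H_embed m n U) = H2_char D E U"
  by (rule H_char_embed(2)[OF _ D E _ _ assms(2)]) (use assms(1) in \<open>auto simp: restricts_def\<close>)

text \<open>If \<open>restricts F\<close> holds, this is, on formal sums, the homomorphism from the
  induced module to the simple module of \<open>F\<close> that Frobenius reciprocity attaches to the
  inverse of \<open>h\<close>.\<close>

definition evaluation :: "nat set \<Rightarrow> ('a mpoly set \<times> 'b \<Rightarrow>\<^sub>0 int) \<Rightarrow> 'a" where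
  "evaluation F = gsum type_ring (\<lambda>(a, t). H_char F a * val t)"

lemma evaluation_simps:
  "evaluation F 0 = 0" "evaluation F (frag_of (a, t)) = H_char F a * val t"
  "evaluation F (f - g) = evaluation F f - evaluation F g"
  by (simp_all add: evaluation_def gsum_type_ring_simps)

definition shift_action :: "'a mpoly set \<Rightarrow> ('a mpoly set \<times> 'b \<Rightarrow>\<^sub>0 int) \<Rightarrow> 'a mpoly set \<times> 'b \<Rightarrow>\<^sub>0 int" where
  "shift_action a g = frag_extend (\<lambda>(a', t). frag_of (a \<otimes>\<^bsub>target\<^esub> a', t)) g"

lemma shift_action_closed:
  assumes "a \<in> carrier target" "Poly_Mapping.keys g \<subseteq> carrier target \<times> carrier T"
  shows "Poly_Mapping.keys (shift_action a g) \<subseteq> carrier target \<times> carrier T"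
  unfolding shift_action_def
  by (rule frag_extend_closed[OF _ assms(2)]) (use assms(1) in \<open>auto simp: keys_frag_of H_mult_closed\<close>)

text \<open>The evaluation is linear over the large algebra, so that on fibres the induced action is
  multiplication by the character.\<close>

lemma evaluation_shift_action:
  assumes "nonadjacent F" "a \<in> carrier target" "Poly_Mapping.keys g \<subseteq> carrier target \<times> carrier T"
  shows "evaluation F (shift_action a g) = H_char F a * evaluation F g"
  using assms(3)
proof (induction g rule: frag_induct)
  case (frag_of x)
  then show ?case
    using ring_hom_mult[OF H_char_ring_hom[OF assms(1)] assms(2)]
    by (cases x) (simp add: shift_action_def evaluation_simps)
qed (simp_all add: shift_action_def evaluation_simps frag_extend_diff right_diff_distrib)

lemma restricts_exists: "\<exists>F. restricts F"
proof (intro exI)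
  \<comment> \<open>Leaving \<open>m\<close> out separates the blocks: one ends at
    \<open>m - 1\<close>, the other starts at \<open>m + 1\<close>. The index 0 is removed from
    \<open>E\<close> since it would be shifted to \<open>m\<close>.\<close>
  show "restricts ((D \<inter> {..<m}) \<union> (\<lambda>i. i + m) ` (E \<inter> {1..}))"
    using D E unfolding restricts_def nonadjacent_def by (auto simp: image_iff)
qed

text \<open>Closure is the first conclusion of \<open>H_char_embed\<close>, which can be invoked as
  soon as one completion is at hand.\<close>

lemma H_embed_closed: "r \<in> carrier (H2 m n) \<Longrightarrow> H_embed m n r \<in> carrier target"
proof -
  assume r: "r \<in> carrier (H2 m n)"
  obtain F where "restricts F" using restricts_exists by blast
  then show ?thesis
    by (intro H_char_embed(1)[OF _ D E _ _ r, of F]) (auto simp: restricts_def)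
qed

sublocale tensor_pair "H2 m n" scalars T
proof
  show "module_closed (H2 m n) scalars"
    by (auto simp: module_closed_def H_add_closed H_mult_closed H_embed_closed)
  show "module_closed (H2 m n) T"
    by (auto simp: module_closed_def carrier_T simp flip: h_add h_smult)
qed

abbreviation kernel :: "('a mpoly set \<times> 'b \<Rightarrow>\<^sub>0 int) set" where
  "kernel \<equiv> tensor_kernel (H2 m n) scalars T"

text \<open>The balancing relation is respected because the character of \<open>F\<close> restricts
  to that of the pair \<open>D\<close>, \<open>E\<close>. Each completion thus bounds the induced
  module from below.\<close>

lemma evaluation_kernel:
  assumes F: "restricts F" and g: "g \<in> kernel"
  shows "evaluation F g = 0"
  using g
proof (rule tensor_kernel_induct)
  have na: "nonadjacent F" using F by (simp add: restricts_def)
  note hom = H_char_ring_hom[OF na, of "m + n"]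
  fix g assume "g \<in> tensor_relations (H2 m n) scalars T"
  then show "evaluation F g = 0"
  proof (cases rule: tensor_relationsE)
    case (add_left u u' v)
    then show ?thesis
      using ring_hom_add[OF hom, of u u'] by (simp add: evaluation_simps distrib_right)
  next
    case (add_right u v v')
    then obtain x y where "v = h x" "v' = h y" by (auto simp: carrier_T)
    then show ?thesis
      using add_right(1) by (simp add: evaluation_simps distrib_left flip: h_add)
  next
    case (smult r u v)
    then obtain x where "v = h x" by (auto simp: carrier_T)
    then show ?thesis
      using smult ring_hom_mult[OF hom H_embed_closed[OF smult(2)], of u] H_char_embed_restricts[OF F smult(2)]
      by (simp add: evaluation_simps flip: h_smult)
  qed
qed (simp_all add: evaluation_simps)

section \<open>Elements of the tensor algebra acting on the generator\<close>

lemma pure_in_H2: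
  assumes "a \<in> carrier (H m)" "b \<in> carrier (H n)"
  shows "H2_coset m n (frag_of (a, b)) \<in> carrier (H2 m n)"
  using assms by (auto simp: carrier_H2 keys_frag_of)

lemma H2_char_pure:
  assumes "a \<in> carrier (H m)" "b \<in> carrier (H n)"
  shows "H2_char D E (H2_coset m n (frag_of (a, b))) = H_char D a * H_char E b"
  using H2_char_coset[OF D E _ H2_coset_self, of "frag_of (a, b)" m n] assms
  by (simp add: gsum_type_ring_simps keys_frag_of)

lemma H_embed_pure:
  fixes a b :: "'a mpoly set"
  assumes "a \<in> carrier (H m)" "b \<in> carrier (H n)"
  shows "H_embed m n (H2_coset m n (frag_of (a, b))) = H_shift (m + n) 0 a \<otimes>\<^bsub>target\<^esub> H_shift (m + n) m b"
proof -
  have hom: "H_shift (m + n) 0 \<in> ring_hom (H m) target" "H_shift (m + n) m \<in> ring_hom (H n) target"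
    by (auto intro: H_shift_ring_hom)
  have "H_embed m n (H2_coset m n (frag_of (a, b)))
      = gsum target (\<lambda>(a, b). H_shift (m + n) 0 a \<otimes>\<^bsub>target\<^esub> H_shift (m + n) m b) (frag_of (a, b))"
    unfolding H_embed_eq_lift
    by (rule H2_lift_coset[OF H_cring hom _ _ H2_coset_self])
      (use assms in \<open>simp_all add: H_shift_coset Const_hom.poly_subst_simps keys_frag_of\<close>)
  also have "\<dots> = H_shift (m + n) 0 a \<otimes>\<^bsub>target\<^esub> H_shift (m + n) m b"
    using ring_hom_closed[OF hom(1) assms(1)] ring_hom_closed[OF hom(2) assms(2)]
    by (simp add: abelian_group.gsum_frag_of ring.is_abelian_group cring.axioms(1) H_cring H_mult_closed)
  finally show ?thesis .
qed

text \<open>The induced module is balanced over the tensor algebra, not directly over the field; a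
  field scalar crosses the tensor sign as \<open>c \<otimes> 1\<close>.\<close>

lemma scalar_exists:
  fixes c :: 'a
  obtains r where "r \<in> carrier (H2 m n)" "H2_char D E r = c"
    "H_embed m n r = H_coset (m + n) (Const c)"
proof
  let ?a = "H_coset m (Const c)" and ?b = "H_coset n (1 :: 'a mpoly)"
  have c: "?a \<in> carrier (H m)" "?b \<in> carrier (H n)"
    by (simp_all add: H_coset_closed H_poly_closed)
  show "H2_coset m n (frag_of (?a, ?b)) \<in> carrier (H2 m n)"
    using c by (rule pure_in_H2)
  show "H2_char D E (H2_coset m n (frag_of (?a, ?b))) = c"
    unfolding H2_char_pure[OF c] by (simp add: H_char_coset D E eval_at_simps)
  show "H_embed m n (H2_coset m n (frag_of (?a, ?b))) = H_coset (m + n) (Const c)"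
    unfolding H_embed_pure[OF c]
    by (simp add: H_shift_coset Const_hom.poly_subst_simps H_mult H_poly_closed)
qed

text \<open>The preimage is \<open>x_i \<otimes> 1\<close> to the left of \<open>m\<close> and
  \<open>1 \<otimes> x_(i-m)\<close> to the right. Writing the scalar as a coordinate of
  \<open>C\<close> treats both sides uniformly.\<close>

lemma variable_exists:
  assumes i: "i \<in> {1..<m + n}" "i \<noteq> m" and C: "restricts C"
  obtains r where "r \<in> carrier (H2 m n)" "H2_char D E r = (H_point C i :: 'a)"
    "H_embed m n r = H_coset (m + n) (Var i)"
proof (cases "i < m")
  case True
  let ?a = "H_coset m (Var i :: 'a mpoly)" and ?b = "H_coset n (1 :: 'a mpoly)"
  have c: "?a \<in> carrier (H m)" "?b \<in> carrier (H n)"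
    using i True by (simp_all add: H_coset_closed H_poly_closed)
  have "i \<in> C \<longleftrightarrow> i \<in> D" using C i True by (simp add: restricts_def)
  then have "H2_char D E (H2_coset m n (frag_of (?a, ?b))) = (H_point C i :: 'a)"
    unfolding H2_char_pure[OF c] by (simp add: H_char_coset D E eval_at_simps)
  moreover have "H_embed m n (H2_coset m n (frag_of (?a, ?b))) = H_coset (m + n) (Var i)"
    unfolding H_embed_pure[OF c] using i
    by (simp add: H_shift_coset Const_hom.poly_subst_simps H_mult H_poly_closed)
  ultimately show ?thesis using pure_in_H2[OF c] that by blast
next
  case False
  let ?a = "H_coset m (1 :: 'a mpoly)" and ?b = "H_coset n (Var (i - m) :: 'a mpoly)"
  have i': "i - m \<in> {1..<n}" "i = (i - m) + m" using i False by auto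
  have c: "?a \<in> carrier (H m)" "?b \<in> carrier (H n)"
    using i' by (simp_all add: H_coset_closed H_poly_closed)
  have "i \<in> C \<longleftrightarrow> i - m \<in> E" using C i' unfolding restricts_def by metis
  then have "H2_char D E (H2_coset m n (frag_of (?a, ?b))) = (H_point C i :: 'a)"
    unfolding H2_char_pure[OF c] by (simp add: H_char_coset D E eval_at_simps)
  moreover have "H_embed m n (H2_coset m n (frag_of (?a, ?b))) = H_coset (m + n) (Var i)"
    unfolding H_embed_pure[OF c] using i i'
    by (simp add: H_shift_coset Const_hom.poly_subst_simps H_mult H_poly_closed)
  ultimately show ?thesis using pure_in_H2[OF c] that by blast
qed

text \<open>\<open>p\<close> annihilates the generator \<open>1 \<otimes> h 1\<close> of the induced module.\<close>

definition annihilates :: "'a mpoly \<Rightarrow> bool" where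
  "annihilates p \<longleftrightarrow> frag_of (H_coset (m + n) p, h 1) \<in> kernel"

section \<open>Computation with the annihilator of the generator\<close>

abbreviation polys :: "'a mpoly set" where
  "polys \<equiv> carrier (H_poly_ring (m + n))"

lemma pure_add_kernel:
  assumes "p \<in> polys" "q \<in> polys"
  shows "frag_of (H_coset (m + n) (p + q), h v) - frag_of (H_coset (m + n) p, h v)
    - frag_of (H_coset (m + n) q, h v) \<in> kernel"
  using tensor_kernel_add_left[of "H_coset (m + n) p" "H_coset (m + n) q" "h v"] assms
  by (simp add: H_coset_closed H_add carrier_T)

lemma annihilates_of_difference:
  assumes "p \<in> polys" "q \<in> polys"
    and "frag_of (H_coset (m + n) p, h 1) - frag_of (H_coset (m + n) q, h 1) \<in> kernel"
  shows "annihilates (p - q)"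
  using tensor_kernel_diff[OF assms(3) pure_add_kernel[of "p - q" q 1]] assms(1,2)
  by (simp add: annihilates_def H_poly_closed)

lemma annihilates_add:
  assumes "p \<in> polys" "q \<in> polys" "annihilates p" "annihilates q"
  shows "annihilates (p + q)"
  using tensor_kernel_add[OF tensor_kernel_add[OF pure_add_kernel[OF assms(1,2), of 1]]] assms(3,4)
  by (fastforce simp: annihilates_def)

lemma annihilates_diff:
  assumes "p \<in> polys" "q \<in> polys" "annihilates p" "annihilates q"
  shows "annihilates (p - q)"
  using annihilates_of_difference[OF assms(1,2)] tensor_kernel_diff assms(3,4)
  by (simp add: annihilates_def)

lemma annihilates_H_ideal:
  assumes "p \<in> H_ideal (m + n)"
  shows "annihilates p"
proof -
  have "annihilates 0"
    using annihilates_of_difference[of 0 0] tensor_kernel_zero by (simp add: H_poly_closed)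
  moreover have "H_coset (m + n) p = H_coset (m + n) 0"
    using assms by (intro H_coset_eqI) simp
  ultimately show ?thesis by (simp add: annihilates_def)
qed

text \<open>\<open>r\<close> and the constant \<open>s\<close> act alike on \<open>h 1\<close>;
  carried across the tensor sign they become \<open>p\<close> and \<open>c\<close>. The factor
  \<open>q\<close> allows the rule to be used inside a product.\<close>

lemma annihilates_scalar:
  assumes r: "r \<in> carrier (H2 m n)" "H2_char D E r = c" "H_embed m n r = H_coset (m + n) p"
    and p: "p \<in> polys" and q: "q \<in> polys"
  shows "annihilates (p * q - Const c * q)"
proof (rule annihilates_of_difference)
  obtain s where s: "s \<in> carrier (H2 m n)" "H2_char D E s = c"
    "H_embed m n s = H_coset (m + n) (Const c)"
    by (rule scalar_exists)
  have q': "H_coset (m + n) q \<in> carrier scalars" "h 1 \<in> carrier T"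
    using q by (simp_all add: H_coset_closed carrier_T)
  have "r \<odot>\<^bsub>T\<^esub> h 1 = s \<odot>\<^bsub>T\<^esub> h 1"
    using r(1,2) s(1,2) by (simp flip: h_smult)
  then have "frag_of (r \<odot>\<^bsub>scalars\<^esub> H_coset (m + n) q, h 1) - frag_of (s \<odot>\<^bsub>scalars\<^esub> H_coset (m + n) q, h 1) \<in> kernel"
    using tensor_kernel_diff[OF tensor_kernel_smult[OF r(1) q'] tensor_kernel_smult[OF s(1) q']]
    by simp
  then show "frag_of (H_coset (m + n) (p * q), h 1) - frag_of (H_coset (m + n) (Const c * q), h 1) \<in> kernel"
    using p q by (simp add: r(3) s(3) H_mult H_poly_closed)
qed (use p q in \<open>auto intro: H_poly_closed\<close>)

text \<open>If \<open>m = 0\<close> or \<open>n = 0\<close>, there is no generator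
  \<open>x_m\<close>. The value 0 is idempotent too, so these cases run through the same
  reduction.\<close>

definition middle :: "'a mpoly" where
  "middle = (if m \<in> {1..<m + n} then Var m else 0)"

lemma middle_closed: "middle \<in> polys"
  by (simp add: middle_def H_poly_closed)

lemma middle_idempotent: "middle * middle - middle \<in> H_ideal (m + n)"
  by (simp add: middle_def H_ideal_square H_ideal_zero)

text \<open>The multiplier \<open>q\<close> is universally quantified so that, when a variable is
  peeled off \<open>p\<close>, the induction hypothesis can be applied with \<open>Var i * q\<close>
  in its place.\<close>

lemma linear_reduction:
  assumes C: "restricts C" and p: "p \<in> polys"
  obtains c d where "\<And>q. q \<in> polys \<Longrightarrow> annihilates (p * q - (Const c + Const d * middle) * q)"
proof -
  have "\<exists>c d. \<forall>q\<in>polys. annihilates (p * q - (Const c + Const d * middle) * q)"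
    using p
  proof (induction p rule: H_poly_induct)
    case (Const c)
    have "Const (0::'a) = 0" by (simp add: Const_def)
    then show ?case
      by (intro exI[of _ c] exI[of _ 0]) (auto intro: annihilates_H_ideal H_ideal_zero)
  next
    case (Var i p)
    then obtain c d where IH: "\<And>q. q \<in> polys \<Longrightarrow> annihilates (p * q - (Const c + Const d * middle) * q)"
      by blast
    have vi: "Var i \<in> polys" using Var by (intro H_poly_closed)
    have l: "Const c + Const d * middle \<in> polys"
      by (intro H_poly_closed middle_closed)
    show ?case
    proof (cases "i = m")
      case False
      define e where "e = (H_point C i :: 'a)"
      obtain r where r: "r \<in> carrier (H2 m n)" "H2_char D E r = e"
        "H_embed m n r = H_coset (m + n) (Var i)"
        using variable_exists[OF Var(1) False C] unfolding e_def by blast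
      \<comment> \<open>\<open>x_i\<close> acts as the scalar \<open>e\<close>, which multiplies
        both coefficients.\<close>
      show ?thesis
      proof (rule exI[of _ "e * c"], rule exI[of _ "e * d"], rule ballI)
        fix q assume q: "q \<in> polys"
        have "annihilates ((p * (Var i * q) - (Const c + Const d * middle) * (Var i * q)) +
          (Var i * ((Const c + Const d * middle) * q) - Const e * ((Const c + Const d * middle) * q)))"
          using q vi l Var(1,2)
          by (intro annihilates_add IH annihilates_scalar[OF r] H_poly_closed middle_closed) auto
        moreover have "(p * (Var i * q) - (Const c + Const d * middle) * (Var i * q)) +
          (Var i * ((Const c + Const d * middle) * q) - Const e * ((Const c + Const d * middle) * q))
          = Var i * p * q - (Const (e * c) + Const (e * d) * middle) * q"
          unfolding Const_hom.h_mult by (simp only: algebra_simps)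
        ultimately show "annihilates (Var i * p * q - (Const (e * c) + Const (e * d) * middle) * q)"
          by simp
      qed
    next
      case True
      then have mid: "middle = Var i" using Var(1) by (simp add: middle_def)
      \<comment> \<open>By idempotence, \<open>x_m\<close> times \<open>c + d x_m\<close> is
        \<open>(c + d) x_m\<close>.\<close>
      show ?thesis
      proof (rule exI[of _ 0], rule exI[of _ "c + d"], rule ballI)
        fix q assume q: "q \<in> polys"
        have "(middle * middle - middle) * (Const d * q) \<in> H_ideal (m + n)"
          using q by (intro H_ideal_mult middle_idempotent H_poly_closed)
        then have "annihilates ((p * (Var i * q) - (Const c + Const d * middle) * (Var i * q)) +
            (middle * middle - middle) * (Const d * q))"
          using q vi l Var(1,2)
          by (intro annihilates_add IH annihilates_H_ideal H_poly_closed middle_closed) auto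
        moreover have "(p * (Var i * q) - (Const c + Const d * middle) * (Var i * q)) +
            (middle * middle - middle) * (Const d * q)
          = Var i * p * q - (Const 0 + Const (c + d) * middle) * q"
          unfolding Const_hom.h_add Const_hom.h_zero mid
          by (simp only: algebra_simps mult_zero_left add_0_left)
        ultimately show "annihilates (Var i * p * q - (Const 0 + Const (c + d) * middle) * q)"
          by simp
      qed
    qed
  next
    case (add p p')
    then obtain c d c' d' where IH: "\<And>q. q \<in> polys \<Longrightarrow> annihilates (p * q - (Const c + Const d * middle) * q)"
      "\<And>q. q \<in> polys \<Longrightarrow> annihilates (p' * q - (Const c' + Const d' * middle) * q)"
      by blast
    show ?case
    proof (rule exI[of _ "c + c'"], rule exI[of _ "d + d'"], rule ballI)
      fix q assume q: "q \<in> polys"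
      have "annihilates ((p * q - (Const c + Const d * middle) * q) + (p' * q - (Const c' + Const d' * middle) * q))"
        using q add(1,2) by (intro annihilates_add IH H_poly_closed middle_closed) auto
      moreover have "(p * q - (Const c + Const d * middle) * q) + (p' * q - (Const c' + Const d' * middle) * q)
          = (p + p') * q - (Const (c + c') + Const (d + d') * middle) * q"
        unfolding Const_hom.h_add by (simp only: algebra_simps)
      ultimately show "annihilates ((p + p') * q - (Const (c + c') + Const (d + d') * middle) * q)"
        by simp
    qed
  qed
  then show ?thesis using that by blast
qed

lemma annihilates_eval:
  assumes "restricts F" "annihilates p"
  shows "eval_at (H_point F) p = 0"
  using evaluation_kernel[OF assms(1)] assms(2) assms(1)
  by (force simp: annihilates_def evaluation_simps H_char_coset restricts_def)

text \<open>As \<open>h 1\<close> generates \<open>T\<close>, a formal sum reduces to a pure tensor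
  \<open>p \<otimes> h 1\<close>, on which the evaluations are the values of \<open>p\<close>. The
  family \<open>\<F>\<close> has one or two members, one for each completion of the point.\<close>

lemma kernel_from_annihilates:
  assumes g: "Poly_Mapping.keys g \<subseteq> carrier target \<times> carrier T"
    and ann: "\<And>p. p \<in> polys \<Longrightarrow> (\<And>F. F \<in> \<F> \<Longrightarrow> eval_at (H_point F) p = 0) \<Longrightarrow> annihilates p"
    and \<F>: "\<And>F. F \<in> \<F> \<Longrightarrow> restricts F" "\<And>F. F \<in> \<F> \<Longrightarrow> evaluation F g = 0"
  shows "g \<in> kernel"
proof -
  have ab: "abelian_group scalars"
  proof -
    interpret A: cring target by (rule H_cring)
    show ?thesis
      by (rule abelian_groupI) (auto simp: A.a_ac intro: A.l_neg A.a_inv_closed)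
  qed
  have cyclic: "\<exists>r\<in>carrier (H2 m n). v = r \<odot>\<^bsub>T\<^esub> h 1" if v: "v \<in> carrier T" for v
  proof -
    obtain c where c: "v = h c" using v[unfolded carrier_T] by blast
    obtain r where "r \<in> carrier (H2 m n)" "H2_char D E r = c" using scalar_exists by blast
    then show ?thesis using c h_smult[of r 1] by auto
  qed
  obtain a where a: "a \<in> carrier target" "g - frag_of (a, h 1) \<in> kernel"
    using tensor_reduce[OF ab _ cyclic, of g] g by (auto simp: carrier_T simp del: mem_Sigma_iff)
  then obtain p where p: "p \<in> polys" "a = H_coset (m + n) p" by (auto elim: H_carrierE)
  have "eval_at (H_point F) p = 0" if "F \<in> \<F>" for F
    using evaluation_kernel[OF \<F>(1)[OF that] a(2)] \<F>[OF that]
    by (simp add: evaluation_simps p(2) H_char_coset restricts_def)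
  then have "annihilates p" using ann p(1) by blast
  then have "frag_of (a, h 1) \<in> kernel" by (simp add: annihilates_def p(2))
  with a(2) have "g - frag_of (a, h 1) + frag_of (a, h 1) \<in> kernel"
    by (rule tensor_kernel_add)
  then show ?thesis by simp
qed


section \<open>The induced module with one or two completions\<close>

lemma induced_module_eq:
  "induced_module (H2 m n) target (H_embed m n) T = module_on (tensor_group (H2 m n) scalars T)
     (\<lambda>a Y. \<Union>g\<in>Y. tensor_coset (H2 m n) scalars T (shift_action a g))"
  by (simp add: induced_module_def Let_def shift_action_def)

text \<open>At \<open>C\<close> the middle variable is 0, so the value there is the constant
  coefficient of the linear form, which must vanish.\<close>

lemma linear_reduction_eval:
  assumes C: "restricts C" "m \<notin> C" and p: "p \<in> polys" "eval_at (H_point C) p = 0"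
  obtains d where "annihilates (p - Const d * middle)"
proof -
  obtain c d where "\<And>q. q \<in> polys \<Longrightarrow> annihilates (p * q - (Const c + Const d * middle) * q)"
    using linear_reduction[OF C(1) p(1)] by blast
  from this[OF H_poly_one] have ann: "annihilates (p - (Const c + Const d * middle))" by simp
  have "eval_at (H_point C) middle = 0"
    using C(2) by (simp add: middle_def eval_at_simps)
  then have "c = 0"
    using annihilates_eval[OF C(1) ann] p(2) by (simp add: eval_at_simps)
  then show ?thesis using ann that by (simp add: Const_hom.h_zero)
qed

text \<open>The premise \<open>clash\<close> is conditional: without a generator \<open>x_m\<close>
  the polynomial \<open>middle\<close> is 0 and a linear form has only its constant
  coefficient.\<close>

lemma induced_module_iso:
  assumes C: "restricts C" "m \<notin> C"
    and clash: "m \<in> {1..<m + n} \<Longrightarrow> \<exists>j\<in>{1..<m + n}. j \<in> C \<and> (j + 1 = m \<or> j = m + 1)"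
  shows "mod_iso target (H_char_module C) (induced_module (H2 m n) target (H_embed m n) T)"
proof -
  have na: "nonadjacent C" using C by (simp add: restricts_def)
  have kill: "annihilates (Const d * middle)" for d
  proof (cases "m \<in> {1..<m + n}")
    case False
    then have "Const d * middle = 0" by (simp only: middle_def if_False mult_zero_right)
    then show ?thesis using annihilates_H_ideal[OF H_ideal_zero] by (simp only:)
  next
    case True
    then obtain j where j: "j \<in> {1..<m + n}" "j \<in> C" "j + 1 = m \<or> j = m + 1" using clash by blast
    have jm: "j \<noteq> m" using j(3) by auto
    have one: "H_point C j = (1 :: 'a)" using j(2) by simp
    obtain r where r: "r \<in> carrier (H2 m n)" "H2_char D E r = (1 :: 'a)"
      "H_embed m n r = H_coset (m + n) (Var j)"
      using variable_exists[OF j(1) jm C(1)] unfolding one by blast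
    have "Var j * Var m \<in> H_ideal (m + n)"
      using j True H_ideal_adjacent[of j "m + n"] H_ideal_adjacent[of m "m + n"]
      by (auto simp: mult.commute)
    then have "Var j * Var m * Const d \<in> H_ideal (m + n)"
      by (rule H_ideal_mult) (rule H_poly_Const)
    then have 1: "annihilates (Var j * (Const d * middle))"
      using True by (intro annihilates_H_ideal) (simp add: middle_def ac_simps)
    have 2: "annihilates (Var j * (Const d * middle) - Const 1 * (Const d * middle))"
      using j by (intro annihilates_scalar[OF r] H_poly_closed middle_closed)
    \<comment> \<open>Facts \<open>1\<close> and \<open>2\<close> concern elements whose difference
      is \<open>Const d * middle\<close>: \<open>x_j\<close> both kills it and fixes it.\<close>
    have "annihilates (Var j * (Const d * middle) -
        (Var j * (Const d * middle) - Const 1 * (Const d * middle)))"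
      using j by (intro annihilates_diff 1 2 H_poly_closed middle_closed)
    then show ?thesis by (simp add: Const_hom.h_one)
  qed
  have ann: "annihilates p" if p: "p \<in> polys" "eval_at (H_point C) p = 0" for p
  proof -
    obtain d where d: "annihilates (p - Const d * middle)"
      using linear_reduction_eval[OF C p] by blast
    have "annihilates ((p - Const d * middle) + Const d * middle)"
      using p(1) by (intro annihilates_add d kill H_poly_closed middle_closed)
    then show ?thesis by simp
  qed
  interpret tensor_evaluation "H2 m n" scalars T "evaluation C"
  proof unfold_locales
    fix f :: "'a mpoly set \<times> 'b \<Rightarrow>\<^sub>0 int"
    assume "Poly_Mapping.keys f \<subseteq> carrier scalars \<times> carrier T"
    then show "f \<in> kernel \<longleftrightarrow> evaluation C f = 0"
      using evaluation_kernel[OF C(1)] kernel_from_annihilates[where \<F> = "{C}"] C(1) ann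
      by auto
  next
    fix v
    show "\<exists>f. Poly_Mapping.keys f \<subseteq> carrier scalars \<times> carrier T \<and> evaluation C f = v"
      by (intro exI[of _ "frag_of (H_coset (m + n) 1, h v)"])
        (simp add: evaluation_simps keys_frag_of H_coset_closed H_poly_closed carrier_T
          H_char_coset[OF na] eval_at_simps)
  qed (simp add: evaluation_simps)
  show ?thesis
    unfolding induced_module_eq
  proof (rule tensor_group_iso)
    fix a :: "'a mpoly set" and v assume a: "a \<in> carrier target"
    have "tensor_coset (H2 m n) scalars T (shift_action a g) = fibre (H_char C a * v)"
      if "g \<in> fibre v" for g
      using that shift_action_closed[OF a, of g] evaluation_shift_action[OF na a, of g]
      by (simp add: tensor_coset_eq_fibre fibre_def)
    then show "(\<Union>g\<in>fibre v. tensor_coset (H2 m n) scalars T (shift_action a g)) = fibre (H_char C a * v)"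
      using fibre_nonempty[of v] by simp
  qed
qed

text \<open>The two evaluations agree on constants and differ at \<open>x_m\<close>, so together
  they determine both coefficients of a linear form; this makes the map injective.\<close>

lemma induced_module_iso_pair:
  assumes C: "restricts C" "m \<notin> C" and C': "restricts (insert m C)" and m: "m \<in> {1..<m + n}"
  shows "mod_iso target (type_module (\<lambda>U (v, w). (H_char C U * v, H_char (insert m C) U * w)))
    (induced_module (H2 m n) target (H_embed m n) T)"
proof -
  let ?C' = "insert m C"
  let ?\<Phi> = "\<lambda>g. (evaluation C g, evaluation ?C' g)"
  have na: "nonadjacent C" "nonadjacent ?C'" using C C' by (simp_all add: restricts_def)
  have ann: "annihilates p"
    if p: "p \<in> polys" "eval_at (H_point C) p = 0" "eval_at (H_point ?C') p = 0" for p
  proof -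
    obtain d where d: "annihilates (p - Const d * middle)"
      using linear_reduction_eval[OF C p(1,2)] by blast
    \<comment> \<open>At the second point the middle variable is 1, so the value there is
      \<open>d\<close>.\<close>
    have "d = 0"
      using annihilates_eval[OF C' d] p(3) m by (simp add: eval_at_simps middle_def)
    then show ?thesis using d by (simp add: Const_hom.h_zero)
  qed
  interpret tensor_evaluation "H2 m n" scalars T ?\<Phi>
  proof unfold_locales
    fix f :: "'a mpoly set \<times> 'b \<Rightarrow>\<^sub>0 int"
    assume f: "Poly_Mapping.keys f \<subseteq> carrier scalars \<times> carrier T"
    show "f \<in> kernel \<longleftrightarrow> ?\<Phi> f = 0"
    proof
      assume "f \<in> kernel"
      then show "?\<Phi> f = 0"
        using evaluation_kernel[OF C(1)] evaluation_kernel[OF C'] by (simp add: zero_prod_def)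
    next
      assume "?\<Phi> f = 0"
      then have ev: "evaluation C f = 0" "evaluation ?C' f = 0" by (simp_all add: zero_prod_def)
      show "f \<in> kernel"
      proof (rule kernel_from_annihilates)
        show "Poly_Mapping.keys f \<subseteq> carrier target \<times> carrier T" using f by simp
        show "restricts F" if "F \<in> {C, ?C'}" for F using that C(1) C' by blast
        show "evaluation F f = 0" if "F \<in> {C, ?C'}" for F using that ev by blast
        show "annihilates p" if p: "p \<in> polys" and z: "\<And>F. F \<in> {C, ?C'} \<Longrightarrow> eval_at (H_point F) p = 0" for p
          using ann[OF p z z] by blast
      qed
    qed
  next
    fix vw :: "'a \<times> 'a"
    obtain v w where vw: "vw = (v, w)" by (cases vw)
    \<comment> \<open>The idempotents \<open>1 - x_m\<close> and \<open>x_m\<close> evaluate to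
      \<open>(1, 0)\<close> and \<open>(0, 1)\<close>. The second term is subtracted at
      \<open>- w\<close>, as formal sums are handled through differences.\<close>
    let ?f = "frag_of (H_coset (m + n) (1 - Var m), h v) - frag_of (H_coset (m + n) (Var m), h (- w))"
    have cl: "1 - Var m \<in> polys" "Var m \<in> polys" using m by (simp_all add: H_poly_closed)
    have "?\<Phi> ?f = vw"
      using C(2) by (simp add: vw evaluation_simps H_char_coset na eval_at_simps)
    moreover have "Poly_Mapping.keys ?f \<subseteq> carrier scalars \<times> carrier T"
      using cl by (intro keys_diff3_subset) (simp_all add: H_coset_closed carrier_T)
    ultimately show "\<exists>f. Poly_Mapping.keys f \<subseteq> carrier scalars \<times> carrier T \<and> ?\<Phi> f = vw" by blast
  qed (simp add: evaluation_simps)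
  show ?thesis
    unfolding induced_module_eq
  proof (rule tensor_group_iso)
    fix a :: "'a mpoly set" and vw :: "'a \<times> 'a" assume a: "a \<in> carrier target"
    let ?act = "(\<lambda>(v, w). (H_char C a * v, H_char ?C' a * w)) vw"
    have "tensor_coset (H2 m n) scalars T (shift_action a g) = fibre ?act"
      if "g \<in> fibre vw" for g
      using that shift_action_closed[OF a, of g] evaluation_shift_action[OF na(1) a, of g]
        evaluation_shift_action[OF na(2) a, of g]
      by (auto simp: tensor_coset_eq_fibre fibre_def simp del: mem_Sigma_iff)
    then show "(\<Union>g\<in>fibre vw. tensor_coset (H2 m n) scalars T (shift_action a g)) = fibre ?act"
      using fibre_nonempty[of vw] by simp
  qed
qed

end

section \<open>Grothendieck groups\<close>

lemma exact_relations_subgroup: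
  "subgroup (exact_relations R) (free_Abelian_group (fg_modules R))"
  unfolding exact_relations_def
proof (rule group.generate_is_subgroup[OF group_free_Abelian_group], rule subsetI)
  fix f
  assume "f \<in> {frag_of M - frag_of L - frag_of N |L M N.
      L \<in> fg_modules R \<and> M \<in> fg_modules R \<and> N \<in> fg_modules R \<and> short_exact R L M N}"
  then obtain L M N where "f = frag_of M - frag_of L - frag_of N"
    "M \<in> fg_modules R" "L \<in> fg_modules R" "N \<in> fg_modules R" by blast
  then show "f \<in> carrier (free_Abelian_group (fg_modules R))"
    unfolding carrier_free_Abelian_group_iff by (simp only: keys_diff3_subset(1))
qed

lemma exact_relations_normal:
  "exact_relations R \<lhd> free_Abelian_group (fg_modules R)"
  by (rule comm_group.subgroup_imp_normal[OF abelian_free_Abelian_group exact_relations_subgroup])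

lemma G0_group: "Group.group (G0 R)"
  unfolding G0_def by (rule normal.factorgroup_is_group[OF exact_relations_normal])

section \<open>Short exact sequences and additivity of classes\<close>

lemma mod_hom_zero:
  assumes "module R M" "module R N" "h \<in> mod_hom R M N"
  shows "h \<zero>\<^bsub>M\<^esub> = \<zero>\<^bsub>N\<^esub>"
proof -
  interpret M: module R M by fact
  interpret N: module R N by fact
  have "h (\<zero>\<^bsub>M\<^esub> \<oplus>\<^bsub>M\<^esub> \<zero>\<^bsub>M\<^esub>) = h \<zero>\<^bsub>M\<^esub> \<oplus>\<^bsub>N\<^esub> h \<zero>\<^bsub>M\<^esub>" and "h \<zero>\<^bsub>M\<^esub> \<in> carrier N"
    using assms(3) by (auto simp: mod_hom_def hom_def Pi_iff simp del: M.M.r_zero M.M.l_zero)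
  then show ?thesis by simp
qed

lemma mod_hom_comp:
  assumes "f \<in> mod_hom R L M" "g \<in> mod_hom R M N"
  shows "g \<circ> f \<in> mod_hom R L N"
  using assms by (auto simp: mod_hom_def hom_def Pi_iff)

lemma module_imp_closed: "module R M \<Longrightarrow> module_closed R M"
proof -
  assume "module R M"
  then interpret module R M .
  show ?thesis by (simp add: module_closed_def)
qed

text \<open>The relations of \<open>G0\<close> concern small modules only, so exactness has to be
  carried over to the chosen copies; the maps are conjugated by the isomorphisms.\<close>

lemma short_exact_iso:
  assumes mods: "module R L" "module R M" "module R N" "module R N'"
    and exact: "short_exact R L M N"
    and isos: "mod_iso R L L'" "mod_iso R M M'" "mod_iso R N N'"
  shows "short_exact R L' M' N'"
proof -
  obtain f g where fg: "f \<in> mod_hom R L M" "g \<in> mod_hom R M N" "inj_on f (carrier L)"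
    "f ` carrier L = a_kernel M N g" "g ` carrier M = carrier N"
    using exact by (auto simp: short_exact_def)
  obtain k where k: "k \<in> mod_hom R L' L" "bij_betw k (carrier L') (carrier L)"
    using mod_iso_sym[OF module_imp_closed[OF mods(1)] isos(1)] by (auto simp: mod_iso_def)
  obtain h where h: "h \<in> mod_hom R M M'" "bij_betw h (carrier M) (carrier M')"
    using isos(2) by (auto simp: mod_iso_def)
  define h' where "h' = inv_into (carrier M) h"
  have h': "h' (h x) = x" if "x \<in> carrier M" for x
    unfolding h'_def using h(2) that by (intro inv_into_f_f) (auto simp: bij_betw_def)
  have M': "carrier M' = h ` carrier M" using h(2) by (simp add: bij_betw_def)
  have "h x \<oplus>\<^bsub>M'\<^esub> h y = h (x \<oplus>\<^bsub>M\<^esub> y)" "r \<odot>\<^bsub>M'\<^esub> h x = h (r \<odot>\<^bsub>M\<^esub> x)"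
    if "x \<in> carrier M" "y \<in> carrier M" "r \<in> carrier R" for x y r
    using h(1) that by (auto simp: mod_hom_def hom_def)
  \<comment> \<open>The preceding fact bundles addition and action under a common \<open>r\<close>;
    an element of the ring is needed to extract the additive part.\<close>
  moreover have "\<zero>\<^bsub>R\<^esub> \<in> carrier R"
    using mods(1) by (simp add: module_def cring_def ring.ring_simprules)
  ultimately have h'_hom: "h' \<in> mod_hom R M' M"
    using module_imp_closed[OF mods(2)] by (auto simp: mod_hom_def hom_def M' h' module_closed_def)
  obtain l where l: "l \<in> mod_hom R N N'" "bij_betw l (carrier N) (carrier N')"
    using isos(3) by (auto simp: mod_iso_def)
  have l0: "l \<zero>\<^bsub>N\<^esub> = \<zero>\<^bsub>N'\<^esub>" by (rule mod_hom_zero[OF mods(3,4) l(1)])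
  have z: "\<zero>\<^bsub>N\<^esub> \<in> carrier N" using mods(3) by (simp add: module_def abelian_group_def abelian_monoid.zero_closed)
  show ?thesis
    unfolding short_exact_def
  proof (intro bexI[of _ "h \<circ> (f \<circ> k)"] bexI[of _ "l \<circ> (g \<circ> h')"] conjI)
    show "h \<circ> (f \<circ> k) \<in> mod_hom R L' M'" "l \<circ> (g \<circ> h') \<in> mod_hom R M' N'"
      using mod_hom_comp[OF mod_hom_comp[OF k(1) fg(1)] h(1)]
        mod_hom_comp[OF mod_hom_comp[OF h'_hom fg(2)] l(1)] by simp_all
    have fM: "f ` carrier L \<subseteq> carrier M" using fg(1) by (auto simp: mod_hom_def hom_def)
    show "inj_on (h \<circ> (f \<circ> k)) (carrier L')"
    proof (intro comp_inj_on)
      have "(f \<circ> k) ` carrier L' = f ` carrier L"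
        using k(2) unfolding bij_betw_def image_comp[symmetric] by simp
      then show "inj_on h ((f \<circ> k) ` carrier L')"
        using h(2) fM by (auto simp: bij_betw_def intro: inj_on_subset)
    qed (use k(2) fg(3) in \<open>auto simp: bij_betw_def\<close>)
    have "(h \<circ> (f \<circ> k)) ` carrier L' = h ` a_kernel M N g"
      using k(2) fg(4) unfolding bij_betw_def image_comp[symmetric] by simp
    also have "\<dots> = a_kernel M' N' (l \<circ> (g \<circ> h'))"
    proof -
      have "l (g x) = \<zero>\<^bsub>N'\<^esub> \<longleftrightarrow> g x = \<zero>\<^bsub>N\<^esub>" if "x \<in> carrier M" for x
      proof -
        have "g x \<in> carrier N" using fg(5) that by blast
        then show ?thesis
          using inj_on_eq_iff[OF bij_betw_imp_inj_on[OF l(2)] _ z] l0 by metis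
      qed
      then show ?thesis by (auto simp: a_kernel_def' M' h' l0)
    qed
    finally show "(h \<circ> (f \<circ> k)) ` carrier L' = a_kernel M' N' (l \<circ> (g \<circ> h'))" .
    have "h' ` carrier M' = carrier M" by (auto simp: M' h' image_iff)
    then show "(l \<circ> (g \<circ> h')) ` carrier M' = carrier N'"
      using fg(5) l(2) unfolding bij_betw_def image_comp[symmetric] by simp
  qed
qed

text \<open>The assumptions \<open>small\<close> ensure that the three choices really are isomorphic
  copies; their exact sequence is then one of the defining relations.\<close>

lemma mod_class_exact:
  assumes mods: "module R L" "module R M" "module R N"
    and exact: "short_exact R L M N"
    and small: "\<exists>P\<in>fg_modules R. mod_iso R L P" "\<exists>P\<in>fg_modules R. mod_iso R M P"
      "\<exists>P\<in>fg_modules R. mod_iso R N P"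
  shows "mod_class R M = mod_class R L \<otimes>\<^bsub>G0 R\<^esub> mod_class R N"
proof -
  let ?F = "free_Abelian_group (fg_modules R)"
  define L' where "L' = (SOME P. P \<in> fg_modules R \<and> mod_iso R L P)"
  define M' where "M' = (SOME P. P \<in> fg_modules R \<and> mod_iso R M P)"
  define N' where "N' = (SOME P. P \<in> fg_modules R \<and> mod_iso R N P)"
  have L': "L' \<in> fg_modules R \<and> mod_iso R L L'"
    using someI_ex[of "\<lambda>P. P \<in> fg_modules R \<and> mod_iso R L P"] small(1) unfolding L'_def by blast
  have M': "M' \<in> fg_modules R \<and> mod_iso R M M'"
    using someI_ex[of "\<lambda>P. P \<in> fg_modules R \<and> mod_iso R M P"] small(2) unfolding M'_def by blast
  have N': "N' \<in> fg_modules R \<and> mod_iso R N N'"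
    using someI_ex[of "\<lambda>P. P \<in> fg_modules R \<and> mod_iso R N P"] small(3) unfolding N'_def by blast
  have "module R N'" using N' by (simp add: fg_modules_def fg_module_def)
  then have "short_exact R L' M' N'"
    by (rule short_exact_iso[OF mods _ exact]) (use L' M' N' in auto)
  then have "frag_of M' - frag_of L' - frag_of N' \<in> exact_relations R"
    unfolding exact_relations_def using L' M' N' by (intro generate.incl) blast
  then have "frag_of M' \<in> exact_relations R #>\<^bsub>?F\<^esub> (frag_of L' + frag_of N')"
    unfolding r_coset_def mult_free_Abelian_group
    by (intro UN_I[of "frag_of M' - frag_of L' - frag_of N'"]) simp_all
  moreover have "frag_of L' + frag_of N' \<in> carrier ?F"
    using L' N' keys_add[of "frag_of L'" "frag_of N'"]
    unfolding carrier_free_Abelian_group_iff keys_frag_of by blast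
  ultimately have "exact_relations R #>\<^bsub>?F\<^esub> frag_of M' = exact_relations R #>\<^bsub>?F\<^esub> (frag_of L' + frag_of N')"
    using group.repr_independence[OF group_free_Abelian_group _ _ exact_relations_subgroup] by metis
  also have "\<dots> = (exact_relations R #>\<^bsub>?F\<^esub> frag_of L') <#>\<^bsub>?F\<^esub> (exact_relations R #>\<^bsub>?F\<^esub> frag_of N')"
    using normal.rcos_sum[OF exact_relations_normal, of "frag_of L'" R "frag_of N'"] L' N'
    by (simp add: keys_frag_of)
  finally show ?thesis
    by (simp add: mod_class_def G0_def FactGroup_def L'_def M'_def N'_def)
qed

text \<open>The structure is transported along \<open>j\<close>. Two generators cover models on the
  field and on its square; \<open>u \<noteq> v\<close> guarantees that a sum over the set
  \<open>{j u, j v}\<close> has two terms.\<close>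

lemma small_copy:
  fixes j :: "'b \<Rightarrow> (nat \<Rightarrow> 'r) set" and M :: "('r, 'b) module"
  assumes M: "module R M" and inj: "inj_on j (carrier M)"
    and gens: "u \<in> carrier M" "v \<in> carrier M" "u \<noteq> v"
    and span: "\<And>x. x \<in> carrier M \<Longrightarrow> \<exists>a\<in>carrier R. \<exists>b\<in>carrier R. x = a \<odot>\<^bsub>M\<^esub> u \<oplus>\<^bsub>M\<^esub> b \<odot>\<^bsub>M\<^esub> v"
  shows "\<exists>N\<in>fg_modules R. mod_iso R M N"
proof -
  interpret M: module R M by fact
  define k where "k = inv_into (carrier M) j"
  have k: "k (j x) = x" if "x \<in> carrier M" for x
    unfolding k_def using inj that by (rule inv_into_f_f)
  define N :: "'r small_module" where
    "N = \<lparr>carrier = j ` carrier M, monoid.mult = undefined, monoid.one = undefined,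
      ring.zero = j \<zero>\<^bsub>M\<^esub>, ring.add = (\<lambda>x y. j (k x \<oplus>\<^bsub>M\<^esub> k y)), module.smult = (\<lambda>r x. j (r \<odot>\<^bsub>M\<^esub> k x))\<rparr>"
  have N: "carrier N = j ` carrier M" "\<zero>\<^bsub>N\<^esub> = j \<zero>\<^bsub>M\<^esub>" "x \<oplus>\<^bsub>N\<^esub> y = j (k x \<oplus>\<^bsub>M\<^esub> k y)"
    "r \<odot>\<^bsub>N\<^esub> x = j (r \<odot>\<^bsub>M\<^esub> k x)" for x y r
    by (simp_all add: N_def)
  have modN: "module R N"
  proof (rule moduleI)
    show "cring R" using M by (simp add: module_def)
    show "abelian_group N"
    proof (rule abelian_groupI)
      fix x assume "x \<in> carrier N"
      then obtain y where "x = j y" "y \<in> carrier M" by (auto simp: N)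
      then show "\<exists>y\<in>carrier N. y \<oplus>\<^bsub>N\<^esub> x = \<zero>\<^bsub>N\<^esub>"
        by (intro bexI[of _ "j (\<ominus>\<^bsub>M\<^esub> y)"]) (auto simp: N k M.M.l_neg)
    qed (auto simp: N k M.M.a_assoc intro!: arg_cong[where f = j] M.M.a_comm)
  qed (auto simp: N k M.smult_l_distr M.smult_r_distr M.smult_assoc1)
  interpret N: module R N by (rule modN)
  have "fg_module R N"
    unfolding fg_module_def
  proof (intro conjI exI[of _ "{j u, j v}"] ballI)
    have juv: "j u \<noteq> j v" using inj gens by (auto dest: inj_onD)
    fix y assume "y \<in> carrier N"
    then obtain x where x: "y = j x" "x \<in> carrier M" by (auto simp: N)
    then obtain a b where ab: "a \<in> carrier R" "b \<in> carrier R" "x = a \<odot>\<^bsub>M\<^esub> u \<oplus>\<^bsub>M\<^esub> b \<odot>\<^bsub>M\<^esub> v"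
      using span by blast
    define c where "c = (\<lambda>z. if z = j u then a else b)"
    have jc: "j u \<in> carrier N" "j v \<in> carrier N" using gens by (auto simp: N)
    have "finsum N (\<lambda>z. c z \<odot>\<^bsub>N\<^esub> z) {j u, j v} = a \<odot>\<^bsub>N\<^esub> j u \<oplus>\<^bsub>N\<^esub> b \<odot>\<^bsub>N\<^esub> j v"
      using juv jc ab(1,2) by (subst N.M.finsum_insert) (auto simp: c_def)
    also have "\<dots> = y" using gens ab x by (simp add: N k)
    finally show "\<exists>c\<in>{j u, j v} \<rightarrow> carrier R. y = finsum N (\<lambda>z. c z \<odot>\<^bsub>N\<^esub> z) {j u, j v}"
      using ab(1,2) by (intro bexI[of _ c]) (auto simp: c_def)
  qed (use modN gens in \<open>auto simp: N\<close>)
  moreover have "mod_iso R M N"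
    by (rule mod_isoI[of j]) (use inj in \<open>auto simp: bij_betw_def N k\<close>)
  ultimately show ?thesis by (auto simp: fg_modules_def)
qed

section \<open>Modules given by one or two characters\<close>

lemma H_char_simps:
  assumes "nonadjacent D"
  shows "a \<in> carrier (H n) \<Longrightarrow> b \<in> carrier (H n) \<Longrightarrow> H_char D (a \<oplus>\<^bsub>H n\<^esub> b) = H_char D a + H_char D b"
    and "a \<in> carrier (H n) \<Longrightarrow> b \<in> carrier (H n) \<Longrightarrow> H_char D (a \<otimes>\<^bsub>H n\<^esub> b) = H_char D a * H_char D b"
    and "H_char D \<one>\<^bsub>H n\<^esub> = 1"
  using ring_hom_add[OF H_char_ring_hom[OF assms]] ring_hom_mult[OF H_char_ring_hom[OF assms]]
    ring_hom_one[OF H_char_ring_hom[OF assms]] by simp_all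

lemma H_char_module_module:
  assumes "nonadjacent D"
  shows "module (H n) (H_char_module D)"
  by (rule moduleI[OF H_cring])
    (auto intro!: abelian_group_UNIV simp: H_char_simps[OF assms] distrib_left distrib_right)

definition H_pair_module :: "nat set \<Rightarrow> nat set \<Rightarrow> ('a::field mpoly set, 'a \<times> 'a) module" where
  "H_pair_module C C' = type_module (\<lambda>U (v, w). (H_char C U * v, H_char C' U * w))"

lemma H_pair_module_module:
  assumes "nonadjacent C" "nonadjacent C'"
  shows "module (H n) (H_pair_module C C')"
  unfolding H_pair_module_def
  by (rule moduleI[OF H_cring])
    (auto intro!: abelian_group_UNIV simp: H_char_simps assms distrib_left distrib_right)

lemma H_char_module_small:
  assumes "nonadjacent D"
  shows "\<exists>N\<in>fg_modules (H n :: ('a::field, 'a mpoly set) module). mod_iso (H n) (H_char_module D) N"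
proof (rule small_copy[OF H_char_module_module[OF assms]])
  \<comment> \<open>Any injection into the carrier type of small modules will do; field elements are
    coded as constant polynomials.\<close>
  show "inj_on (\<lambda>v :: 'a. {\<lambda>k :: nat. {Const v}}) (carrier (H_char_module D))"
    using Const_inj by (auto simp: inj_def fun_eq_iff)
  \<comment> \<open>One generator is enough here, and 0 serves as the distinct second one.\<close>
  show "\<exists>a\<in>carrier (H n). \<exists>b\<in>carrier (H n). x = a \<odot>\<^bsub>H_char_module D\<^esub> 1 \<oplus>\<^bsub>H_char_module D\<^esub> b \<odot>\<^bsub>H_char_module D\<^esub> 0"
    for x :: 'a
    by (intro bexI[of _ "H_coset n (Const x)"]) (simp_all add: H_char_Const assms H_coset_closed H_poly_closed)
qed simp_all

lemma H_pair_module_small: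
  assumes "nonadjacent C" "nonadjacent C'"
  shows "\<exists>N\<in>fg_modules (H n :: ('a::field, 'a mpoly set) module). mod_iso (H n) (H_pair_module C C') N"
proof (rule small_copy[OF H_pair_module_module[OF assms]])
  \<comment> \<open>The coordinates of the pair are recovered as the values at 0 and 1.\<close>
  show "inj_on (\<lambda>x :: 'a \<times> 'a. {\<lambda>k :: nat. if k = 0 then {Const (fst x)} else {Const (snd x)}}) (carrier (H_pair_module C C'))"
  proof (rule inj_onI)
    fix x y :: "'a \<times> 'a"
    assume "{\<lambda>k :: nat. if k = 0 then {Const (fst x)} else {Const (snd x)}} =
      {\<lambda>k. if k = 0 then {Const (fst y)} else {Const (snd y)}}"
    then have "(\<lambda>k :: nat. if k = 0 then {Const (fst x)} else {Const (snd x)}) =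
      (\<lambda>k. if k = 0 then {Const (fst y)} else {Const (snd y)})" by blast
    from fun_cong[OF this, of 0] fun_cong[OF this, of 1] show "x = y"
      by (simp add: prod_eq_iff inj_eq[OF Const_inj])
  qed
  show "\<exists>a\<in>carrier (H n). \<exists>b\<in>carrier (H n).
      x = a \<odot>\<^bsub>H_pair_module C C'\<^esub> (1, 0) \<oplus>\<^bsub>H_pair_module C C'\<^esub> b \<odot>\<^bsub>H_pair_module C C'\<^esub> (0, 1)"
    for x :: "'a \<times> 'a"
    by (intro bexI[of _ "H_coset n (Const (fst x))"] bexI[of _ "H_coset n (Const (snd x))"])
      (simp_all add: H_pair_module_def H_char_Const assms H_coset_closed H_poly_closed)
qed (simp_all add: H_pair_module_def)

text \<open>Taking the second summand as the submodule fixes the order of the classes: for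
  \<open>C' = insert m C\<close> the class belonging to the concatenation comes first.\<close>

lemma H_pair_module_exact:
  "short_exact (H n) (H_char_module C') (H_pair_module C C') (H_char_module C)"
  unfolding short_exact_def
  by (intro bexI[of _ "\<lambda>w. (0, w)"] bexI[of _ fst])
    (auto simp: H_pair_module_def mod_hom_def hom_def a_kernel_def' inj_on_def image_iff)

lemma H_class_pair:
  assumes "nonadjacent C" "nonadjacent C'"
  shows "H_class n (H_pair_module C C' :: ('a::field mpoly set, 'a \<times> 'a) module) =
    H_class n (H_char_module C') \<otimes>\<^bsub>G0_H\<^esub> H_class n (H_char_module C)"
proof -
  have "mod_class (H n) (H_pair_module C C' :: ('a mpoly set, 'a \<times> 'a) module) =
      mod_class (H n) (H_char_module C') \<otimes>\<^bsub>G0 (H n)\<^esub> mod_class (H n) (H_char_module C)"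
    by (intro mod_class_exact H_char_module_module H_pair_module_module H_pair_module_exact
        H_char_module_small H_pair_module_small assms)
  \<comment> \<open>In every degree other than \<open>n\<close> all three classes are
    trivial.\<close>
  moreover have "\<one>\<^bsub>G0 R\<^esub> \<otimes>\<^bsub>G0 R\<^esub> \<one>\<^bsub>G0 R\<^esub> = \<one>\<^bsub>G0 R\<^esub>" for R :: "('a, 'a mpoly set) module"
    using monoid.l_one[OF group.is_monoid[OF G0_group]] monoid.one_closed[OF group.is_monoid[OF G0_group]]
    by blast
  ultimately show ?thesis
    by (auto simp: H_class_def G0_H_def summand_inj_def fun_eq_iff)
qed

lemma H_class_cong:
  assumes "module_closed (H n) M" "mod_iso (H n) M N"
  shows "H_class n M = H_class n N"
  using mod_class_cong[OF assms] by (simp add: H_class_def)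

lemma H2_class_cong:
  assumes "module_closed (H2 m n) M" "mod_iso (H2 m n) M N"
  shows "H2_class m n M = H2_class m n N"
  using mod_class_cong[OF assms] by (simp add: H2_class_def)

lemma foldSetD_cong:
  assumes "(A, x) \<in> foldSetD D f e" "\<And>a. a \<in> A \<Longrightarrow> f a = g a"
  shows "(A, x) \<in> foldSetD D g e"
  using assms
proof (induction rule: foldSetD.induct)
  case (insertI x A y)
  then show ?case using foldSetD.insertI[of x A g y D e] by simp
qed (rule foldSetD.emptyI)

text \<open>The fold relation looks at a function only on \<open>A\<close>, so agreement there
  suffices, with no need to locate the values in the group. Hence the coproduct formula can be
  compared summand by summand.\<close>

lemma finprod_cong_no_carrier:
  assumes "\<And>a. a \<in> A \<Longrightarrow> f a = g a"
  shows "finprod G f A = finprod G g A"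
proof -
  have "(A, x) \<in> foldSetD (carrier G) (monoid.mult G \<circ> f) \<one>\<^bsub>G\<^esub> \<longleftrightarrow>
      (A, x) \<in> foldSetD (carrier G) (monoid.mult G \<circ> g) \<one>\<^bsub>G\<^esub>" for x
    using assms by (auto intro: foldSetD_cong)
  then show ?thesis by (simp add: finprod_def foldD_def)
qed

section \<open>Descents of compositions\<close>

text \<open>Both ends, 0 and the total, are included. The set then obeys simple recursions over
  lists, and \<open>descents_iff\<close> takes the ends away again.\<close>

definition psums :: "nat list \<Rightarrow> nat set" where
  "psums \<alpha> = psum \<alpha> ` {..length \<alpha>}"

lemma psums_Nil [simp]: "psums [] = {0}"
  by (simp add: psums_def psum_def)

lemma psums_Cons: "psums (a # \<alpha>) = insert 0 ((+) a ` psums \<alpha>)"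
proof -
  have "{..length (a # \<alpha>)} = insert 0 (Suc ` {..length \<alpha>})"
    by (simp add: atMost_Suc_eq_insert_0)
  then show ?thesis by (simp add: psums_def psum_def image_image)
qed

lemma zero_in_psums: "0 \<in> psums \<alpha>"
  by (cases \<alpha>) (simp_all add: psums_Cons)

lemma sum_list_in_psums: "sum_list \<alpha> \<in> psums \<alpha>"
  by (induction \<alpha>) (simp_all add: psums_Cons)

lemma psums_append: "psums (\<alpha> @ \<beta>) = psums \<alpha> \<union> (+) (sum_list \<alpha>) ` psums \<beta>"
proof (induction \<alpha>)
  case Nil
  then show ?case using zero_in_psums[of \<beta>] by auto
next
  case (Cons a \<alpha>)
  then show ?case by (simp add: psums_Cons image_Un image_image add.assoc)
qed

lemma psums_le: "d \<in> psums \<alpha> \<Longrightarrow> d \<le> sum_list \<alpha>"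
  by (induction \<alpha> arbitrary: d) (auto simp: psums_Cons)

lemma psum_Suc: "i < length \<alpha> \<Longrightarrow> psum \<alpha> (Suc i) = psum \<alpha> i + \<alpha> ! i"
  by (simp add: psum_def take_Suc_conv_app_nth)

lemma psum_mono: "i \<le> j \<Longrightarrow> psum \<alpha> i \<le> psum \<alpha> j"
proof -
  assume "i \<le> j"
  then have "take j \<alpha> = take i \<alpha> @ take (j - i) (drop i \<alpha>)"
    by (metis le_add_diff_inverse take_add)
  then show ?thesis by (simp add: psum_def)
qed

lemma psum_pos:
  assumes "is_composition \<alpha> n" "0 < i" "i \<le> length \<alpha>"
  shows "0 < psum \<alpha> i"
proof -
  have "psum \<alpha> (Suc 0) = psum \<alpha> 0 + \<alpha> ! 0" using assms by (intro psum_Suc) auto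
  moreover have "\<alpha> ! 0 \<in> set \<alpha>" using assms by (intro nth_mem) auto
  ultimately have "0 < psum \<alpha> (Suc 0)" using assms(1) by (simp add: is_composition_def psum_def)
  also have "\<dots> \<le> psum \<alpha> i" using assms(2) by (intro psum_mono) simp
  finally show ?thesis .
qed

lemma psum_less:
  assumes "is_composition \<alpha> n" "i < length \<alpha>"
  shows "psum \<alpha> i < n"
proof -
  have "\<alpha> ! i \<in> set \<alpha>" using assms(2) by simp
  then have "psum \<alpha> i < psum \<alpha> (Suc i)"
    using assms by (simp add: psum_Suc is_composition_def)
  also have "\<dots> \<le> psum \<alpha> (length \<alpha>)" using assms(2) by (intro psum_mono) simp
  also have "\<dots> = n" using assms(1) by (simp add: psum_def is_composition_def)
  finally show ?thesis .
qed

text \<open>The parts are positive, so among the partial sums only the empty one is 0 and only the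
  full one is \<open>n\<close>.\<close>

lemma descents_iff:
  assumes "is_composition \<alpha> n"
  shows "d \<in> descents \<alpha> \<longleftrightarrow> 0 < d \<and> d < n \<and> d \<in> psums \<alpha>"
proof
  assume "d \<in> descents \<alpha>"
  then obtain i where "d = psum \<alpha> i" "1 \<le> i" "i < length \<alpha>" by (auto simp: descents_def)
  then show "0 < d \<and> d < n \<and> d \<in> psums \<alpha>"
    using psum_pos[OF assms, of i] psum_less[OF assms, of i] by (auto simp: psums_def)
next
  assume d: "0 < d \<and> d < n \<and> d \<in> psums \<alpha>"
  then obtain i where i: "i \<le> length \<alpha>" "d = psum \<alpha> i" by (auto simp: psums_def)
  have "psum \<alpha> 0 = 0" by (simp add: psum_def)
  then have "i \<noteq> 0" using d i by (metis less_irrefl)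
  moreover have "i \<noteq> length \<alpha>" using d i assms by (auto simp: psum_def is_composition_def)
  ultimately show "d \<in> descents \<alpha>" using i by (auto simp: descents_def intro!: exI[of _ i])
qed

text \<open>Between two descents lies at least one inner part, and an inner part exceeds 1.\<close>

lemma nonadjacent_descents:
  assumes "\<alpha> \<propto> n"
  shows "nonadjacent (descents \<alpha>)"
  unfolding nonadjacent_def
proof (intro allI impI notI)
  fix d assume "d \<in> descents \<alpha>" "Suc d \<in> descents \<alpha>"
  then obtain i j where i: "d = psum \<alpha> i" "1 \<le> i" "i < length \<alpha>"
    and j: "Suc d = psum \<alpha> j" "1 \<le> j" "j < length \<alpha>" unfolding descents_def by blast
  show False
  proof (cases "j \<le> i")
    case True
    then show ?thesis using psum_mono[OF True, of \<alpha>] i j by simp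
  next
    case False
    then have ij: "Suc i \<le> j" by simp
    \<comment> \<open>The part added in passing from \<open>psum \<alpha> i\<close> to the next
      partial sum has number \<open>i + 1\<close> counted from 1; it is inner because
      \<open>1 < Suc i \<le> j < length \<alpha>\<close>.\<close>
    then have "1 < \<alpha> ! (Suc i - 1)" using assms i j unfolding admissible_def by (metis Suc_le_lessD le_less_trans le_imp_less_Suc One_nat_def)
    then show ?thesis using psum_mono[OF ij, of \<alpha>] i j by (simp add: psum_Suc)
  qed
qed

lemma is_composition_append:
  "is_composition \<alpha> m \<Longrightarrow> is_composition \<beta> n \<Longrightarrow> is_composition (\<alpha> @ \<beta>) (m + n)"
  by (auto simp: is_composition_def)

lemma composition_pos: "is_composition \<alpha> m \<Longrightarrow> \<alpha> \<noteq> [] \<Longrightarrow> 0 < m"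
  by (cases \<alpha>) (auto simp: is_composition_def)

lemma descents_append:
  assumes "is_composition \<alpha> m" "is_composition \<beta> n" "\<alpha> \<noteq> []" "\<beta> \<noteq> []"
  shows "descents (\<alpha> @ \<beta>) = insert m (descents \<alpha> \<union> (+) m ` descents \<beta>)"
proof (rule Set.set_eqI)
  fix d
  have m: "sum_list \<alpha> = m" "sum_list \<beta> = n" using assms by (simp_all add: is_composition_def)
  have "0 < m" "0 < n" using assms composition_pos by blast+
  then show "d \<in> descents (\<alpha> @ \<beta>) \<longleftrightarrow> d \<in> insert m (descents \<alpha> \<union> (+) m ` descents \<beta>)"
    using zero_in_psums[of \<beta>] sum_list_in_psums[of \<alpha>] psums_le[of d \<alpha>]
    by (auto simp: image_iff descents_iff[OF is_composition_append[OF assms(1,2)]] descents_iff[OF assms(1)]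
        descents_iff[OF assms(2)] psums_append m)
qed

text \<open>Merging two parts leaves the partial sums on either side unchanged; only the cut at
  \<open>m\<close> disappears.\<close>

lemma descents_near_concat:
  assumes "is_composition \<alpha> m" "is_composition \<beta> n" "\<alpha> \<noteq> []" "\<beta> \<noteq> []"
  shows "descents (\<alpha> \<rhd> \<beta>) = descents \<alpha> \<union> (+) m ` descents \<beta>"
proof (rule Set.set_eqI)
  fix d
  obtain a x where \<alpha>: "\<alpha> = a @ [x]" using assms(3) by (metis rev_exhaust)
  obtain y b where \<beta>: "\<beta> = y # b" using assms(4) by (cases \<beta>) auto
  have c: "is_composition (\<alpha> \<rhd> \<beta>) (m + n)"
    using assms by (auto simp: \<alpha> \<beta> is_composition_def near_concat_def)
  have eqs: "m = sum_list a + x" "n = y + sum_list b" "0 < x" "0 < y"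
    using assms by (auto simp: \<alpha> \<beta> is_composition_def)
  show "d \<in> descents (\<alpha> \<rhd> \<beta>) \<longleftrightarrow> d \<in> descents \<alpha> \<union> (+) m ` descents \<beta>"
    using sum_list_in_psums[of a] psums_le[of d a] eqs
    unfolding Un_iff image_iff Bex_def descents_iff[OF c] descents_iff[OF assms(1)] descents_iff[OF assms(2)]
    by (auto simp: \<alpha> \<beta> near_concat_def psums_append psums_Cons)
qed

text \<open>The only parts that concatenation can turn into inner ones are the last of
  \<open>\<alpha>\<close> and the first of \<open>\<beta>\<close>. If such a part is 1, it puts a
  descent right next to \<open>m\<close>.\<close>

lemma not_admissible_append:
  assumes \<alpha>: "\<alpha> \<propto> m" and \<beta>: "\<beta> \<propto> n" and "\<alpha> \<noteq> []" "\<beta> \<noteq> []" and not: "\<not> \<alpha> @ \<beta> \<propto> m + n"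
  shows "m - 1 \<in> descents \<alpha> \<and> 1 < m \<or> 1 \<in> descents \<beta>"
proof -
  have c: "is_composition \<alpha> m" "is_composition \<beta> n" using \<alpha> \<beta> by (simp_all add: admissible_def)
  obtain i where i: "1 < i" "i < length (\<alpha> @ \<beta>)" "\<not> 1 < (\<alpha> @ \<beta>) ! (i - 1)"
    using not is_composition_append[OF c] by (auto simp: admissible_def)
  have "(\<alpha> @ \<beta>) ! (i - 1) \<in> set (\<alpha> @ \<beta>)" using i by (intro nth_mem) simp
  then have one: "(\<alpha> @ \<beta>) ! (i - 1) = 1"
    using i(3) is_composition_append[OF c] unfolding is_composition_def by (metis Suc_lessI One_nat_def)
  consider "i < length \<alpha>" | "i = length \<alpha>" | "i = Suc (length \<alpha>)" | "Suc (length \<alpha>) < i" by linarith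
  then show ?thesis
  proof cases
    case 1
    then have "1 < \<alpha> ! (i - 1)" using \<alpha> i(1) unfolding admissible_def by blast
    then show ?thesis using 1 i(3) by (simp add: nth_append less_imp_diff_less)
  next
    case 2
    \<comment> \<open>The last part of \<open>\<alpha>\<close> is 1, so the partial sum before it is
      \<open>m - 1\<close>; as \<open>1 < i\<close>, that sum is a descent.\<close>
    have "psum \<alpha> (Suc (i - 1)) = psum \<alpha> (i - 1) + \<alpha> ! (i - 1)"
      using 2 i by (intro psum_Suc) simp
    moreover have "i - 1 < length \<alpha>" using 2 i(1) by simp
    ultimately have "psum \<alpha> (i - 1) + 1 = m"
      using 2 i(1) one c(1) by (simp add: nth_append psum_def is_composition_def)
    moreover have "psum \<alpha> (i - 1) \<in> descents \<alpha>" using 2 i unfolding descents_def by auto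
    moreover have "0 < psum \<alpha> (i - 1)" using 2 i by (intro psum_pos[OF c(1)]) auto
    ultimately show ?thesis by auto
  next
    case 3
    \<comment> \<open>Being inner in the concatenation, the first part of \<open>\<beta>\<close> is
      followed by another one, so its partial sum 1 is a descent.\<close>
    then have "\<beta> ! 0 = 1" "1 < length \<beta>" using i one by (auto simp: nth_append)
    then have "psum \<beta> 1 = 1" by (cases \<beta>) (auto simp: psum_def)
    then show ?thesis using \<open>1 < length \<beta>\<close> unfolding descents_def by force
  next
    case 4
    define k where "k = i - length \<alpha>"
    have "1 < k" "k < length \<beta>" "(\<alpha> @ \<beta>) ! (i - 1) = \<beta> ! (k - 1)"
      using 4 i by (auto simp: k_def nth_append)
    moreover from this have "1 < \<beta> ! (k - 1)" using \<beta> unfolding admissible_def by blast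
    ultimately show ?thesis using i(3) by simp
  qed
qed

section \<open>Cutting a composition at a position\<close>

lemma cut_index:
  assumes "i \<le> sum_list \<alpha>"
  shows "cut_index \<alpha> i \<le> length \<alpha>" "psum \<alpha> (cut_index \<alpha> i) \<le> i"
    "\<And>r. r \<le> length \<alpha> \<Longrightarrow> psum \<alpha> r \<le> i \<Longrightarrow> r \<le> cut_index \<alpha> i"
proof -
  let ?P = "\<lambda>r. r \<le> length \<alpha> \<and> psum \<alpha> r \<le> i"
  have "?P (cut_index \<alpha> i)"
    unfolding cut_index_def
    by (rule GreatestI_nat[where k = 0 and b = "length \<alpha>"]) (auto simp: psum_def)
  then show "cut_index \<alpha> i \<le> length \<alpha>" "psum \<alpha> (cut_index \<alpha> i) \<le> i" by auto
  show "r \<le> cut_index \<alpha> i" if "r \<le> length \<alpha>" "psum \<alpha> r \<le> i" for r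
    unfolding cut_index_def
    by (rule Greatest_le_nat[where b = "length \<alpha>"]) (use that in auto)
qed

lemma is_composition_sublists:
  assumes "is_composition \<alpha> n"
  shows "is_composition (take r \<alpha>) (psum \<alpha> r)" "is_composition (drop r \<alpha>) (n - psum \<alpha> r)"
proof -
  have "sum_list (take r \<alpha> @ drop r \<alpha>) = n" using assms by (simp add: is_composition_def)
  then have "sum_list (drop r \<alpha>) = n - psum \<alpha> r" by (simp add: psum_def del: append_take_drop_id)
  then show "is_composition (take r \<alpha>) (psum \<alpha> r)" "is_composition (drop r \<alpha>) (n - psum \<alpha> r)"
    using assms by (auto simp: is_composition_def psum_def dest: in_set_takeD in_set_dropD)
qed

lemma psums_split: "psums \<alpha> = psums (take r \<alpha>) \<union> (+) (psum \<alpha> r) ` psums (drop r \<alpha>)"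
  using psums_append[of "take r \<alpha>" "drop r \<alpha>"] by (simp add: psum_def)

lemma descents_comp_le:
  assumes \<alpha>: "is_composition \<alpha> m" and i: "i \<le> m"
  shows "descents (comp_le \<alpha> i) = descents \<alpha> \<inter> {..<i}"
proof (rule Set.set_eqI)
  fix d
  define r where "r = cut_index \<alpha> i"
  have "i \<le> sum_list \<alpha>" using \<alpha> i by (simp add: is_composition_def)
  note r = cut_index[OF this, folded r_def]
  have le: "comp_le \<alpha> i = take r \<alpha> @ (if i - psum \<alpha> r = 0 then [] else [i - psum \<alpha> r])"
    by (simp add: comp_le_def r_def Let_def)
  have c: "is_composition (comp_le \<alpha> i) i"
    using is_composition_sublists(1)[OF \<alpha>, of r] r(2) unfolding le by (auto simp: is_composition_def)
  have s: "sum_list (take r \<alpha>) = psum \<alpha> r" by (simp add: psum_def)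
  have "psums (comp_le \<alpha> i) \<inter> {..<i} = psums (take r \<alpha>) \<inter> {..<i}"
    using sum_list_in_psums[of "take r \<alpha>"] unfolding le by (auto simp: psums_append psums_Cons s)
  moreover have "psums \<alpha> \<inter> {..<i} = psums (take r \<alpha>) \<inter> {..<i}"
  proof -
    \<comment> \<open>By maximality of \<open>r\<close> the next partial sum exceeds
      \<open>i\<close>, so the dropped parts contribute only their empty sum below
      \<open>i\<close>.\<close>
    have "e = 0" if "e \<in> psums (drop r \<alpha>)" "psum \<alpha> r + e < i" for e
    proof (cases "r < length \<alpha>")
      case True
      then have "i < psum \<alpha> (Suc r)" using r(3)[of "Suc r"] by fastforce
      then show ?thesis
        using that True by (auto simp: Cons_nth_drop_Suc[symmetric] psums_Cons psum_Suc)
    qed (use that in auto)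
    then show ?thesis
      using sum_list_in_psums[of "take r \<alpha>"] unfolding psums_split[of \<alpha> r] by (fastforce simp: s)
  qed
  ultimately have "d \<in> psums (comp_le \<alpha> i) \<longleftrightarrow> d \<in> psums \<alpha>" if "d < i"
    using that by blast
  then show "d \<in> descents (comp_le \<alpha> i) \<longleftrightarrow> d \<in> descents \<alpha> \<inter> {..<i}"
    using i by (auto simp: descents_iff[OF c] descents_iff[OF \<alpha>])
qed

lemma descents_comp_gt:
  assumes \<alpha>: "is_composition \<alpha> m" and i: "i \<le> m"
  shows "descents (comp_gt \<alpha> i) = {d. 0 < d \<and> d + i \<in> descents \<alpha>}"
proof (cases "i = m")
  case True
  then show ?thesis
    using \<alpha> by (auto simp: comp_gt_def descents_iff[OF \<alpha>]) (auto simp: is_composition_def descents_def)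
next
  case False
  define r where "r = cut_index \<alpha> i"
  have m: "sum_list \<alpha> = m" using \<alpha> by (simp add: is_composition_def)
  note r = cut_index[of i \<alpha>, unfolded m, OF i, folded r_def]
  have "r \<noteq> length \<alpha>" using r(2) False i m by (auto simp: psum_def)
  then have rl: "r < length \<alpha>" using r(1) by simp
  then have \<sigma>: "i < psum \<alpha> (Suc r)" using r(3)[of "Suc r"] by fastforce
  let ?\<sigma> = "psum \<alpha> (Suc r)"
  have gt: "comp_gt \<alpha> i = (?\<sigma> - i) # drop (Suc r) \<alpha>"
    using False by (simp add: comp_gt_def r_def Let_def m)
  have \<sigma>m: "?\<sigma> \<le> m" using psum_mono[of "Suc r" "length \<alpha>" \<alpha>] rl m by (simp add: psum_def)
  have c: "is_composition (comp_gt \<alpha> i) (m - i)"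
    using is_composition_sublists(2)[OF \<alpha>, of "Suc r"] \<sigma> \<sigma>m unfolding gt by (auto simp: is_composition_def)
  show ?thesis
  proof (rule Set.set_eqI)
    fix d
    \<comment> \<open>Consequently a partial sum of \<open>\<alpha>\<close> beyond \<open>i\<close>
      is \<open>?\<sigma>\<close> plus a partial sum of the remaining parts.\<close>
    have small: "e \<le> i \<or> e = ?\<sigma>" if e: "e \<in> psums (take (Suc r) \<alpha>)" for e
    proof -
      obtain k where "k \<le> length (take (Suc r) \<alpha>)" "e = psum (take (Suc r) \<alpha>) k"
        using e by (auto simp: psums_def)
      then have "k \<le> Suc r" "e = psum \<alpha> k" by (simp_all add: psum_def min_absorb1)
      then show ?thesis using psum_mono[of k r \<alpha>] r(2) by (cases "k = Suc r") auto
    qed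
    have "d \<in> psums (comp_gt \<alpha> i) \<longleftrightarrow> d + i \<in> psums \<alpha>" if pos: "0 < d"
    proof
      assume "d \<in> psums (comp_gt \<alpha> i)"
      then obtain e where "e \<in> psums (drop (Suc r) \<alpha>)" "d = ?\<sigma> - i + e"
        using pos unfolding gt by (auto simp: psums_Cons)
      then show "d + i \<in> psums \<alpha>" using \<sigma> unfolding psums_split[of \<alpha> "Suc r"] by auto
    next
      assume "d + i \<in> psums \<alpha>"
      then obtain e where "e \<in> psums (drop (Suc r) \<alpha>)" "d + i = ?\<sigma> + e"
        using small[of "d + i"] pos zero_in_psums unfolding psums_split[of \<alpha> "Suc r"] by force
      then have "d = (?\<sigma> - i) + e" using \<sigma> by simp
      then show "d \<in> psums (comp_gt \<alpha> i)"
        using \<open>e \<in> _\<close> unfolding gt by (simp add: psums_Cons)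
    qed
    then show "d \<in> descents (comp_gt \<alpha> i) \<longleftrightarrow> d \<in> {d. 0 < d \<and> d + i \<in> descents \<alpha>}"
      using i by (auto simp: descents_iff[OF c] descents_iff[OF \<alpha>])
  qed
qed

section \<open>Product and coproduct\<close>

lemma H_tensor_parametrization:
  assumes "nonadjacent D" "nonadjacent E"
  obtains h :: "'a::field \<Rightarrow> ('a \<times> 'a \<Rightarrow>\<^sub>0 int) set"
    where "H_induction m n D E (H_tensor m n (H_char_module D) (H_char_module E)) h"
proof -
  let ?T = "H_tensor m n (H_char_module D) (H_char_module E) :: ('a H2_elem, ('a \<times> 'a \<Rightarrow>\<^sub>0 int) set) module"
  have "mod_iso (H2 m n) (type_module (\<lambda>U v. H2_char D E U * v)) ?T"
    by (rule H_tensor_iso[OF assms])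
  then obtain h :: "'a \<Rightarrow> ('a \<times> 'a \<Rightarrow>\<^sub>0 int) set"
    where h: "bij_betw h UNIV (carrier ?T)"
      "\<And>u v. h (u + v) = h u \<oplus>\<^bsub>?T\<^esub> h v"
      "\<And>r v. r \<in> carrier (H2 m n) \<Longrightarrow> h (H2_char D E r * v) = r \<odot>\<^bsub>?T\<^esub> h v"
    unfolding mod_iso_def mod_hom_def by (auto simp: hom_def)
  then have "H_induction m n D E ?T h"
    using assms by unfold_locales
  then show ?thesis by (rule that)
qed

lemma admissible_composition: "\<alpha> \<propto> m \<Longrightarrow> is_composition \<alpha> m"
  by (simp add: admissible_def)

lemma H_product_admissible:
  assumes \<alpha>: "\<alpha> \<propto> m" and \<beta>: "\<beta> \<propto> n"
  shows "H_product m n (simple_module \<alpha> :: ('a::field mpoly set, 'a) module) (simple_module \<beta>) =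
    (if \<alpha> = [] \<or> \<beta> = [] then H_class (m + n) (simple_module (\<alpha> @ \<beta>))
     else if \<alpha> @ \<beta> \<propto> m + n
     then H_class (m + n) (simple_module (\<alpha> @ \<beta>)) \<otimes>\<^bsub>G0_H\<^esub> H_class (m + n) (simple_module (\<alpha> \<rhd> \<beta>))
     else H_class (m + n) (simple_module (\<alpha> \<rhd> \<beta>)))"
proof -
  let ?D = "descents \<alpha>" and ?E = "descents \<beta>"
  let ?T = "H_tensor m n (H_char_module ?D) (H_char_module ?E) :: ('a H2_elem, ('a \<times> 'a \<Rightarrow>\<^sub>0 int) set) module"
  let ?I = "induced_module (H2 m n) (H (m + n)) (H_embed m n) ?T"
  \<comment> \<open>The completion with coordinate 0 at \<open>m\<close>. If both compositions are
    nonempty, it is the descent set of \<open>\<alpha> \<rhd> \<beta>\<close>.\<close>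
  define C where "C = ?D \<union> (+) m ` ?E"
  note c = admissible_composition[OF \<alpha>] admissible_composition[OF \<beta>]
  have na: "nonadjacent ?D" "nonadjacent ?E"
    using \<alpha> \<beta> by (simp_all add: nonadjacent_descents)
  have Dm: "0 < d \<and> d < m" if "d \<in> ?D" for d using that descents_iff[OF c(1)] by blast
  have En: "0 < d \<and> d < n" if "d \<in> ?E" for d using that descents_iff[OF c(2)] by blast
  obtain h where "H_induction m n ?D ?E ?T h"
    using H_tensor_parametrization[OF na, of m n] by blast
  then interpret H_induction m n ?D ?E ?T h .
  have mC: "m \<notin> C" using Dm En by (fastforce simp: C_def)
  have Ci: "i \<in> C \<longleftrightarrow> i \<in> ?D" if "i < m" for i using that by (auto simp: C_def)
  have Cj: "i + m \<in> C \<longleftrightarrow> i \<in> ?E" for i using Dm by (fastforce simp: C_def image_iff)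
  have naC: "nonadjacent C"
    unfolding nonadjacent_def
  proof (intro allI impI notI)
    fix i assume i: "i \<in> C" "Suc i \<in> C"
    \<comment> \<open>Two adjacent indices lie in the left block, lie in the right block, or include
      \<open>m\<close>, which \<open>C\<close> avoids.\<close>
    consider "Suc i < m" | "i = m \<or> Suc i = m" | k where "i = k + m"
      by (metis add.commute less_imp_add_positive not_less_eq linorder_neqE_nat)
    then show False
    proof cases
      case 1
      then show ?thesis using i na(1) Ci[of i] Ci[of "Suc i"] by (auto simp: nonadjacent_def)
    next
      case 2
      then show ?thesis using i mC by auto
    next
      case (3 k)
      then show ?thesis using i na(2) Cj[of k] Cj[of "Suc k"] by (auto simp: nonadjacent_def)
    qed
  qed
  have C: "restricts C"
    unfolding restricts_def using naC Ci Cj by auto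
  have prod: "H_product m n (simple_module \<alpha>) (simple_module \<beta>) = H_class (m + n) ?I"
    by (simp add: H_product_def simple_module_eq)
  show ?thesis
  proof (cases "\<alpha> = [] \<or> \<beta> = [] \<or> \<not> \<alpha> @ \<beta> \<propto> m + n")
    case True
    \<comment> \<open>An empty composition makes \<open>m = 0\<close> or \<open>n = 0\<close>, and
      then \<open>m\<close> is not in the range. Only failing admissibility is left to be
      treated.\<close>
    have "\<exists>j\<in>{1..<m + n}. j \<in> C \<and> (j + 1 = m \<or> j = m + 1)" if m: "m \<in> {1..<m + n}"
    proof -
      have "\<alpha> \<noteq> []" "\<beta> \<noteq> []" using m c by (auto simp: is_composition_def)
      then consider "m - 1 \<in> ?D" "1 < m" | "1 \<in> ?E"
        using True not_admissible_append[OF \<alpha> \<beta>] by blast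
      then show ?thesis
      proof cases
        case 1
        then show ?thesis using Dm by (intro bexI[of _ "m - 1"]) (auto simp: C_def)
      next
        case 2
        then show ?thesis using En[of 1] Cj[of 1] by (intro bexI[of _ "m + 1"]) auto
      qed
    qed
    then have "mod_iso (H (m + n)) (H_char_module C) ?I"
      by (rule induced_module_iso[OF C mC])
    then have "H_class (m + n) ?I = H_class (m + n) (H_char_module C :: ('a mpoly set, 'a) module)"
      by (rule H_class_cong[OF type_module_closed, symmetric])
    \<comment> \<open>With an empty composition there are no two parts for \<open>\<rhd>\<close> to
      merge; the product is the class of the other factor.\<close>
    moreover have "C = descents (\<alpha> @ \<beta>)" if "\<alpha> = [] \<or> \<beta> = []"
      using that c by (auto simp: C_def descents_def is_composition_def)
    moreover have "C = descents (\<alpha> \<rhd> \<beta>)" if "\<alpha> \<noteq> []" "\<beta> \<noteq> []"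
      using descents_near_concat[OF c that] by (simp add: C_def)
    ultimately show ?thesis
      unfolding prod using True by (auto simp: simple_module_eq)
  next
    case False
    then have ne: "\<alpha> \<noteq> []" "\<beta> \<noteq> []" and adm: "\<alpha> @ \<beta> \<propto> m + n" by auto
    have m: "m \<in> {1..<m + n}" using composition_pos[OF c(1) ne(1)] composition_pos[OF c(2) ne(2)] by simp
    have C': "insert m C = descents (\<alpha> @ \<beta>)" and C'': "C = descents (\<alpha> \<rhd> \<beta>)"
      using descents_append[OF c ne] descents_near_concat[OF c ne] by (simp_all add: C_def)
    \<comment> \<open>Here admissibility of the concatenation enters: it makes the point with
      coordinate 1 at \<open>m\<close> satisfy the relations.\<close>
    have na': "nonadjacent (insert m C)"
      unfolding C' by (rule nonadjacent_descents[OF adm])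
    have "restricts (insert m C)"
      unfolding restricts_def using na' Ci Cj by auto
    then have "mod_iso (H (m + n)) (H_pair_module C (insert m C)) ?I"
      unfolding H_pair_module_def by (rule induced_module_iso_pair[OF C mC _ m])
    then have "H_class (m + n) ?I = H_class (m + n) (H_pair_module C (insert m C) :: ('a mpoly set, 'a \<times> 'a) module)"
      by (rule H_class_cong[symmetric, rotated]) (simp add: H_pair_module_def type_module_closed)
    also have "\<dots> = H_class (m + n) (H_char_module (insert m C)) \<otimes>\<^bsub>G0_H\<^esub> H_class (m + n) (H_char_module C)"
      by (rule H_class_pair[OF naC na'])
    finally show ?thesis
      unfolding prod using ne adm by (simp add: simple_module_eq C' C''[symmetric])
  qed
qed

text \<open>A descent of \<open>\<alpha>\<close> equal to \<open>i\<close> is forgotten by both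
  pieces of the cut composition, just as \<open>x_i\<close> is missing from the subalgebra; all
  other coordinates match.\<close>

lemma H_coproduct_admissible:
  assumes \<alpha>: "\<alpha> \<propto> m"
  shows "H_coproduct m (simple_module \<alpha> :: ('a::field mpoly set, 'a) module) =
    finprod G0_H2 (\<lambda>i. H2_class i (m - i)
      (H_tensor i (m - i) (simple_module (comp_le \<alpha> i)) (simple_module (comp_gt \<alpha> i)))) {0..m}"
  unfolding H_coproduct_def
proof (rule finprod_cong_no_carrier)
  fix i assume "i \<in> {0..m}"
  then have i: "i \<le> m" by simp
  note c = admissible_composition[OF \<alpha>]
  let ?D = "descents (comp_le \<alpha> i)" and ?E = "descents (comp_gt \<alpha> i)"
  have na: "nonadjacent (descents \<alpha>)" using \<alpha> by (rule nonadjacent_descents)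
  then have na': "nonadjacent ?D" "nonadjacent ?E"
    unfolding descents_comp_le[OF c i] descents_comp_gt[OF c i] nonadjacent_def by auto
  have "mod_iso (H2 i (m - i)) (restrict_scalars (H_embed i (m - i)) (H_char_module (descents \<alpha>) :: ('a mpoly set, 'a) module))
    (H_tensor i (m - i) (H_char_module ?D) (H_char_module ?E))"
    by (rule H_restriction_iso[OF na na'])
      (auto simp: descents_comp_le[OF c i] descents_comp_gt[OF c i])
  then show "H2_class i (m - i) (restrict_scalars (H_embed i (m - i)) (simple_module \<alpha> :: ('a mpoly set, 'a) module)) =
    H2_class i (m - i) (H_tensor i (m - i) (simple_module (comp_le \<alpha> i)) (simple_module (comp_gt \<alpha> i)))"
    unfolding simple_module_eq
    by (rule H2_class_cong[rotated]) (simp add: module_closed_def restrict_scalars_def)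
qed

theorem proposition7p5:
  fixes \<alpha> \<beta> :: "nat list" and m n :: nat
  assumes "\<alpha> \<propto> m" and "\<beta> \<propto> n"
  shows "H_product m n (simple_module \<alpha> :: ('a::field mpoly set, 'a) module) (simple_module \<beta>) =
           (if \<alpha> = [] \<or> \<beta> = [] then H_class (m + n) (simple_module (\<alpha> @ \<beta>))
            else if \<alpha> @ \<beta> \<propto> m + n
            then H_class (m + n) (simple_module (\<alpha> @ \<beta>))
                   \<otimes>\<^bsub>G0_H\<^esub> H_class (m + n) (simple_module (\<alpha> \<rhd> \<beta>))
            else H_class (m + n) (simple_module (\<alpha> \<rhd> \<beta>))) \<and>
         H_coproduct m (simple_module \<alpha> :: ('a mpoly set, 'a) module) =
           finprod G0_H2
             (\<lambda>i. H2_class i (m - i)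
                (H_tensor i (m - i) (simple_module (comp_le \<alpha> i)) (simple_module (comp_gt \<alpha> i))))
             {0..m}"
  using H_product_admissible[OF assms] H_coproduct_admissible[OF assms(1)] by blast

end
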